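(* ($\mathsf{ZF}$) Suppose that $\aleph_0<\kappa=\mathrm{cf}(\lambda)<\lambda$ and that $\kappa$ carries a normal measure $\mathscr{U}$. In addition, suppose that $\langle\lambda_i\mid i<\kappa\rangle$ is a sequence of cardinals cofinal in $\lambda$ admitting a family $\langle\mathscr{U}_i\mid i<\kappa\rangle$ such that for every $i<\kappa$: (a) $\mathscr{U}_i$ is a normal filter over $\lambda_i$ whose dual ideal contains $[\lambda_i]^{<\lambda_i}$; (b) $\mathrm{Gal}_{\mathrm{Def}}(\mathscr{U},\lambda_i,\lambda_i)$ holds. Then $\lambda\rightarrow(\lambda,\omega+1)^2$.
   Context: The Axiom of Choice is not assumed. A normal measure on $\kappa$ is a non-principal $\kappa$-complete normal ultrafilter over $\kappa$. $\mathrm{Gal}_{\mathrm{Def}}(\mathscr{U},\mu,\mu)$ means: for every sequence $\mathcal{C}=\langle C_\alpha\mid\alpha<\mu\rangle$ of elements of $\mathscr{U}$ (repetitions allowed) there is a subsequence $\langle C_{\rho_j}\mid j<\mu\rangle$ (with pairwise distinct indices $\rho_j$), definable from $\mathcal{C}$, such that $\bigcap_{j<\mu}C_{\rho_j}\in\mathscr{U}$. "Definable from $\mathcal{C}$" is meant in the sense of the language of set theory with $\mathcal{C}$ as a parameter; the intention is that such subsequences can be picked for many sequences $\mathcal{C}$ simultaneously without using the Axiom of Choice. $\lambda\rightarrow(\alpha,\beta)^2$ means: for every $c\colon[\lambda]^2\to 2$, either there is $A\subseteq\lambda$ of order type $\alpha$ such that $c$ is constantly $0$ on $[A]^2$, or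 there is $B\subseteq\lambda$ of order type $\beta$ such that $c$ is constantly $1$ on $[B]^2$. *)

theory Defs
  imports Main
begin

text \<open>
  HOL has the axiom of choice and no definability predicate, so a theorem of ZF is rendered as a
  statement about an arbitrary first-order model \<open>(M, E)\<close> of ZF without choice.
  The domain \<open>M\<close> is a type, \<open>E x y\<close> reads ``\<open>x\<close> is an element of \<open>y\<close>'', and the model need not be
  well-founded or transitive.  Every set-theoretic notion below is the one of the model: sets,
  functions and sequences are elements of \<open>M\<close>.  The only notion that is not internal is
  definability, where the defining formula is a genuine (standard) formula.
\<close>

section \<open>The language of set theory\<close>

datatype fm =
    FMem nat nat
  | FEq nat nat
  | FNeg fm
  | FConj fm fm
  | FAll nat fm

primrec fv :: "fm \<Rightarrow> nat set" where
  "fv (FMem m n) = {m, n}"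
| "fv (FEq m n) = {m, n}"
| "fv (FNeg p) = fv p"
| "fv (FConj p q) = fv p \<union> fv q"
| "fv (FAll n p) = fv p - {n}"

primrec sat :: "('m \<Rightarrow> 'm \<Rightarrow> bool) \<Rightarrow> fm \<Rightarrow> (nat \<Rightarrow> 'm) \<Rightarrow> bool" where
  "sat E (FMem m n) v = E (v m) (v n)"
| "sat E (FEq m n) v = (v m = v n)"
| "sat E (FNeg p) v = (\<not> sat E p v)"
| "sat E (FConj p q) v = (sat E p v \<and> sat E q v)"
| "sat E (FAll n p) v = (\<forall>x. sat E p (v(n := x)))"

definition definable_from :: "('m \<Rightarrow> 'm \<Rightarrow> bool) \<Rightarrow> 'm \<Rightarrow> 'm \<Rightarrow> bool" where
  "definable_from E c a \<longleftrightarrow>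
     (\<exists>p. fv p \<subseteq> {0, 1} \<and> (\<forall>v x. sat E p (v(0 := x, 1 := c)) \<longleftrightarrow> x = a))"

section \<open>Models of ZF\<close>

definition elts :: "('m \<Rightarrow> 'm \<Rightarrow> bool) \<Rightarrow> 'm \<Rightarrow> 'm set" where
  "elts E x = {y. E y x}"

text \<open>In separation variable \<open>0\<close>, in replacement variables \<open>0\<close> and \<open>1\<close> are the arguments of the
  formula; the values of \<open>v\<close> at its other free variables are the parameters.\<close>

definition ZF_model :: "('m \<Rightarrow> 'm \<Rightarrow> bool) \<Rightarrow> bool" where
  "ZF_model E \<longleftrightarrow>
     (\<forall>x y. elts E x = elts E y \<longrightarrow> x = y) \<and>
     (\<forall>x. elts E x \<noteq> {} \<longrightarrow> (\<exists>y\<in>elts E x. elts E y \<inter> elts E x = {})) \<and>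
     (\<forall>x y. \<exists>z. elts E z = {x, y}) \<and>
     (\<forall>x. \<exists>z. elts E z = (\<Union>y\<in>elts E x. elts E y)) \<and>
     (\<forall>x. \<exists>z. elts E z = {y. elts E y \<subseteq> elts E x}) \<and>
     (\<exists>w. (\<exists>z\<in>elts E w. elts E z = {}) \<and>
          (\<forall>x\<in>elts E w. \<exists>y\<in>elts E w. elts E y = insert x (elts E x))) \<and>
     (\<forall>p v x. \<exists>z. elts E z = {y \<in> elts E x. sat E p (v(0 := y))}) \<and>
     (\<forall>p v x.
        (\<forall>y\<in>elts E x. \<forall>z z'. sat E p (v(0 := y, 1 := z)) \<longrightarrow>
                              sat E p (v(0 := y, 1 := z')) \<longrightarrow> z = z') \<longrightarrow>
        (\<exists>w. elts E w = {z. \<exists>y\<in>elts E x. sat E p (v(0 := y, 1 := z))}))"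

section \<open>Functions and sequences\<close>

definition is_opair :: "('m \<Rightarrow> 'm \<Rightarrow> bool) \<Rightarrow> 'm \<Rightarrow> 'm \<Rightarrow> 'm \<Rightarrow> bool" where
  "is_opair E a b p \<longleftrightarrow>
     (\<exists>s t. elts E s = {a} \<and> elts E t = {a, b} \<and> elts E p = {s, t})"

definition is_seq :: "('m \<Rightarrow> 'm \<Rightarrow> bool) \<Rightarrow> 'm \<Rightarrow> 'm \<Rightarrow> bool" where
  "is_seq E A f \<longleftrightarrow>
     (\<forall>p\<in>elts E f. \<exists>a\<in>elts E A. \<exists>b. is_opair E a b p) \<and>
     (\<forall>a\<in>elts E A. \<exists>!b. \<exists>p\<in>elts E f. is_opair E a b p)"

definition app :: "('m \<Rightarrow> 'm \<Rightarrow> bool) \<Rightarrow> 'm \<Rightarrow> 'm \<Rightarrow> 'm" where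
  "app E f a = (THE b. \<exists>p\<in>elts E f. is_opair E a b p)"

definition is_map :: "('m \<Rightarrow> 'm \<Rightarrow> bool) \<Rightarrow> 'm \<Rightarrow> 'm \<Rightarrow> 'm \<Rightarrow> bool" where
  "is_map E A B f \<longleftrightarrow> is_seq E A f \<and> (\<forall>a\<in>elts E A. app E f a \<in> elts E B)"

definition is_bij :: "('m \<Rightarrow> 'm \<Rightarrow> bool) \<Rightarrow> 'm \<Rightarrow> 'm \<Rightarrow> 'm \<Rightarrow> bool" where
  "is_bij E A B f \<longleftrightarrow> is_map E A B f \<and> bij_betw (app E f) (elts E A) (elts E B)"

section \<open>Ordinals and cardinals\<close>

text \<open>Well-foundedness of membership on an ordinal is given by the axiom of foundation.\<close>

definition is_ord :: "('m \<Rightarrow> 'm \<Rightarrow> bool) \<Rightarrow> 'm \<Rightarrow> bool" where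
  "is_ord E a \<longleftrightarrow>
     (\<forall>x\<in>elts E a. elts E x \<subseteq> elts E a) \<and>
     (\<forall>x\<in>elts E a. \<forall>y\<in>elts E a. E x y \<or> x = y \<or> E y x)"

definition is_zero :: "('m \<Rightarrow> 'm \<Rightarrow> bool) \<Rightarrow> 'm \<Rightarrow> bool" where
  "is_zero E z \<longleftrightarrow> elts E z = {}"

definition is_succ :: "('m \<Rightarrow> 'm \<Rightarrow> bool) \<Rightarrow> 'm \<Rightarrow> 'm \<Rightarrow> bool" where
  "is_succ E x y \<longleftrightarrow> elts E y = insert x (elts E x)"

definition is_limit :: "('m \<Rightarrow> 'm \<Rightarrow> bool) \<Rightarrow> 'm \<Rightarrow> bool" where
  "is_limit E a \<longleftrightarrow> is_ord E a \<and> \<not> is_zero E a \<and> \<not> (\<exists>x. is_succ E x a)"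

definition is_omega :: "('m \<Rightarrow> 'm \<Rightarrow> bool) \<Rightarrow> 'm \<Rightarrow> bool" where
  "is_omega E w \<longleftrightarrow> is_limit E w \<and> (\<forall>x\<in>elts E w. \<not> is_limit E x)"

definition is_card :: "('m \<Rightarrow> 'm \<Rightarrow> bool) \<Rightarrow> 'm \<Rightarrow> bool" where
  "is_card E k \<longleftrightarrow> is_ord E k \<and> (\<forall>b\<in>elts E k. \<not> (\<exists>f. is_bij E b k f))"

definition cofinal_seq :: "('m \<Rightarrow> 'm \<Rightarrow> bool) \<Rightarrow> 'm \<Rightarrow> 'm \<Rightarrow> 'm \<Rightarrow> bool" where
  "cofinal_seq E b l f \<longleftrightarrow>
     is_map E b l f \<and> (\<forall>a\<in>elts E l. \<exists>i\<in>elts E b. E a (app E f i) \<or> a = app E f i)"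

definition is_cf :: "('m \<Rightarrow> 'm \<Rightarrow> bool) \<Rightarrow> 'm \<Rightarrow> 'm \<Rightarrow> bool" where
  "is_cf E l k \<longleftrightarrow>
     is_ord E k \<and> (\<exists>f. cofinal_seq E k l f) \<and>
     (\<forall>b\<in>elts E k. \<not> (\<exists>f. cofinal_seq E b l f))"

section \<open>Filters\<close>

definition is_filter :: "('m \<Rightarrow> 'm \<Rightarrow> bool) \<Rightarrow> 'm \<Rightarrow> 'm \<Rightarrow> bool" where
  "is_filter E S F \<longleftrightarrow>
     (\<forall>X\<in>elts E F. elts E X \<subseteq> elts E S) \<and>
     S \<in> elts E F \<and>
     (\<forall>X\<in>elts E F. elts E X \<noteq> {}) \<and>
     (\<forall>X\<in>elts E F. \<forall>Y. elts E X \<subseteq> elts E Y \<and> elts E Y \<subseteq> elts E S \<longrightarrow> Y \<in> elts E F) \<and>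
     (\<forall>X\<in>elts E F. \<forall>Y\<in>elts E F. \<exists>Z\<in>elts E F. elts E Z = elts E X \<inter> elts E Y)"

definition is_ultrafilter :: "('m \<Rightarrow> 'm \<Rightarrow> bool) \<Rightarrow> 'm \<Rightarrow> 'm \<Rightarrow> bool" where
  "is_ultrafilter E S F \<longleftrightarrow>
     is_filter E S F \<and>
     (\<forall>X. elts E X \<subseteq> elts E S \<longrightarrow>
        X \<in> elts E F \<or> (\<exists>Y\<in>elts E F. elts E Y = elts E S - elts E X))"

definition principal :: "('m \<Rightarrow> 'm \<Rightarrow> bool) \<Rightarrow> 'm \<Rightarrow> 'm \<Rightarrow> bool" where
  "principal E S F \<longleftrightarrow>
     (\<exists>B. elts E B \<subseteq> elts E S \<and>
        elts E F = {X. elts E B \<subseteq> elts E X \<and> elts E X \<subseteq> elts E S})"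

text \<open>Completeness of a filter over the ordinal \<open>k\<close>: intersections of sequences of length less
  than \<open>k\<close>; the intersection of the empty sequence is \<open>k\<close>.\<close>

definition complete_filter :: "('m \<Rightarrow> 'm \<Rightarrow> bool) \<Rightarrow> 'm \<Rightarrow> 'm \<Rightarrow> bool" where
  "complete_filter E k F \<longleftrightarrow>
     (\<forall>b\<in>elts E k. \<forall>f. is_map E b F f \<longrightarrow>
        (\<exists>X\<in>elts E F. elts E X = {x \<in> elts E k. \<forall>i\<in>elts E b. x \<in> elts E (app E f i)}))"

definition diagonal_closed :: "('m \<Rightarrow> 'm \<Rightarrow> bool) \<Rightarrow> 'm \<Rightarrow> 'm \<Rightarrow> bool" where
  "diagonal_closed E k F \<longleftrightarrow>
     (\<forall>f. is_map E k F f \<longrightarrow>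
        (\<exists>X\<in>elts E F. elts E X = {x \<in> elts E k. \<forall>i\<in>elts E x. x \<in> elts E (app E f i)}))"

definition normal_filter :: "('m \<Rightarrow> 'm \<Rightarrow> bool) \<Rightarrow> 'm \<Rightarrow> 'm \<Rightarrow> bool" where
  "normal_filter E k F \<longleftrightarrow> is_filter E k F \<and> diagonal_closed E k F"

definition normal_measure :: "('m \<Rightarrow> 'm \<Rightarrow> bool) \<Rightarrow> 'm \<Rightarrow> 'm \<Rightarrow> bool" where
  "normal_measure E k F \<longleftrightarrow>
     is_ultrafilter E k F \<and> \<not> principal E k F \<and> complete_filter E k F \<and> diagonal_closed E k F"

definition in_dual_ideal :: "('m \<Rightarrow> 'm \<Rightarrow> bool) \<Rightarrow> 'm \<Rightarrow> 'm \<Rightarrow> 'm \<Rightarrow> bool" where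
  "in_dual_ideal E S F X \<longleftrightarrow>
     elts E X \<subseteq> elts E S \<and> (\<exists>Y\<in>elts E F. elts E Y = elts E S - elts E X)"

definition dual_ideal_contains_small :: "('m \<Rightarrow> 'm \<Rightarrow> bool) \<Rightarrow> 'm \<Rightarrow> 'm \<Rightarrow> bool" where
  "dual_ideal_contains_small E m F \<longleftrightarrow>
     (\<forall>X. elts E X \<subseteq> elts E m \<and> (\<exists>b\<in>elts E m. \<exists>f. is_bij E b X f) \<longrightarrow> in_dual_ideal E m F X)"

section \<open>The definable Galvin property and the partition relation\<close>

text \<open>The subsequence \<open>D\<close> itself is what is definable from \<open>C\<close>; the index map \<open>r\<close> is injective
  but need not be increasing.  The formula may depend on \<open>C\<close>: by reflection \<open>D\<close> is then definable
  from \<open>C\<close> over some rank-initial segment of the model, which suffices to pick such subsequences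
  simultaneously without choice.\<close>

definition Gal_Def :: "('m \<Rightarrow> 'm \<Rightarrow> bool) \<Rightarrow> 'm \<Rightarrow> 'm \<Rightarrow> bool" where
  "Gal_Def E U m \<longleftrightarrow>
     (\<forall>C. is_map E m U C \<longrightarrow>
        (\<exists>r D. is_map E m m r \<and> inj_on (app E r) (elts E m) \<and>
           is_seq E m D \<and> (\<forall>j\<in>elts E m. app E D j = app E C (app E r j)) \<and>
           definable_from E C D \<and>
           (\<exists>X\<in>elts E U. elts E X = (\<Inter>j\<in>elts E m. elts E (app E D j)))))"

definition pairs :: "('m \<Rightarrow> 'm \<Rightarrow> bool) \<Rightarrow> 'm \<Rightarrow> 'm set" where
  "pairs E A = {z. \<exists>x\<in>elts E A. \<exists>y\<in>elts E A. x \<noteq> y \<and> elts E z = {x, y}}"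

definition has_otp :: "('m \<Rightarrow> 'm \<Rightarrow> bool) \<Rightarrow> 'm \<Rightarrow> 'm \<Rightarrow> bool" where
  "has_otp E A a \<longleftrightarrow>
     (\<exists>f. is_bij E a A f \<and>
        (\<forall>x\<in>elts E a. \<forall>y\<in>elts E a. E x y \<longleftrightarrow> E (app E f x) (app E f y)))"

definition arrows :: "('m \<Rightarrow> 'm \<Rightarrow> bool) \<Rightarrow> 'm \<Rightarrow> 'm \<Rightarrow> 'm \<Rightarrow> bool" where
  "arrows E l a b \<longleftrightarrow>
     (\<forall>zero one two P c.
        is_zero E zero \<and> is_succ E zero one \<and> is_succ E one two \<and>
        elts E P = pairs E l \<and> is_map E P two c \<longrightarrow>
        (\<exists>A. elts E A \<subseteq> elts E l \<and> has_otp E A a \<and> (\<forall>z\<in>pairs E A. app E c z = zero)) \<or>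
        (\<exists>B. elts E B \<subseteq> elts E l \<and> has_otp E B b \<and> (\<forall>z\<in>pairs E B. app E c z = one)))"

end

theory Submission
  imports Defs
begin

text \<open>
  Colour one is read as adjacency in a graph on \<open>lam\<close>.  Normality of the filters gives in each block
  \<open>mu j\<close> a positive set without edges: a vertex is sent to its lexicographically first clique of
  smaller neighbours, which is finite if there is no clique of type \<open>\<omega> + 1\<close>, and two vertices with
  the same first clique are not adjacent.  Given positive sets \<open>Q j\<close> inside these, call a vertex of
  \<open>Q i\<close> terminal if it has null neighbourhood in \<open>Q j\<close> for almost all \<open>j\<close>.  If for almost all \<open>i\<close>
  there are positively many terminal vertices, then the Galvin property and a diagonal
  intersection produce the edgeless set of type \<open>lam\<close>.  Otherwise a clique \<open>t\<close> with positively
  many common neighbours in almost all blocks can always be extended by one vertex so that the rank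
  of \<open>t\<close> in the well-founded tree of cliques below a common neighbour decreases in almost all
  blocks; doing this \<open>\<omega>\<close> times contradicts completeness of \<open>U\<close>.

  The Galvin property is used for \<open>kap\<close> many sequences at once.  By reflection, an element
  definable from \<open>C\<close> by a standard formula is generated from a level of the cumulative
  hierarchy and \<open>C\<close> by finitely many set operations.  At the least level where a suitable
  candidate appears, all candidates are intersected; since only countably many sets are generated
  there by finite stages, the intersection stays in \<open>U\<close>.
\<close>

text \<open>The shaping obstacle is that nothing may be chosen inside the model. Separation and
  replacement accept only predicates definable with parameters, so HOL choice cannot supply families
  of witnesses, and every construction carries a definability premise. Where the candidates are
  ordinals the least one is taken; the Galvin subsequences are the case that resists this. The model
  may be ill-founded with nonstandard natural numbers, so induction and least elements exist only
  for definable predicates, whereas the formula supplied by definability is standard and can be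
  analysed by HOL induction. Two cardinals are reserved for each index \<open>j\<close>:
  \<open>mu j\<close> carries the block, while \<open>nu j\<close> lies above all earlier blocks and
  is regular, because it carries a normal filter. A clique below a vertex of block \<open>j\<close>
  has fewer than \<open>nu j\<close> one-point extensions in earlier blocks, so its rank stays below
  \<open>nu j\<close>. As \<open>nu j\<close> is below \<open>mu j\<close>, completeness of
  \<open>Fl j\<close> fixes one rank on a positive set; this is what makes ranks comparable although
  they depend on the vertex.\<close>

section \<open>Definability with parameters and its closure properties\<close>

primrec rename_fm :: "(nat \<Rightarrow> nat) \<Rightarrow> fm \<Rightarrow> fm" where
  "rename_fm f (FMem m n) = FMem (f m) (f n)"
| "rename_fm f (FEq m n) = FEq (f m) (f n)"
| "rename_fm f (FNeg p) = FNeg (rename_fm f p)"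
| "rename_fm f (FConj p q) = FConj (rename_fm f p) (rename_fm f q)"
| "rename_fm f (FAll n p) = FAll (f n) (rename_fm f p)"

text \<open>Bound variables are renamed together with the free ones; injectivity of \<open>f\<close>
  is what excludes capture.\<close>

lemma sat_rename_fm:
  assumes "inj f"
  shows "sat E (rename_fm f p) v = sat E p (\<lambda>n. v (f n))"
proof (induction p arbitrary: v)
  case (FAll n p)
  have "(\<lambda>k. (v(f n := x)) (f k)) = (\<lambda>k. v (f k))(n := x)" for x
    using assms by (auto simp: fun_eq_iff inj_eq)
  then show ?case by (simp add: FAll del: fun_upd_apply)
qed auto

text \<open>Arguments sit at the even variables, parameters at the odd ones.\<close>

definition layout :: "(nat \<Rightarrow> 'm) \<Rightarrow> (nat \<Rightarrow> 'm) \<Rightarrow> nat \<Rightarrow> 'm" where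
  "layout c v n = (if even n then v (n div 2) else c (n div 2))"

named_theorems dI

locale zf =
  fixes E :: "'m \<Rightarrow> 'm \<Rightarrow> bool"
  assumes ZF: "ZF_model E"
begin

text \<open>\<open>dP\<close> and \<open>dT\<close> hold of the predicates and functions of environments that are first-order
  definable with parameters.  Environments are de Bruijn style: a bound variable becomes \<open>w 0\<close> and
  the surrounding environment becomes \<open>\<lambda>n. w (Suc n)\<close>.  The rules \<open>dI\<close> then read off definability
  from the shape of a term.\<close>

definition dP :: "((nat \<Rightarrow> 'm) \<Rightarrow> bool) \<Rightarrow> bool" where
  "dP P \<longleftrightarrow> (\<exists>p c. \<forall>v. P v = sat E p (layout c v))"

definition dT :: "((nat \<Rightarrow> 'm) \<Rightarrow> 'm) \<Rightarrow> bool" where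
  "dT t \<longleftrightarrow> dP (\<lambda>w. w 0 = t (\<lambda>n. w (Suc n)))"

abbreviation dpred where "dpred P \<equiv> dP (\<lambda>v. P (v 0))"
abbreviation dpred2 where "dpred2 P \<equiv> dP (\<lambda>v. P (v 0) (v (Suc 0)))"
abbreviation dfun where "dfun f \<equiv> dT (\<lambda>v. f (v 0))"
abbreviation dfun2 where "dfun2 f \<equiv> dT (\<lambda>v. f (v 0) (v (Suc 0)))"

lemma dPI: "(\<And>v. P v = sat E p (layout c v)) \<Longrightarrow> dP P"
  unfolding dP_def by blast

lemma dP_neg [dI]: "dP P \<Longrightarrow> dP (\<lambda>v. \<not> P v)"
  unfolding dP_def by (metis sat.simps(3))

lemma dP_conj [dI]:
  assumes "dP P" "dP Q"
  shows "dP (\<lambda>v. P v \<and> Q v)"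
proof -
  obtain p c q d where p: "\<And>v. P v = sat E p (layout c v)" and q: "\<And>v. Q v = sat E q (layout d v)"
    using assms unfolding dP_def by blast
  \<comment> \<open>The two formulas come with separate parameters. Slot \<open>2*m+1\<close> is
    sent to \<open>4*m+1\<close> for the first and to \<open>4*m+3\<close> for the second, and
    \<open>e\<close> interleaves \<open>c\<close> and \<open>d\<close> accordingly.\<close>
  define f g where "f = (\<lambda>n::nat. if even n then n else 2 * n - 1)"
    and "g = (\<lambda>n::nat. if even n then n else 2 * n + 1)"
  define e where "e = (\<lambda>n::nat. if even n then c (n div 2) else d (n div 2))"
  have "inj f" unfolding f_def by (rule injI) (simp split: if_splits, presburger+)
  have "inj g" unfolding g_def by (rule injI) (simp split: if_splits, presburger+)
  have "layout e v (f n) = layout c v n \<and> layout e v (g n) = layout d v n" for v n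
  proof (cases "even n")
    case False
    then obtain m where "n = 2 * m + 1" by (rule oddE)
    then have "f n = 2 * (2 * m) + 1" "g n = 2 * (2 * m + 1) + 1" "n div 2 = m" "odd n"
      by (simp_all add: f_def g_def)
    then show ?thesis by (simp add: layout_def e_def)
  qed (simp add: layout_def f_def g_def)
  then have "(\<lambda>n. layout e v (f n)) = layout c v" "(\<lambda>n. layout e v (g n)) = layout d v" for v
    by auto
  then show ?thesis
    by (intro dPI[of _ "FConj (rename_fm f p) (rename_fm g q)" e])
      (simp add: sat_rename_fm \<open>inj f\<close> \<open>inj g\<close> p q)
qed

lemma dP_all [dI]:
  assumes "dP (\<lambda>w. P (w 0) (\<lambda>n. w (Suc n)))"
  shows "dP (\<lambda>v. \<forall>x. P x v)"
proof -
  obtain p c where p: "\<And>w. P (w 0) (\<lambda>n. w (Suc n)) = sat E p (layout c w)"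
    using assms unfolding dP_def by blast
  have p': "P x v = sat E p (layout c (case_nat x v))" for x v
    using p[of "case_nat x v"] by simp
  \<comment> \<open>The quantified variable moves from slot 0 to the parameter slot 1. Arguments
    drop by one position and parameters move up by one, so the entry of \<open>e\<close> at 0 is a
    dummy that the quantifier overwrites.\<close>
  define f where "f = (\<lambda>n::nat. if n = 0 then 1 else if even n then n - 2 else n + 2)"
  define e where "e = case_nat undefined c"
  have "inj f" unfolding f_def by (rule injI) (simp split: if_splits, presburger+)
  have "((layout e v)(1 := x)) (f n) = layout c (case_nat x v) n" for v x n
  proof (cases "even n")
    case True
    then obtain m where m: "n = 2 * m" by (rule evenE)
    show ?thesis by (cases m) (simp_all add: m f_def layout_def)
  next
    case False
    then obtain m where "n = 2 * m + 1" by (rule oddE)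
    then have "f n = 2 * (Suc m) + 1" "n div 2 = m" "odd n"
      by (simp_all add: f_def)
    then show ?thesis by (simp add: layout_def e_def)
  qed
  then have "(\<lambda>n. ((layout e v)(1 := x)) (f n)) = layout c (case_nat x v)" for v x
    by blast
  then show ?thesis
    by (intro dPI[of _ "FAll 1 (rename_fm f p)" e])
      (simp add: sat_rename_fm \<open>inj f\<close> p' del: One_nat_def fun_upd_apply)
qed

lemma dP_rename_fm:
  assumes "dP P" "inj f"
  shows "dP (\<lambda>v. P (\<lambda>n. v (f n)))"
proof -
  obtain p c where p: "\<And>v. P v = sat E p (layout c v)"
    using assms unfolding dP_def by blast
  define g where "g = (\<lambda>n::nat. if even n then 2 * f (n div 2) else n)"
  have "inj g"
  proof (rule injI)
    fix x y assume eq: "g x = g y"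
    show "x = y"
    proof (cases "even x \<and> even y")
      case True
      then have "f (x div 2) = f (y div 2)" using eq by (simp add: g_def)
      then have "x div 2 = y div 2" using assms(2) by (simp add: inj_eq)
      then show ?thesis using True by (metis dvd_mult_div_cancel)
    next
      case False
      have "even (g z) = even z" for z by (simp add: g_def)
      then have "even x = even y" using eq by metis
      then show ?thesis using False eq by (simp add: g_def)
    qed
  qed
  have "(\<lambda>n. layout c v (g n)) = layout c (\<lambda>n. v (f n))" for v
    by (auto simp: fun_eq_iff layout_def g_def)
  then show ?thesis
    by (intro dPI[of _ "rename_fm g p" c]) (simp add: sat_rename_fm \<open>inj g\<close> p)
qed

lemma dP_ex [dI]:
  assumes "dP (\<lambda>w. P (w 0) (\<lambda>n. w (Suc n)))"
  shows "dP (\<lambda>v. \<exists>x. P x v)"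
proof -
  have "dP (\<lambda>v. \<not> (\<forall>x. \<not> P x v))" by (intro dP_neg dP_all assms)
  then show ?thesis by simp
qed

lemma dP_disj [dI]:
  assumes "dP P" "dP Q"
  shows "dP (\<lambda>v. P v \<or> Q v)"
proof -
  have "dP (\<lambda>v. \<not> (\<not> P v \<and> \<not> Q v))" by (intro dP_neg dP_conj assms)
  then show ?thesis by simp
qed

lemma dP_imp [dI]:
  assumes "dP P" "dP Q"
  shows "dP (\<lambda>v. P v \<longrightarrow> Q v)"
  unfolding imp_conv_disj by (intro dP_neg dP_disj assms)

lemma dP_iff [dI]:
  assumes "dP P" "dP Q"
  shows "dP (\<lambda>v. P v \<longleftrightarrow> Q v)"
  unfolding iff_conv_conj_imp by (intro dP_imp dP_conj assms)

lemma dP_const [dI]: "dP (\<lambda>v. b)"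
proof (cases b)
  case True
  then show ?thesis by (intro dPI[of _ "FEq 0 0"]) simp
next
  case False
  then show ?thesis by (intro dPI[of _ "FNeg (FEq 0 0)"]) simp
qed

lemma dT_var [dI]: "dT (\<lambda>v. v n)"
  unfolding dT_def by (rule dPI[of _ "FEq 0 (2 * Suc n)"]) (simp add: layout_def)

lemma dT_const [dI]: "dT (\<lambda>v. a)"
  unfolding dT_def by (rule dPI[of _ "FEq 0 1" "\<lambda>_. a"]) (simp add: layout_def)

lemma dT_weak: "dT t \<Longrightarrow> dT (\<lambda>v. t (\<lambda>n. v (Suc n)))"
  using dP_rename_fm[of "\<lambda>w. w 0 = t (\<lambda>n. w (Suc n))" "case_nat 0 (\<lambda>n. Suc (Suc n))"]
  unfolding dT_def by (simp add: inj_def split: nat.splits)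

lemma dP_two:
  assumes "dT s" "dT t" "dP (\<lambda>w. R (w (Suc 0)) (w 0))"
  shows "dP (\<lambda>v. R (s v) (t v))"
proof -
  have "dP (\<lambda>v. \<exists>x. x = s v \<and> (\<exists>y. y = t v \<and> R x y))"
    by (intro dP_ex dP_conj assms(1)[unfolded dT_def] dT_weak[OF assms(2), unfolded dT_def] assms(3))
  then show ?thesis by simp
qed

lemma dP_mem [dI]: "dT s \<Longrightarrow> dT t \<Longrightarrow> dP (\<lambda>v. E (s v) (t v))"
  by (rule dP_two[of s t E], assumption, assumption) (rule dPI[of _ "FMem 2 0"], simp add: layout_def)

lemma dP_eq [dI]: "dT s \<Longrightarrow> dT t \<Longrightarrow> dP (\<lambda>v. s v = t v)"
  by (rule dP_two[of s t "(=)"], assumption, assumption) (rule dPI[of _ "FEq 2 0"], simp add: layout_def)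

text \<open>Simultaneous substitution, by induction on the standard formula \<open>p\<close>: a
  quantifier overrides one component of the family \<open>T\<close>, and the other components are
  weakened to an environment with one more variable.\<close>

lemma dP_sat: "(\<And>n. dT (T n)) \<Longrightarrow> dP (\<lambda>v. sat E p (\<lambda>n. T n v))"
proof (induction p arbitrary: T)
  case (FAll n p)
  define T' where "T' k w = (if k = n then w 0 else T k (\<lambda>n. w (Suc n)))" for k and w :: "nat \<Rightarrow> 'm"
  have "dT (T' k)" for k
    by (cases "k = n") (auto simp: T'_def[abs_def] dT_var dT_weak FAll.prems)
  then have "dP (\<lambda>v. sat E p (\<lambda>k. T' k v))" by (rule FAll.IH)
  moreover have "(\<lambda>k. T' k w) = (\<lambda>k. T k (\<lambda>n. w (Suc n)))(n := w 0)" for w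
    by (auto simp: T'_def fun_eq_iff)
  ultimately have "dP (\<lambda>w. sat E p ((\<lambda>k. T k (\<lambda>n. w (Suc n)))(n := w 0)))" by simp
  then show ?case unfolding sat.simps
    by (rule dP_all[of "\<lambda>x v. sat E p ((\<lambda>k. T k v)(n := x))"])
qed (simp_all add: dI)

lemma dP_subst:
  assumes "dP P" "\<And>n. dT (T n)"
  shows "dP (\<lambda>v. P (\<lambda>n. T n v))"
proof -
  obtain p c where p: "\<And>v. P v = sat E p (layout c v)"
    using assms unfolding dP_def by blast
  have "dP (\<lambda>v. sat E p (\<lambda>n. (if even n then T (n div 2) else (\<lambda>v. c (n div 2))) v))"
    by (rule dP_sat) (auto simp: assms dT_const)
  moreover have "(\<lambda>n. (if even n then T (n div 2) else (\<lambda>v. c (n div 2))) v) = layout c (\<lambda>n. T n v)" for v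
    by (auto simp: layout_def fun_eq_iff)
  ultimately show ?thesis by (simp add: p)
qed

lemma dT_case: "dT s \<Longrightarrow> (\<And>n. dT (T n)) \<Longrightarrow> dT (case_nat s T n)"
  by (cases n) auto

lemma dT_subst:
  assumes "dT f" "\<And>n. dT (T n)"
  shows "dT (\<lambda>v. f (\<lambda>n. T n v))"
proof -
  have "dT (case_nat (\<lambda>w. w 0) (\<lambda>k w. T k (\<lambda>n. w (Suc n))) n)" for n
    by (intro dT_case dT_var dT_weak[OF assms(2)])
  from dP_subst[OF assms(1)[unfolded dT_def], where T = "case_nat (\<lambda>w. w 0) (\<lambda>k w. T k (\<lambda>n. w (Suc n)))", OF this]
  show ?thesis unfolding dT_def by simp
qed

text \<open>Once a predicate or operation is known to be definable in its own arguments, these rules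
  allow definable terms in their place. The surplus variables of the environment are filled by
  repeating the last term.\<close>

lemma dP1:
  assumes "dpred R" "dT s"
  shows "dP (\<lambda>v. R (s v))"
proof -
  have "dT ((\<lambda>_. s) n)" for n by (intro dT_case assms)
  from dP_subst[OF assms(1), where T = "\<lambda>_. s", OF this] show ?thesis by simp
qed

lemma dP2:
  assumes "dpred2 R" "dT s" "dT t"
  shows "dP (\<lambda>v. R (s v) (t v))"
proof -
  have "dT ((case_nat s (\<lambda>_. t)) n)" for n by (intro dT_case assms)
  from dP_subst[OF assms(1), where T = "case_nat s (\<lambda>_. t)", OF this] show ?thesis by simp
qed

lemma dP3:
  assumes "dP (\<lambda>v. R (v 0) (v (Suc 0)) (v (Suc (Suc 0))))" "dT s" "dT t" "dT u"
  shows "dP (\<lambda>v. R (s v) (t v) (u v))"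
proof -
  have "dT ((case_nat s (case_nat t (\<lambda>_. u))) n)" for n by (intro dT_case assms)
  from dP_subst[OF assms(1), where T = "case_nat s (case_nat t (\<lambda>_. u))", OF this] show ?thesis by simp
qed

lemma dP4:
  assumes "dP (\<lambda>v. R (v 0) (v (Suc 0)) (v (Suc (Suc 0))) (v (Suc (Suc (Suc 0)))))" "dT s" "dT t" "dT u" "dT r"
  shows "dP (\<lambda>v. R (s v) (t v) (u v) (r v))"
proof -
  have "dT ((case_nat s (case_nat t (case_nat u (\<lambda>_. r)))) n)" for n by (intro dT_case assms)
  from dP_subst[OF assms(1), where T = "case_nat s (case_nat t (case_nat u (\<lambda>_. r)))", OF this] show ?thesis by simp
qed

lemma dT1:
  assumes "dfun f" "dT s"
  shows "dT (\<lambda>v. f (s v))"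
proof -
  have "dT ((\<lambda>_. s) n)" for n by (intro dT_case assms)
  from dT_subst[OF assms(1), where T = "\<lambda>_. s", OF this] show ?thesis by simp
qed

lemma dT2:
  assumes "dfun2 f" "dT s" "dT t"
  shows "dT (\<lambda>v. f (s v) (t v))"
proof -
  have "dT ((case_nat s (\<lambda>_. t)) n)" for n by (intro dT_case assms)
  from dT_subst[OF assms(1), where T = "case_nat s (\<lambda>_. t)", OF this] show ?thesis by simp
qed

lemma dT3:
  assumes "dT (\<lambda>v. f (v 0) (v (Suc 0)) (v (Suc (Suc 0))))" "dT s" "dT t" "dT u"
  shows "dT (\<lambda>v. f (s v) (t v) (u v))"
proof -
  have "dT ((case_nat s (case_nat t (\<lambda>_. u))) n)" for n by (intro dT_case assms)
  from dT_subst[OF assms(1), where T = "case_nat s (case_nat t (\<lambda>_. u))", OF this] show ?thesis by simp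
qed

lemma dP_bind:
  assumes "dP (\<lambda>w. P (w 0) (\<lambda>n. w (Suc n)))" "dT s" "\<And>n. dT (T n)"
  shows "dP (\<lambda>v. P (s v) (\<lambda>n. T n v))"
proof -
  have "dT (case_nat s T n)" for n by (intro dT_case assms)
  from dP_subst[OF assms(1), where T = "case_nat s T", OF this] show ?thesis by simp
qed

lemma dT_bind:
  assumes "dT (\<lambda>w. P (w 0) (\<lambda>n. w (Suc n)))" "dT s" "\<And>n. dT (T n)"
  shows "dT (\<lambda>v. P (s v) (\<lambda>n. T n v))"
proof -
  have "dT (case_nat s T n)" for n by (intro dT_case assms)
  from dT_subst[OF assms(1), where T = "case_nat s T", OF this] show ?thesis by simp
qed

lemma dT_bind2:
  assumes "dT (\<lambda>w. P (w 0) (w (Suc 0)) (\<lambda>n. w (Suc (Suc n))))" "dT s" "dT t" "\<And>n. dT (T n)"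
  shows "dT (\<lambda>v. P (s v) (t v) (\<lambda>n. T n v))"
proof -
  have "dT (case_nat s (case_nat t T) n)" for n by (intro dT_case assms)
  from dT_subst[OF assms(1), where T = "case_nat s (case_nat t T)", OF this] show ?thesis by simp
qed

lemma dP_mem_elts [dI]: "dT s \<Longrightarrow> dT t \<Longrightarrow> dP (\<lambda>v. s v \<in> elts E (t v))"
  unfolding elts_def by (simp add: dI)

lemma dP_Ball [dI]:
  assumes "dT t" "dP (\<lambda>w. P (w 0) (\<lambda>n. w (Suc n)))"
  shows "dP (\<lambda>v. \<forall>x\<in>elts E (t v). P x v)"
  unfolding Ball_def by (intro dI assms dT_weak[OF assms(1)])

lemma dP_Bex [dI]:
  assumes "dT t" "dP (\<lambda>w. P (w 0) (\<lambda>n. w (Suc n)))"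
  shows "dP (\<lambda>v. \<exists>x\<in>elts E (t v). P x v)"
  unfolding Bex_def by (intro dI assms dT_weak[OF assms(1)])

lemma dP_Ex1 [dI]:
  assumes "dP (\<lambda>w. P (w 0) (\<lambda>n. w (Suc n)))"
  shows "dP (\<lambda>v. \<exists>!x. P x v)"
  unfolding Ex1_def
  by (intro dI assms dP_bind[OF assms])

lemma dP_subset [dI]:
  assumes "dT s" "dT t"
  shows "dP (\<lambda>v. elts E (s v) \<subseteq> elts E (t v))"
  unfolding subset_eq by (intro dI assms dT_weak[OF assms(2)])

section \<open>Sets and functions of the model\<close>

lemmas zf = ZF[unfolded ZF_model_def]

lemma set_ext: "elts E x = elts E y \<Longrightarrow> x = y"
  using conjunct1[OF zf] by blast

lemma foundation: "elts E x \<noteq> {} \<Longrightarrow> \<exists>y\<in>elts E x. elts E y \<inter> elts E x = {}"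
  using conjunct1[OF conjunct2[OF zf]] by blast

lemma ex_pair: "\<exists>z. elts E z = {x, y}"
  using conjunct1[OF conjunct2[OF conjunct2[OF zf]]] by blast

lemma ex_union: "\<exists>z. elts E z = (\<Union>y\<in>elts E x. elts E y)"
  using conjunct1[OF conjunct2[OF conjunct2[OF conjunct2[OF zf]]]] by blast

lemma ex_power: "\<exists>z. elts E z = {y. elts E y \<subseteq> elts E x}"
  using conjunct1[OF conjunct2[OF conjunct2[OF conjunct2[OF conjunct2[OF zf]]]]] by blast

lemma ex_empty: "\<exists>z. elts E z = {}"
  using conjunct1[OF conjunct2[OF conjunct2[OF conjunct2[OF conjunct2[OF conjunct2[OF zf]]]]]] by blast

lemma separation0: "\<exists>z. elts E z = {y \<in> elts E x. sat E p (v(0 := y))}"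
  using conjunct1[OF conjunct2[OF conjunct2[OF conjunct2[OF conjunct2[OF conjunct2[OF conjunct2[OF zf]]]]]]] by blast

lemma replacement0:
  "(\<And>y z z'. y \<in> elts E x \<Longrightarrow> sat E p (v(0 := y, 1 := z)) \<Longrightarrow> sat E p (v(0 := y, 1 := z')) \<Longrightarrow> z = z')
    \<Longrightarrow> \<exists>w. elts E w = {z. \<exists>y\<in>elts E x. sat E p (v(0 := y, 1 := z))}"
  using spec[OF spec[OF spec[OF conjunct2[OF conjunct2[OF conjunct2[OF conjunct2[OF conjunct2[OF conjunct2[OF conjunct2[OF zf]]]]]]], of p], of v], of x] by blast

lemma separation:
  assumes "dpred P"
  shows "\<exists>z. elts E z = {y \<in> elts E x. P y}"
proof -
  obtain p c where p: "\<And>v. P (v 0) = sat E p (layout c v)"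
    using assms unfolding dP_def by blast
  have "(layout c (\<lambda>_. undefined))(0 := y) = layout c (case_nat y (\<lambda>_. undefined))" for y
    by (auto simp: fun_eq_iff layout_def split: nat.split)
  then have "sat E p ((layout c (\<lambda>_. undefined))(0 := y)) = P y" for y
    by (simp add: p[symmetric])
  then show ?thesis
    using separation0[of x p "layout c (\<lambda>_. undefined)"] by simp
qed

lemma replacement:
  assumes "dfun f"
  shows "\<exists>w. elts E w = f ` elts E x"
proof -
  have "dP (\<lambda>v. v (Suc 0) = f (v 0))" by (rule dP_eq[OF dT_var assms])
  then obtain p c where p: "\<And>v. (v (Suc 0) = f (v 0)) = sat E p (layout c v)"
    unfolding dP_def by blast
  \<comment> \<open>\<open>replacement0\<close> expects the value at variable 1, whereas
    \<open>layout\<close> puts the second argument at variable 2 and a parameter at 1;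
    \<open>g\<close> swaps the two.\<close>
  define g :: "nat \<Rightarrow> nat" where "g n = (if n = 1 then 2 else if n = 2 then 1 else n)" for n
  have "g (g n) = n" for n by (simp add: g_def)
  then have g: "inj g" by (metis injI)
  define V where "V = (\<lambda>y z. case_nat y (case_nat z (\<lambda>_. undefined :: 'm)))"
  define W where "W n = layout c (\<lambda>_. undefined) (g n)" for n
  have W: "(W(0 := y, 1 := z)) (g n) = layout c (V y z) n" for y z n
  proof -
    consider "n = 0" | "n = 1" | "n = 2" | k where "n = Suc (Suc (Suc k))"
      by (metis One_nat_def not0_implies_Suc numeral_2_eq_2)
    then show ?thesis
    proof cases
      case 4
      have "V y z (n div 2) = undefined" if "even n"
      proof -
        have "n div 2 = Suc (Suc ((n - 4) div 2))" using 4 that by presburger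
        then show ?thesis by (simp add: V_def)
      qed
      then show ?thesis using 4 by (auto simp: W_def g_def layout_def)
    qed (simp_all add: W_def V_def g_def layout_def)
  qed
  have "sat E (rename_fm g p) (W(0 := y, 1 := z)) = (z = f y)" for y z
  proof -
    have "(\<lambda>n. (W(0 := y, 1 := z)) (g n)) = layout c (V y z)"
      unfolding fun_eq_iff using W by blast
    then have "sat E (rename_fm g p) (W(0 := y, 1 := z)) = sat E p (layout c (V y z))"
      by (simp only: sat_rename_fm[OF g])
    then show ?thesis using p[of "V y z"] by (simp add: V_def)
  qed
  then have "\<exists>w. elts E w = {z. \<exists>y\<in>elts E x. z = f y}"
    using replacement0[of x "rename_fm g p" W] by simp
  then show ?thesis by (simp add: image_def)
qed

definition emp :: 'm where "emp = (THE z. elts E z = {})"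

lemma elts_emp [simp]: "elts E emp = {}"
proof -
  obtain z where z: "elts E z = {}" using ex_empty by blast
  have "emp = z" unfolding emp_def by (rule the_equality) (auto intro: set_ext simp: z)
  with z show ?thesis by simp
qed

text \<open>With the fixed default \<open>emp\<close>, every operation below is total and definable without side conditions.\<close>

definition the1 :: "('m \<Rightarrow> bool) \<Rightarrow> 'm" where
  "the1 P = (if \<exists>!x. P x then THE x. P x else emp)"

lemma the1_eqI: "P a \<Longrightarrow> (\<And>x. P x \<Longrightarrow> x = a) \<Longrightarrow> the1 P = a"
  unfolding the1_def by (metis the_equality)

lemma dT_the1 [dI]:
  assumes "dP (\<lambda>w. P (w 0) (\<lambda>n. w (Suc n)))"
  shows "dT (\<lambda>v. the1 (\<lambda>x. P x v))"
proof -
  have *: "(y = the1 Q) \<longleftrightarrow> ((\<exists>!x. Q x) \<and> Q y) \<or> (\<not> (\<exists>!x. Q x) \<and> y = emp)" for y Q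
    using theI'[of Q] the1_equality[of Q y] unfolding the1_def by (cases "\<exists>!x. Q x") auto
  show ?thesis
    unfolding dT_def * by (intro dI dP_bind[OF assms])
qed

lemma dT_if [dI]:
  assumes "dP P" "dT s" "dT t"
  shows "dT (\<lambda>v. if P v then s v else t v)"
proof -
  have "dP (\<lambda>w. P (\<lambda>n. w (Suc n)))" by (rule dP_rename_fm[OF assms(1)]) simp
  have *: "(y = (if Q then a else b)) \<longleftrightarrow> (Q \<and> y = a) \<or> (\<not> Q \<and> y = b)" for Q and y a b :: 'm by auto
  show ?thesis unfolding dT_def *
    by (intro dI \<open>dP (\<lambda>w. P (\<lambda>n. w (Suc n)))\<close> dT_weak[OF assms(2)] dT_weak[OF assms(3)])
qed

text \<open>Collections that form no set of the model are sent to \<open>emp\<close>, so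
  comprehension terms are definable before their existence is settled.\<close>

definition mk_set :: "'m set \<Rightarrow> 'm" where "mk_set A = the1 (\<lambda>z. elts E z = A)"

lemma mk_set_elts [simp]: "mk_set (elts E x) = x"
  unfolding mk_set_def by (rule the1_eqI) (auto intro: set_ext)

lemma elts_mk_set: "\<exists>z. elts E z = A \<Longrightarrow> elts E (mk_set A) = A"
  by auto

lemma dT_mk_set [dI]:
  assumes "dP (\<lambda>w. P (w 0) (\<lambda>n. w (Suc n)))"
  shows "dT (\<lambda>v. mk_set {x. P x v})"
proof -
  have *: "elts E z = {x. P x v} \<longleftrightarrow> (\<forall>x. x \<in> elts E z \<longleftrightarrow> P x v)" for z v by auto
  show ?thesis
    unfolding mk_set_def * by (intro dI dP_bind[OF assms])
qed

definition sep :: "'m \<Rightarrow> ('m \<Rightarrow> bool) \<Rightarrow> 'm" where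
  "sep A P = mk_set {x. x \<in> elts E A \<and> P x}"

lemma elts_sep: "dpred P \<Longrightarrow> elts E (sep A P) = {x \<in> elts E A. P x}"
  unfolding sep_def by (intro elts_mk_set separation)

lemma dT_sep [dI]:
  assumes "dT s" "dP (\<lambda>w. P (w 0) (\<lambda>n. w (Suc n)))"
  shows "dT (\<lambda>v. sep (s v) (\<lambda>x. P x v))"
  unfolding sep_def by (intro dI assms dT_weak[OF assms(1)])

definition img :: "('m \<Rightarrow> 'm) \<Rightarrow> 'm \<Rightarrow> 'm" where
  "img f A = mk_set {y. \<exists>x\<in>elts E A. y = f x}"

lemma elts_img: "dfun f \<Longrightarrow> elts E (img f A) = f ` elts E A"
  unfolding img_def image_def[symmetric] by (intro elts_mk_set replacement)

lemma dT_img [dI]: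
  assumes "dT (\<lambda>w. f (w 0) (\<lambda>n. w (Suc n)))" "dT s"
  shows "dT (\<lambda>v. img (\<lambda>x. f x v) (s v))"
  unfolding img_def by (intro dI assms dT_weak[OF assms(2)] dT_bind[OF assms(1)])

definition union :: "'m \<Rightarrow> 'm" where
  "union A = mk_set {y. \<exists>x\<in>elts E A. y \<in> elts E x}"

lemma elts_union [simp]: "elts E (union A) = (\<Union>y\<in>elts E A. elts E y)"
proof -
  have "(\<Union>y\<in>elts E A. elts E y) = {y. \<exists>x\<in>elts E A. y \<in> elts E x}" by blast
  then show ?thesis unfolding union_def using elts_mk_set[OF ex_union[of A]] by simp
qed

lemma dT_union [dI]: "dT s \<Longrightarrow> dT (\<lambda>v. union (s v))"
  unfolding union_def by (rule dT1[of union, unfolded union_def]) (intro dI)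

definition power :: "'m \<Rightarrow> 'm" where "power A = mk_set {y. elts E y \<subseteq> elts E A}"

lemma elts_power [simp]: "elts E (power A) = {y. elts E y \<subseteq> elts E A}"
  unfolding power_def using elts_mk_set[OF ex_power[of A]] by simp

lemma dT_power [dI]: "dT s \<Longrightarrow> dT (\<lambda>v. power (s v))"
  unfolding power_def by (rule dT1[of power, unfolded power_def]) (intro dI)

definition upair :: "'m \<Rightarrow> 'm \<Rightarrow> 'm" where "upair a b = mk_set {y. y = a \<or> y = b}"

lemma elts_upair [simp]: "elts E (upair a b) = {a, b}"
proof -
  have "{a, b} = {y. y = a \<or> y = b}" by blast
  then show ?thesis unfolding upair_def using elts_mk_set[OF ex_pair[of a b]] by simp
qed

lemma dT_upair [dI]: "dT s \<Longrightarrow> dT t \<Longrightarrow> dT (\<lambda>v. upair (s v) (t v))"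
  unfolding upair_def by (rule dT2[of upair, unfolded upair_def]) (intro dI)

lemma upairI: "elts E z = {x, y} \<Longrightarrow> z = upair x y"
  by (rule set_ext) simp

definition cup :: "'m \<Rightarrow> 'm \<Rightarrow> 'm" where "cup a b = union (upair a b)"

lemma elts_cup [simp]: "elts E (cup a b) = elts E a \<union> elts E b"
  unfolding cup_def by simp

lemma dT_cup [dI]: "dT s \<Longrightarrow> dT t \<Longrightarrow> dT (\<lambda>v. cup (s v) (t v))"
  unfolding cup_def by (intro dI)

definition ins :: "'m \<Rightarrow> 'm \<Rightarrow> 'm" where "ins x a = cup a (upair x x)"

lemma elts_ins [simp]: "elts E (ins x a) = insert x (elts E a)"
  unfolding ins_def by simp

lemma dT_ins [dI]: "dT s \<Longrightarrow> dT t \<Longrightarrow> dT (\<lambda>v. ins (s v) (t v))"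
  unfolding ins_def by (intro dI)

abbreviation suc :: "'m \<Rightarrow> 'm" where "suc x \<equiv> ins x x"

definition opr :: "'m \<Rightarrow> 'm \<Rightarrow> 'm" where "opr a b = upair (upair a a) (upair a b)"

lemma dT_opr [dI]: "dT s \<Longrightarrow> dT t \<Longrightarrow> dT (\<lambda>v. opr (s v) (t v))"
  unfolding opr_def by (intro dI)

lemma upair_eq: "upair a b = upair c d \<longleftrightarrow> {a, b} = {c, d}"
  by (metis elts_upair set_ext)

lemma opr_inject [simp]: "opr a b = opr c d \<longleftrightarrow> a = c \<and> b = d"
  unfolding opr_def upair_eq by (auto simp: doubleton_eq_iff upair_eq)

lemma is_opair_iff [simp]: "is_opair E a b p \<longleftrightarrow> p = opr a b"
proof
  assume "is_opair E a b p"
  then obtain s t where "elts E s = {a}" "elts E t = {a, b}" "elts E p = {s, t}"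
    unfolding is_opair_def by blast
  then have "s = upair a a" "t = upair a b" "p = upair s t" by (auto intro: set_ext)
  then show "p = opr a b" by (simp add: opr_def)
next
  assume "p = opr a b"
  then show "is_opair E a b p" unfolding is_opair_def opr_def
    by (intro exI[of _ "upair a a"] exI[of _ "upair a b"]) simp
qed

text \<open>Unlike \<open>app\<close>, which is unspecified outside the domain, this has the fixed
  value \<open>emp\<close> there and is therefore definable without side conditions.\<close>

definition ap :: "'m \<Rightarrow> 'm \<Rightarrow> 'm" where "ap f a = the1 (\<lambda>b. opr a b \<in> elts E f)"

lemma dT_ap [dI]: "dT s \<Longrightarrow> dT t \<Longrightarrow> dT (\<lambda>v. ap (s v) (t v))"
  unfolding ap_def by (rule dT2[of ap, unfolded ap_def]) (intro dI)

lemma is_seq_iff: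
  "is_seq E A f \<longleftrightarrow> (\<forall>p\<in>elts E f. \<exists>a\<in>elts E A. \<exists>b. p = opr a b) \<and>
     (\<forall>a\<in>elts E A. \<exists>!b. opr a b \<in> elts E f)"
  unfolding is_seq_def by auto

lemma app_eq_ap:
  assumes "is_seq E A f" "a \<in> elts E A"
  shows "app E f a = ap f a"
  using assms unfolding is_seq_iff app_def ap_def the1_def by auto

definition fn :: "('m \<Rightarrow> 'm) \<Rightarrow> 'm \<Rightarrow> 'm" where "fn f A = img (\<lambda>x. opr x (f x)) A"

lemma dT_fn [dI]:
  assumes "dT (\<lambda>w. f (w 0) (\<lambda>n. w (Suc n)))" "dT s"
  shows "dT (\<lambda>v. fn (\<lambda>x. f x v) (s v))"
  unfolding fn_def by (intro dI assms)

lemma elts_fn: "dfun f \<Longrightarrow> elts E (fn f A) = (\<lambda>x. opr x (f x)) ` elts E A"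
  unfolding fn_def by (intro elts_img dI)

lemma ap_fn: "dfun f \<Longrightarrow> x \<in> elts E A \<Longrightarrow> ap (fn f A) x = f x"
  unfolding ap_def by (rule the1_eqI) (auto simp: elts_fn)

lemma is_seq_fn: "dfun f \<Longrightarrow> is_seq E A (fn f A)"
  unfolding is_seq_iff by (auto simp: elts_fn)

lemma app_fn: "dfun f \<Longrightarrow> x \<in> elts E A \<Longrightarrow> app E (fn f A) x = f x"
  using app_eq_ap[OF is_seq_fn] ap_fn by simp

lemma is_map_fn:
  "dfun f \<Longrightarrow> (\<And>x. x \<in> elts E A \<Longrightarrow> f x \<in> elts E B) \<Longrightarrow> is_map E A B (fn f A)"
  unfolding is_map_def by (simp add: is_seq_fn app_fn)

section \<open>Ordinals and recursion\<close>

abbreviation el :: "'m \<Rightarrow> 'm set" where "el \<equiv> elts E"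
abbreviation mem :: "'m \<Rightarrow> 'm \<Rightarrow> bool" (infix "\<lhd>" 50) where "x \<lhd> y \<equiv> x \<in> elts E y"
abbreviation ord :: "'m \<Rightarrow> bool" where "ord \<equiv> is_ord E"

lemma E_iff: "E x y \<longleftrightarrow> x \<lhd> y"
  unfolding elts_def by simp

lemma mem_irrefl [simp]: "\<not> x \<lhd> x"
  using foundation[of "upair x x"] by auto

lemma mem_asym: "x \<lhd> y \<Longrightarrow> \<not> y \<lhd> x"
  using foundation[of "upair x y"] by auto

lemma mem_no_3_cycle: "x \<lhd> y \<Longrightarrow> y \<lhd> z \<Longrightarrow> \<not> z \<lhd> x"
  using foundation[of "ins x (upair y z)"] by auto

lemma dP_ord [dI]: "dT s \<Longrightarrow> dP (\<lambda>v. is_ord E (s v))"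
  by (rule dP1[of "is_ord E"], unfold is_ord_def, intro dI)

lemma ord_iff:
  "ord a \<longleftrightarrow> (\<forall>x. x \<lhd> a \<longrightarrow> el x \<subseteq> el a) \<and> (\<forall>x y. x \<lhd> a \<longrightarrow> y \<lhd> a \<longrightarrow> x \<lhd> y \<or> x = y \<or> y \<lhd> x)"
  unfolding is_ord_def using E_iff by blast

lemma ord_trans: "ord a \<Longrightarrow> x \<lhd> y \<Longrightarrow> y \<lhd> a \<Longrightarrow> x \<lhd> a"
  unfolding ord_iff by blast

lemma ord_mem: assumes "ord a" "x \<lhd> a" shows "ord x"
  unfolding ord_iff
proof (intro conjI allI impI subsetI)
  fix y z assume "y \<lhd> x" "z \<lhd> y"
  then have "z \<lhd> a" using ord_trans[OF assms(1)] assms(2) by blast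
  then have "z \<lhd> x \<or> z = x \<or> x \<lhd> z" using assms unfolding ord_iff by blast
  then show "z \<lhd> x" using \<open>y \<lhd> x\<close> \<open>z \<lhd> y\<close> mem_asym mem_no_3_cycle by blast
next
  fix y z assume "y \<lhd> x" "z \<lhd> x"
  then show "y \<lhd> z \<or> y = z \<or> z \<lhd> y" using assms unfolding ord_iff by blast
qed

lemma ord_psubset_mem:
  assumes "ord x" "ord y" "el x \<subseteq> el y" "x \<noteq> y"
  shows "x \<lhd> y"
proof -
  define d where "d = sep y (\<lambda>z. \<not> z \<lhd> x)"
  have d: "el d = el y - el x"
    unfolding d_def by (subst elts_sep) (intro dI, auto)
  have "el x \<noteq> el y" using assms(4) set_ext by blast
  then have "el d \<noteq> {}" using assms(3) d by blast
  then obtain m where m: "m \<lhd> d" "el m \<inter> el d = {}" using foundation by blast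
  have "el m \<subseteq> el x" using m d ord_trans[OF assms(2), of _ m] by blast
  moreover have "el x \<subseteq> el m"
  proof
    fix z assume z: "z \<lhd> x"
    then have "z \<lhd> m \<or> z = m \<or> m \<lhd> z" using m d assms(2,3) unfolding ord_iff by blast
    then show "z \<lhd> m" using z m d ord_trans[OF assms(1), of m z] by blast
  qed
  ultimately have "m = x" using set_ext by blast
  then show ?thesis using m d by blast
qed

lemma ord_linear: assumes "ord x" "ord y" shows "x \<lhd> y \<or> x = y \<or> y \<lhd> x"
proof -
  define d where "d = sep x (\<lambda>z. z \<lhd> y)"
  have d: "el d = el x \<inter> el y" unfolding d_def by (subst elts_sep) (intro dI, auto)
  have "ord d" unfolding ord_iff d
    using assms(1)[unfolded ord_iff] assms(2)[unfolded ord_iff]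
    by (intro conjI allI impI subsetI) auto
  have "d = x \<or> d \<lhd> x" "d = y \<or> d \<lhd> y"
    using ord_psubset_mem[OF \<open>ord d\<close> assms(1)] ord_psubset_mem[OF \<open>ord d\<close> assms(2)] d by blast+
  moreover have "\<not> (d \<lhd> x \<and> d \<lhd> y)" using d mem_irrefl[of d] by blast
  ultimately show ?thesis by blast
qed

lemma ord_subset_iff: "ord x \<Longrightarrow> ord y \<Longrightarrow> el x \<subseteq> el y \<longleftrightarrow> x = y \<or> x \<lhd> y"
  using ord_psubset_mem ord_trans by blast

text \<open>Foundation of the model is applied to a separated subset of \<open>x\<close>, hence the
  restriction to definable \<open>P\<close>: seen from outside, the ordinals of the model may
  contain descending sequences.\<close>

lemma ord_ex_least:
  assumes "dpred P" "ord x" "P x"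
  shows "\<exists>m. ord m \<and> P m \<and> (\<forall>y. y \<lhd> m \<longrightarrow> \<not> P y)"
proof (cases "\<exists>y. y \<lhd> x \<and> P y")
  case True
  then obtain m where m: "m \<lhd> sep x P" "el m \<inter> el (sep x P) = {}"
    using foundation[of "sep x P"] elts_sep[OF assms(1), of x] by blast
  then show ?thesis
    using elts_sep[OF assms(1), of x] ord_mem[OF assms(2)] ord_trans[OF assms(2)] by blast
qed (use assms in blast)

lemma ord_induct [consumes 2, case_names step]:
  assumes "dpred P" "ord x"
    and "\<And>x. ord x \<Longrightarrow> (\<And>y. y \<lhd> x \<Longrightarrow> P y) \<Longrightarrow> P x"
  shows "P x"
proof (rule ccontr)
  assume "\<not> P x"
  then obtain m where "ord m" "\<not> P m" "\<forall>y. y \<lhd> m \<longrightarrow> P y"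
    using ord_ex_least[of "\<lambda>x. \<not> P x" x, OF dP_neg[OF assms(1)] assms(2)] by blast
  then show False using assms(3) by blast
qed

lemma ord_emp [simp]: "ord emp"
  unfolding ord_iff by simp

lemma ord_suc [simp]: "ord x \<Longrightarrow> ord (suc x)"
  unfolding ord_iff by auto

lemma ord_union: assumes "\<And>x. x \<lhd> A \<Longrightarrow> ord x" shows "ord (union A)"
  unfolding ord_iff
proof (intro conjI allI impI)
  fix x assume "x \<lhd> union A"
  then obtain a where a: "a \<lhd> A" "x \<lhd> a" by auto
  show "el x \<subseteq> el (union A)" using ord_trans[OF assms[OF a(1)] _ a(2)] a by auto
next
  fix x y assume "x \<lhd> union A" "y \<lhd> union A"
  then have "ord x" "ord y" using assms ord_mem by auto
  then show "x \<lhd> y \<or> x = y \<or> y \<lhd> x" by (rule ord_linear)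
qed

lemma ord_le_union: "(\<And>x. x \<lhd> A \<Longrightarrow> ord x) \<Longrightarrow> a \<lhd> A \<Longrightarrow> a = union A \<or> a \<lhd> union A"
  using ord_subset_iff[of a "union A"] ord_union[of A] by auto

text \<open>Stands in for choice wherever the candidates are ordinals: selecting the least one is
  definable, uniformly in all parameters.\<close>

definition least :: "('m \<Rightarrow> bool) \<Rightarrow> 'm" where
  "least P = the1 (\<lambda>x. ord x \<and> P x \<and> (\<forall>y\<in>el x. \<not> P y))"

lemma dT_least [dI]:
  assumes "dP (\<lambda>w. P (w 0) (\<lambda>n. w (Suc n)))"
  shows "dT (\<lambda>v. least (\<lambda>x. P x v))"
  unfolding least_def by (intro dI assms dP_bind[OF assms])

lemma least:
  assumes "dpred P" "ord x" "P x"
  shows ord_least: "ord (least P)" and least_P: "P (least P)" and not_less_least: "\<And>y. y \<lhd> least P \<Longrightarrow> \<not> P y"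
    and least_le: "least P = x \<or> least P \<lhd> x"
proof -
  obtain m where m: "ord m" "P m" "\<And>y. y \<lhd> m \<Longrightarrow> \<not> P y"
    using ord_ex_least[OF assms] by blast
  have "least P = m" unfolding least_def
    by (rule the1_eqI) (use m ord_linear in blast)+
  then show "ord (least P)" "P (least P)" "\<And>y. y \<lhd> least P \<Longrightarrow> \<not> P y" "least P = x \<or> least P \<lhd> x"
    using m ord_linear[OF m(1) assms(2)] assms(3) by blast+
qed

lemma img_cong: "(\<And>x. x \<lhd> A \<Longrightarrow> f x = g x) \<Longrightarrow> img f A = img g A"
  unfolding img_def by (metis (no_types, lifting))

text \<open>Recursion in which the step sees only the set of earlier values, not the sequence.\<close>

definition approximates :: "('m \<Rightarrow> 'm \<Rightarrow> 'm) \<Rightarrow> 'm \<Rightarrow> 'm \<Rightarrow> bool" where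
  "approximates g f d \<longleftrightarrow> (\<forall>x\<in>el d. ap f x = g x (img (ap f) x))"

definition rec :: "('m \<Rightarrow> 'm \<Rightarrow> 'm) \<Rightarrow> 'm \<Rightarrow> 'm" where
  "rec g a = the1 (\<lambda>y. \<exists>f. approximates g f a \<and> y = g a (img (ap f) a))"

lemma dT_rec [dI]:
  assumes "dT (\<lambda>w. g (w 0) (w (Suc 0)) (\<lambda>n. w (Suc (Suc n))))" "dT s"
  shows "dT (\<lambda>v. rec (\<lambda>a X. g a X v) (s v))"
proof -
  have "dT (\<lambda>w. rec (\<lambda>a X. g a X (\<lambda>n. w (Suc n))) (w 0))"
    unfolding rec_def approximates_def by (intro dI dT_bind2[OF assms(1)])
  from dT_bind[OF this assms(2) dT_var] show ?thesis by simp
qed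

lemma approximates_unique:
  assumes "dfun2 g" "ord a" "ord b" "approximates g f a" "approximates g f' b"
    "x \<lhd> a" "x \<lhd> b"
  shows "ap f x = ap f' x"
proof -
  have d: "dP (\<lambda>v. v 0 \<lhd> a \<longrightarrow> v 0 \<lhd> b \<longrightarrow> ap f (v 0) = ap f' (v 0))" by (intro dI)
  have "ord x" using assms ord_mem by blast
  with d have "x \<lhd> a \<longrightarrow> x \<lhd> b \<longrightarrow> ap f x = ap f' x"
  proof (induction rule: ord_induct)
    case (step x)
    show ?case
    proof (intro impI)
      assume x: "x \<lhd> a" "x \<lhd> b"
      have "img (ap f) x = img (ap f') x"
        by (rule img_cong) (use step x ord_trans assms(2,3) in blast)
      then show "ap f x = ap f' x"
        using assms(4,5) x unfolding approximates_def by simp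
    qed
  qed
  then show ?thesis using assms by blast
qed

lemma approximates_mono: "approximates g f a \<Longrightarrow> ord a \<Longrightarrow> b \<lhd> a \<Longrightarrow> approximates g f b"
  unfolding approximates_def using ord_trans by blast

lemma approximates_rec:
  assumes g: "dfun2 g" and "ord a" "approximates g f a"
  shows "rec g a = g a (img (ap f) a)"
  unfolding rec_def
proof (rule the1_eqI)
  fix y assume "\<exists>f. approximates g f a \<and> y = g a (img (ap f) a)"
  then obtain f' where f': "approximates g f' a" "y = g a (img (ap f') a)" by blast
  have "img (ap f') a = img (ap f) a"
    by (rule img_cong) (use approximates_unique[OF g assms(2,2) f'(1) assms(3)] in blast)
  with f' show "y = g a (img (ap f) a)" by simp
qed (use assms in blast)

lemma ex_approximates:
  assumes g: "dfun2 g" and "ord a"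
  shows "\<exists>f. approximates g f a"
proof -
  have "dP (\<lambda>v. \<exists>f. approximates g f (v 0))"
    unfolding approximates_def by (intro dI dT2[OF g])
  then show ?thesis using assms(2)
  proof (induction rule: ord_induct)
    case (step a)
    have dr: "dT (\<lambda>v. rec g (v 0))" by (intro dT_rec dI dT2[OF g])
    \<comment> \<open>No approximation is selected for the individual arguments below
      \<open>a\<close>: their common values are given by \<open>rec\<close> and are gathered by
      replacement.\<close>
    define F where "F = fn (rec g) a"
    have F: "ap F x = rec g x" if "x \<lhd> a" for x
      unfolding F_def by (rule ap_fn[OF dr that])
    have "ap F x = g x (img (\<lambda>y. ap F y) x)" if x: "x \<lhd> a" for x
    proof -
      obtain f where f: "approximates g f x" using step(2) x by blast
      have ox: "ord x" using ord_mem step(1) x by blast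
      have "ap F y = ap f y" if "y \<lhd> x" for y
      proof -
        have "y \<lhd> a" using ord_trans[OF step(1) that x] .
        have "rec g y = g y (img (ap f) y)"
          by (rule approximates_rec[OF g ord_mem[OF ox that] approximates_mono[OF f ox that]])
        also have "\<dots> = ap f y" using f that unfolding approximates_def by simp
        finally show ?thesis using F[OF \<open>y \<lhd> a\<close>] by simp
      qed
      then have "img (\<lambda>y. ap F y) x = img (ap f) x" by (rule img_cong)
      then show ?thesis using F[OF x] approximates_rec[OF g ox f] by simp
    qed
    then show ?case unfolding approximates_def by blast
  qed
qed

lemma rec_eq:
  assumes g: "dfun2 g" and a: "ord a"
  shows "rec g a = g a (img (rec g) a)"
proof -
  obtain f where f: "approximates g f a" using ex_approximates[OF g a] by blast
  have "ap f x = rec g x" if "x \<lhd> a" for x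
    using approximates_rec[OF g ord_mem[OF a that] approximates_mono[OF f a that]] f that
    unfolding approximates_def by simp
  then have "img (ap f) a = img (rec g) a" by (rule img_cong)
  then show ?thesis using approximates_rec[OF g a f] by simp
qed

lemma ord_mem_suc_iff: "x \<lhd> suc y \<longleftrightarrow> x = y \<or> x \<lhd> y"
  by auto

lemma ord_suc_le: "ord y \<Longrightarrow> x \<lhd> y \<Longrightarrow> suc x = y \<or> suc x \<lhd> y"
  using ord_linear[of "suc x" y] ord_mem[of y x] mem_asym by auto

lemma is_succ_iff [simp]: "is_succ E x y \<longleftrightarrow> y = suc x"
  unfolding is_succ_def by (metis elts_ins set_ext)

lemma is_zero_iff [simp]: "is_zero E x \<longleftrightarrow> x = emp"
  unfolding is_zero_def by (metis elts_emp set_ext)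

lemma limit_ord: "is_limit E a \<Longrightarrow> ord a"
  unfolding is_limit_def by blast

lemma limit_emp: "is_limit E a \<Longrightarrow> emp \<lhd> a"
  unfolding is_limit_def using ord_linear[of emp a] by auto

lemma limit_suc: "is_limit E a \<Longrightarrow> x \<lhd> a \<Longrightarrow> suc x \<lhd> a"
  unfolding is_limit_def using ord_suc_le[of a x] by auto

section \<open>Order types of sets of ordinals, and cardinals\<close>

text \<open>\<open>F\<close> lists \<open>A\<close> in increasing order by recursion. The listing
  must exhaust \<open>A\<close>, since otherwise its inverse would map the set \<open>A\<close> onto
  all ordinals.\<close>

lemma ex_order_type:
  assumes A: "\<And>x. x \<lhd> A \<Longrightarrow> ord x"
  shows "\<exists>t f. ord t \<and> dfun f \<and> bij_betw f (el t) (el A) \<and>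
    (\<forall>x y. x \<lhd> t \<longrightarrow> y \<lhd> t \<longrightarrow> x \<lhd> y \<longrightarrow> f x \<lhd> f y)"
proof -
  define g where "g = (\<lambda>(x::'m) X. if \<exists>y\<in>el A. \<not> y \<lhd> X then least (\<lambda>y. y \<lhd> A \<and> \<not> y \<lhd> X) else A)"
  define F where "F = rec g"
  have dg: "dfun2 g" unfolding g_def by (intro dI)
  have dF: "dfun F" unfolding F_def by (intro dT_rec dI dT2[OF dg])
  have eF: "el (img F a) = F ` el a" for a by (rule elts_img[OF dF])
  have F_eq: "F a = g a (img F a)" if "ord a" for a
    unfolding F_def using rec_eq[OF dg that] by simp
  have F: "F a \<lhd> A \<and> F a \<notin> F ` el a \<and> (\<forall>y. y \<lhd> F a \<longrightarrow> y \<lhd> A \<longrightarrow> y \<in> F ` el a)"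
    if a: "ord a" and na: "\<not> el A \<subseteq> F ` el a" for a
  proof -
    obtain y where y: "y \<lhd> A" "\<not> y \<lhd> img F a" using na eF by blast
    then have eq: "F a = least (\<lambda>y. y \<lhd> A \<and> \<not> y \<lhd> img F a)"
      unfolding F_eq[OF a] g_def by auto
    have d: "dP (\<lambda>v. v 0 \<lhd> A \<and> \<not> v 0 \<lhd> img F a)" by (intro dI)
    have "F a \<lhd> A \<and> \<not> F a \<lhd> img F a" "\<And>z. z \<lhd> F a \<Longrightarrow> \<not> (z \<lhd> A \<and> \<not> z \<lhd> img F a)"
      unfolding eq using least_P[OF d A[OF y(1)]] not_less_least[OF d A[OF y(1)]] y by blast+
    then show ?thesis unfolding eF by blast
  qed
  have "\<exists>a. ord a \<and> el A \<subseteq> F ` el a"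
  proof (rule ccontr)
    assume "\<not> ?thesis"
    then have F': "F a \<lhd> A \<and> F a \<notin> F ` el a" if "ord a" for a using F that by blast
    define h where "h y = the1 (\<lambda>a. ord a \<and> F a = y)" for y
    have dh: "dfun h" unfolding h_def by (intro dI dT1[OF dF])
    have h: "h (F a) = a" if "ord a" for a
      unfolding h_def
    proof (rule the1_eqI)
      fix x assume "ord x \<and> F x = F a"
      then show "x = a" using F'[of x] F'[OF that] ord_linear[of x a] that by (metis imageI)
    qed (use that in blast)
    \<comment> \<open>\<open>B\<close> would be the set of all ordinals and hence an ordinal itself,
      the Burali-Forti contradiction.\<close>
    define B where "B = sep (img h A) ord"
    have "a \<lhd> img h A" if "ord a" for a
    proof -
      have "h (F a) \<in> h ` el A" using F'[OF that] by blast
      then show ?thesis unfolding elts_img[OF dh] h[OF that] .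
    qed
    moreover have "el B = {a \<in> el (img h A). ord a}"
      unfolding B_def by (rule elts_sep) (intro dI)
    ultimately have B: "a \<lhd> B \<longleftrightarrow> ord a" for a by blast
    have "ord B" unfolding ord_iff using B ord_mem ord_linear by blast
    then show False using B mem_irrefl by blast
  qed
  then obtain a0 where a0: "ord a0" "el A \<subseteq> F ` el a0" by blast
  have d: "dP (\<lambda>v. \<forall>y\<in>el A. \<exists>z\<in>el (v 0). y = F z)" by (intro dI dT1[OF dF])
  have conv: "(\<forall>y\<in>el A. \<exists>z\<in>el a. y = F z) \<longleftrightarrow> el A \<subseteq> F ` el a" for a by auto
  obtain t where t: "ord t" "el A \<subseteq> F ` el t"
    and nt: "\<And>y. y \<lhd> t \<Longrightarrow> \<not> el A \<subseteq> F ` el y"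
    using ord_ex_least[of "\<lambda>a. \<forall>y\<in>el A. \<exists>z\<in>el a. y = F z", OF d a0(1)] a0(2)
    unfolding conv by auto
  have Ft: "F x \<lhd> A \<and> F x \<notin> F ` el x \<and> (\<forall>y. y \<lhd> F x \<longrightarrow> y \<lhd> A \<longrightarrow> y \<in> F ` el x)" if "x \<lhd> t" for x
    using F[OF ord_mem[OF t(1) that] nt[OF that]] .
  have lt: "F x \<lhd> F y" if "x \<lhd> t" "y \<lhd> t" "x \<lhd> y" for x y
  proof -
    have "\<not> F y \<lhd> F x"
    proof
      assume "F y \<lhd> F x"
      then have "F y \<in> F ` el x" using Ft[OF that(1)] Ft[OF that(2)] by blast
      then have "F y \<in> F ` el y" using ord_trans[OF ord_mem[OF t(1) that(2)] _ that(3)] by blast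
      then show False using Ft[OF that(2)] by blast
    qed
    moreover have "F x \<noteq> F y" using Ft[OF that(2)] that(3) by (metis imageI)
    ultimately show ?thesis using ord_linear A Ft that by blast
  qed
  have "inj_on F (el t)"
    by (rule inj_onI) (metis lt ord_linear ord_mem t(1) mem_irrefl)
  moreover have "F ` el t = el A" using t(2) Ft by blast
  ultimately show ?thesis
    using t(1) dF lt unfolding bij_betw_def by blast
qed

text \<open>If \<open>f x\<close> lies below \<open>x\<close>, then \<open>f (f x)\<close> lies
  below \<open>f x\<close>, so \<open>f x\<close> is a smaller counterexample.\<close>

lemma le_of_increasing:
  assumes "dfun f" "ord t" "\<And>x. x \<lhd> t \<Longrightarrow> ord (f x)"
    and "\<And>x y. x \<lhd> t \<Longrightarrow> y \<lhd> t \<Longrightarrow> x \<lhd> y \<Longrightarrow> f x \<lhd> f y" and "x \<lhd> t"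
  shows "\<not> f x \<lhd> x"
proof -
  have "dP (\<lambda>v. v 0 \<lhd> t \<longrightarrow> \<not> f (v 0) \<lhd> v 0)" by (intro dI dT1[OF assms(1)])
  then have "x \<lhd> t \<longrightarrow> \<not> f x \<lhd> x" using ord_mem[OF assms(2,5)]
  proof (induction rule: ord_induct)
    case (step x)
    show ?case
    proof (intro impI notI)
      assume x: "x \<lhd> t" "f x \<lhd> x"
      then have fx: "f x \<lhd> t" using ord_trans[OF assms(2)] by blast
      then have "f (f x) \<lhd> f x" using assms(4)[OF fx x(1) x(2)] by blast
      then show False using step(2)[OF x(2)] fx by blast
    qed
  qed
  then show ?thesis using assms(5) by blast
qed

lemma order_type_le:
  assumes "ord b" "el A \<subseteq> el b"
  shows "\<exists>t f. ord t \<and> dfun f \<and> bij_betw f (el t) (el A) \<and>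
    (\<forall>x y. x \<lhd> t \<longrightarrow> y \<lhd> t \<longrightarrow> x \<lhd> y \<longrightarrow> f x \<lhd> f y) \<and> (t = b \<or> t \<lhd> b)"
proof -
  have A: "ord x" if "x \<lhd> A" for x using assms that ord_mem by blast
  obtain t f where t: "ord t" and f: "dfun f" and bij: "bij_betw f (el t) (el A)"
    and mono: "\<And>x y. x \<lhd> t \<Longrightarrow> y \<lhd> t \<Longrightarrow> x \<lhd> y \<Longrightarrow> f x \<lhd> f y"
    using ex_order_type[of A] A by blast
  have fA: "f x \<lhd> A" if "x \<lhd> t" for x using bij that unfolding bij_betw_def by blast
  have "\<not> b \<lhd> t"
  proof
    assume b: "b \<lhd> t"
    then have "f b \<lhd> b" using fA assms(2) by blast
    then show False using le_of_increasing[OF f t _ mono b] fA A by blast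
  qed
  then have "t = b \<or> t \<lhd> b" using ord_linear[OF t assms(1)] by blast
  then show ?thesis using t f bij mono by blast
qed

lemma is_bij_fn:
  assumes "dfun f" "bij_betw f (el A) (el B)"
  shows "is_bij E A B (fn f A)"
proof -
  have "is_map E A B (fn f A)"
    by (rule is_map_fn[OF assms(1)]) (use assms(2) in \<open>auto simp: bij_betw_def\<close>)
  moreover have "bij_betw (app E (fn f A)) (el A) (el B)"
    using assms(2) app_fn[OF assms(1)] by (subst bij_betw_cong[of _ _ f]) auto
  ultimately show ?thesis unfolding is_bij_def by blast
qed

lemma has_otpI:
  assumes "ord t" and f: "dfun f" and bij: "bij_betw f (el t) (el A)"
    and mono: "\<And>x y. x \<lhd> t \<Longrightarrow> y \<lhd> t \<Longrightarrow> x \<lhd> y \<Longrightarrow> f x \<lhd> f y"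
  shows "has_otp E A t"
proof -
  have "E x y \<longleftrightarrow> E (app E (fn f t) x) (app E (fn f t) y)" if "x \<lhd> t" "y \<lhd> t" for x y
    unfolding app_fn[OF f that(1)] app_fn[OF f that(2)]
    using mono[of x y] mono[of y x] that ord_linear[of x y] ord_mem[OF assms(1)]
      mem_asym[of "f x" "f y"] E_iff mem_irrefl by metis
  then show ?thesis unfolding has_otp_def using is_bij_fn[OF f bij] by blast
qed

text \<open>\<open>is_card\<close> excludes only bijections with smaller ordinals. The image of an
  injection is a set of ordinals, so it is replaced by its order type \<open>t\<close>, and
  \<open>h\<close> is the resulting bijection from \<open>t\<close> to \<open>k\<close>; no choice
  enters.\<close>

lemma card_no_inj:
  assumes "is_card E k" "b \<lhd> k" "dfun f" "inj_on f (el k)" "\<And>x. x \<lhd> k \<Longrightarrow> f x \<lhd> b"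
  shows False
proof -
  have k: "ord k" using assms(1) unfolding is_card_def by blast
  have b: "ord b" using ord_mem[OF k assms(2)] .
  have im: "el (img f k) = f ` el k" by (rule elts_img[OF assms(3)])
  have "el (img f k) \<subseteq> el b" unfolding im using assms(5) by auto
  from order_type_le[OF b this] obtain t e where t: "ord t" "t = b \<or> t \<lhd> b"
    and e: "dfun e" and bij: "bij_betw e (el t) (f ` el k)"
    unfolding im by blast
  have tk: "t \<lhd> k" using t(2) assms(2) ord_trans[OF k] by blast
  define h where "h x = the1 (\<lambda>y. y \<lhd> k \<and> f y = e x)" for x
  have dh: "dfun h" unfolding h_def by (intro dI dT1[OF assms(3)] dT1[OF e])
  have h: "h x = y" if "y \<lhd> k" "f y = e x" for x y
    unfolding h_def by (rule the1_eqI) (use that assms(4) in \<open>auto simp: inj_on_def\<close>)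
  have h': "h x \<lhd> k \<and> f (h x) = e x" if "x \<lhd> t" for x
  proof -
    have "e x \<in> f ` el k" using bij that unfolding bij_betw_def by blast
    then obtain y where "y \<lhd> k" "f y = e x" by force
    then show ?thesis using h by simp
  qed
  have "bij_betw h (el t) (el k)"
    unfolding bij_betw_def
  proof
    show "inj_on h (el t)"
    proof (rule inj_onI)
      fix x y assume "x \<lhd> t" "y \<lhd> t" "h x = h y"
      then have "e x = e y" using h'[of x] h'[of y] by simp
      then show "x = y" using bij \<open>x \<lhd> t\<close> \<open>y \<lhd> t\<close> unfolding bij_betw_def inj_on_def by blast
    qed
    show "h ` el t = el k"
    proof
      show "el k \<subseteq> h ` el t"
      proof
        fix y assume y: "y \<lhd> k"
        then obtain x where "x \<lhd> t" "e x = f y" using bij unfolding bij_betw_def by (metis imageE imageI)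
        then show "y \<in> h ` el t" using h[OF y] by force
      qed
    qed (use h' in blast)
  qed
  then have "is_bij E t k (fn h t)" by (rule is_bij_fn[OF dh])
  then show False using assms(1) tk unfolding is_card_def by blast
qed

section \<open>The cumulative hierarchy\<close>

definition Vl :: "'m \<Rightarrow> 'm" where "Vl = rec (\<lambda>a X. union (img power X))"

lemma dT_Vl [dI]: "dT s \<Longrightarrow> dT (\<lambda>v. Vl (s v))"
  unfolding Vl_def by (intro dI)

lemma elts_Vl: "ord a \<Longrightarrow> el (Vl a) = {x. \<exists>b. b \<lhd> a \<and> el x \<subseteq> el (Vl b)}"
proof -
  assume a: "ord a"
  have "dT (\<lambda>v. union (img power (v (Suc 0))))" by (intro dI)
  from rec_eq[OF this a] have "Vl a = union (img power (img Vl a))"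
    unfolding Vl_def by simp
  moreover have "el (img power (img Vl a)) = (\<lambda>b. power (Vl b)) ` el a"
    by (subst elts_img) (intro dI, subst elts_img, intro dI, auto)
  ultimately show ?thesis by auto
qed

lemma Vl_mono: "ord a \<Longrightarrow> b = a \<or> b \<lhd> a \<Longrightarrow> el (Vl b) \<subseteq> el (Vl a)"
  using elts_Vl[of a] elts_Vl[of b] ord_mem[of a b] ord_trans[of a] by blast

lemma Vl_trans: assumes "ord a" "x \<lhd> Vl a" "y \<lhd> x" shows "y \<lhd> Vl a"
proof -
  obtain b where "b \<lhd> a" "el x \<subseteq> el (Vl b)" using assms(2) elts_Vl[OF assms(1)] by blast
  then show ?thesis using Vl_mono[OF assms(1), of b] assms(3) by blast
qed

lemma VlI: "ord a \<Longrightarrow> b \<lhd> a \<Longrightarrow> el x \<subseteq> el (Vl b) \<Longrightarrow> x \<lhd> Vl a"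
  using elts_Vl by blast

lemma ex_Vl_of_elts:
  assumes "\<And>y. y \<lhd> x \<Longrightarrow> \<exists>a. ord a \<and> y \<lhd> Vl a"
  shows "\<exists>a. ord a \<and> x \<lhd> Vl a"
proof -
  define r where "r y = least (\<lambda>a. y \<lhd> Vl a)" for y
  have dr: "dfun r" unfolding r_def by (intro dI)
  have r: "ord (r y) \<and> y \<lhd> Vl (r y)" if "y \<lhd> x" for y
  proof -
    have d: "dP (\<lambda>v. y \<lhd> Vl (v 0))" by (intro dI)
    obtain a where "ord a" "y \<lhd> Vl a" using assms \<open>y \<lhd> x\<close> by blast
    then show ?thesis unfolding r_def using ord_least[OF d] least_P[OF d] by blast
  qed
  have R: "el (img r x) = r ` el x" by (rule elts_img[OF dr])
  define s where "s = union (img r x)"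
  have os: "ord s" unfolding s_def by (rule ord_union) (use R r in auto)
  have "el x \<subseteq> el (Vl s)"
  proof
    fix y assume y: "y \<lhd> x"
    have "r y = s \<or> r y \<lhd> s" unfolding s_def
      by (rule ord_le_union) (use R r y in auto)
    then show "y \<lhd> Vl s" using Vl_mono[OF os, of "r y"] r[OF y] by blast
  qed
  then have "x \<lhd> Vl (suc s)" using VlI[OF ord_suc[OF os], of s] by simp
  then show ?thesis using ord_suc[OF os] by blast
qed

end

section \<open>Induction and dependent choice along the internal omega\<close>

locale zf_om = zf E for E :: "'m \<Rightarrow> 'm \<Rightarrow> bool" +
  fixes om :: 'm
  assumes om: "is_omega E om"
begin

lemma om_limit: "is_limit E om" using om unfolding is_omega_def by blast

lemma om_ord [simp]: "ord om" by (rule limit_ord[OF om_limit])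

lemma emp_om [simp]: "emp \<lhd> om" by (rule limit_emp[OF om_limit])

lemma suc_om: "n \<lhd> om \<Longrightarrow> suc n \<lhd> om" by (rule limit_suc[OF om_limit])

lemma om_cases: assumes "n \<lhd> om" obtains "n = emp" | m where "m \<lhd> om" "n = suc m"
proof -
  have "\<not> is_limit E n" using om assms unfolding is_omega_def by blast
  then have "n = emp \<or> (\<exists>m. n = suc m)"
    using ord_mem[OF om_ord assms] unfolding is_limit_def by auto
  then show ?thesis
  proof
    assume "\<exists>m. n = suc m"
    then obtain m where m: "n = suc m" by blast
    then have "m \<lhd> n" by simp
    then have "m \<lhd> om" using ord_trans[OF om_ord _ assms] by blast
    with m show ?thesis using that by blast
  qed (use that in blast)
qed

lemma om_induct [consumes 2, case_names zero suc]:
  assumes d: "dpred P" and n: "n \<lhd> om"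
    and "P emp" "\<And>n. n \<lhd> om \<Longrightarrow> P n \<Longrightarrow> P (suc n)"
  shows "P n"
proof -
  have d': "dP (\<lambda>v. v 0 \<lhd> om \<longrightarrow> P (v 0))" by (intro dI d)
  have "n \<lhd> om \<longrightarrow> P n" using d' ord_mem[OF om_ord n]
  proof (induction rule: ord_induct)
    case (step x)
    show ?case
    proof
      assume x: "x \<lhd> om"
      then show "P x" using step assms(3,4) by (cases x rule: om_cases) auto
    qed
  qed
  then show ?thesis using n by blast
qed

text \<open>The candidates are ordinals, so the least one is taken at each step. \<open>Q\<close>
  and \<open>R\<close> look only at the set of earlier choices, which is all that \<open>rec\<close>
  provides.\<close>

lemma om_dependent_choice:
  assumes dQ: "dpred Q" and dR: "dpred2 R"
    and base: "Q emp" and ex: "\<And>I. Q I \<Longrightarrow> \<exists>a. ord a \<and> R I a"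
    and step: "\<And>I a. Q I \<Longrightarrow> R I a \<Longrightarrow> Q (ins a I)"
  shows "\<exists>f. dfun f \<and> (\<forall>n. n \<lhd> om \<longrightarrow> Q (img f n) \<and> R (img f n) (f n))"
proof -
  define f where "f = rec (\<lambda>n I. least (R I))"
  have dg: "dT (\<lambda>v. least (R (v (Suc 0))))" by (intro dI dP2[OF dR])
  have df: "dfun f" unfolding f_def by (intro dT_rec dI dP2[OF dR])
  have f_eq: "f n = least (R (img f n))" if "ord n" for n
    using rec_eq[OF dg that] unfolding f_def[symmetric] .
  have im: "el (img f n) = f ` el n" for n by (rule elts_img[OF df])
  have f: "R (img f n) (f n)" if n: "n \<lhd> om" "Q (img f n)" for n
  proof -
    obtain a where a: "ord a" "R (img f n) a" using ex[OF n(2)] by blast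
    have d: "dP (\<lambda>v. R (img f n) (v 0))" by (intro dP2[OF dR] dI)
    show ?thesis unfolding f_eq[OF ord_mem[OF om_ord n(1)]] by (rule least_P[OF d a])
  qed
  have "Q (img f n)" if "n \<lhd> om" for n
  proof -
    have "dP (\<lambda>v. Q (img f (v 0)))" by (intro dP1[OF dQ] dI dT1[OF df])
    then show ?thesis using that
    proof (induction rule: om_induct)
      case zero
      have "img f emp = emp" by (rule set_ext) (simp add: im)
      then show ?case using base by simp
    next
      case (suc n)
      have "img f (suc n) = ins (f n) (img f n)" by (rule set_ext) (simp add: im)
      then show ?case using step[OF suc(2) f[OF suc]] by simp
    qed
  qed
  then show ?thesis using df f by blast
qed

lemma om_limit_le:
  assumes "ord a" "emp \<lhd> a" "\<And>x. x \<lhd> a \<Longrightarrow> \<exists>y. y \<lhd> a \<and> x \<lhd> y"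
  shows "om = a \<or> om \<lhd> a"
proof (rule ccontr)
  assume "\<not> ?thesis"
  then have "a \<lhd> om" using ord_linear[OF assms(1) om_ord] by blast
  then show False
  proof (cases a rule: om_cases)
    case (2 m)
    then obtain y where "y \<lhd> a" "m \<lhd> y" using assms(3)[of m] by auto
    then show False using 2 mem_asym by auto
  qed (use assms(2) in simp)
qed

text \<open>Foundation speaks of sets, so the class of sets without rank is first cut down to the
  transitive closure \<open>tc\<close> of \<open>x\<close>. The stages \<open>T n\<close> collect
  \<open>x\<close> and all members of members of earlier stages; a minimal unranked member of
  \<open>tc\<close> has only ranked members, hence a rank.\<close>

lemma ex_Vl: "\<exists>a. ord a \<and> x \<lhd> Vl a"
proof (rule ccontr)
  assume nx: "\<not> ?thesis"
  define g where "g = (\<lambda>(n::'m) X. cup x (union (union X)))"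
  define T where "T = rec g"
  have dg: "dfun2 g" unfolding g_def by (intro dI)
  have dT: "dfun T" unfolding T_def by (intro dT_rec dI dT2[OF dg])
  have T: "T n = cup x (union (union (img T n)))" if "ord n" for n
    using rec_eq[OF dg that] unfolding T_def[symmetric] unfolding g_def by simp
  have eT: "el (img T n) = T ` el n" for n by (rule elts_img[OF dT])
  define tc where "tc = union (img T om)"
  have tc: "y \<lhd> tc \<longleftrightarrow> (\<exists>n. n \<lhd> om \<and> y \<lhd> T n)" for y
    unfolding tc_def using eT by auto
  have tc_closed: "z \<lhd> tc" if yz: "y \<lhd> tc" "z \<lhd> y" for y z
  proof -
    obtain n where n: "n \<lhd> om" "y \<lhd> T n" using yz(1) unfolding tc by blast
    have "z \<lhd> T (suc n)"
      unfolding T[OF ord_suc[OF ord_mem[OF om_ord n(1)]]] elts_cup elts_union eT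
      using n(2) yz(2) by auto
    then show ?thesis unfolding tc using suc_om[OF n(1)] by blast
  qed
  have x_tc: "el x \<subseteq> el tc"
  proof
    fix y assume "y \<lhd> x"
    then have "y \<lhd> T emp" using T[OF ord_emp] by (metis UnI1 elts_cup)
    then show "y \<lhd> tc" unfolding tc using emp_om by blast
  qed
  define B where "B = sep tc (\<lambda>y. \<not> (\<exists>a. ord a \<and> y \<lhd> Vl a))"
  have "el B = {y \<in> el tc. \<not> (\<exists>a. ord a \<and> y \<lhd> Vl a)}"
    unfolding B_def by (rule elts_sep) (intro dI)
  then have B: "y \<lhd> B \<longleftrightarrow> y \<lhd> tc \<and> \<not> (\<exists>a. ord a \<and> y \<lhd> Vl a)" for y by blast
  obtain y where "y \<lhd> x" "\<not> (\<exists>a. ord a \<and> y \<lhd> Vl a)" using ex_Vl_of_elts nx by blast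
  then have "el B \<noteq> {}" using B x_tc by blast
  then obtain m where "m \<lhd> B" "el m \<inter> el B = {}" using foundation by blast
  then show False using B tc_closed ex_Vl_of_elts[of m] by blast
qed

end

context zf
begin

section \<open>Filters as quantifiers\<close>

definition almost :: "'m \<Rightarrow> 'm \<Rightarrow> ('m \<Rightarrow> bool) \<Rightarrow> bool" where
  "almost S F P \<longleftrightarrow> sep S P \<lhd> F"

definition pos :: "'m \<Rightarrow> 'm \<Rightarrow> ('m \<Rightarrow> bool) \<Rightarrow> bool" where
  "pos S F P \<longleftrightarrow> \<not> almost S F (\<lambda>x. \<not> P x)"

lemma dP_almost [dI]:
  assumes "dT s" "dT f" "dP (\<lambda>w. P (w 0) (\<lambda>n. w (Suc n)))"
  shows "dP (\<lambda>v. almost (s v) (f v) (\<lambda>x. P x v))"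
  unfolding almost_def by (intro dI assms)

lemma dP_pos [dI]:
  assumes "dT s" "dT f" "dP (\<lambda>w. P (w 0) (\<lambda>n. w (Suc n)))"
  shows "dP (\<lambda>v. pos (s v) (f v) (\<lambda>x. P x v))"
  unfolding pos_def by (intro dI assms)

lemma almost_all:
  assumes "is_filter E S F" "\<And>x. x \<lhd> S \<Longrightarrow> P x"
  shows "almost S F P"
proof -
  have "{x. x \<lhd> S \<and> P x} = el S" using assms(2) by auto
  then have "sep S P = S" unfolding sep_def by simp
  then show ?thesis using assms(1) unfolding almost_def is_filter_def by simp
qed

lemma almost_mono:
  assumes "is_filter E S F" "dpred P" "dpred Q" "almost S F P"
    and "\<And>x. x \<lhd> S \<Longrightarrow> P x \<Longrightarrow> Q x"
  shows "almost S F Q"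
proof -
  have "el (sep S P) \<subseteq> el (sep S Q)" "el (sep S Q) \<subseteq> el S"
    unfolding elts_sep[OF assms(2)] elts_sep[OF assms(3)] using assms(5) by auto
  then show ?thesis using assms(1,4) unfolding almost_def is_filter_def by blast
qed

lemma almost_conj:
  assumes "is_filter E S F" "dpred P" "dpred Q" "almost S F P" "almost S F Q"
  shows "almost S F (\<lambda>x. P x \<and> Q x)"
proof -
  obtain Z where Z: "Z \<lhd> F" "el Z = el (sep S P) \<inter> el (sep S Q)"
    using assms(1,4,5) unfolding almost_def is_filter_def by meson
  have d: "dP (\<lambda>v. P (v 0) \<and> Q (v 0))" by (intro dI assms)
  have "sep S (\<lambda>x. P x \<and> Q x) = Z"
    by (rule set_ext) (auto simp: Z(2) elts_sep[OF assms(2)] elts_sep[OF assms(3)] elts_sep[OF d])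
  then show ?thesis using Z(1) unfolding almost_def by simp
qed

lemma almost_ex:
  assumes "is_filter E S F" "dpred P" "almost S F P"
  shows "\<exists>x. x \<lhd> S \<and> P x"
proof -
  have "el (sep S P) \<noteq> {}" using assms(1,3) unfolding almost_def is_filter_def by blast
  then show ?thesis unfolding elts_sep[OF assms(2)] by blast
qed

lemma almost_iff_ex:
  assumes "is_filter E S F" "dpred P"
  shows "almost S F P \<longleftrightarrow> (\<exists>X\<in>el F. el X = {x \<in> el S. P x})"
proof
  assume "\<exists>X\<in>el F. el X = {x \<in> el S. P x}"
  then obtain X where "X \<lhd> F" "el X = el (sep S P)" using elts_sep[OF assms(2)] by auto
  then show "almost S F P" unfolding almost_def using set_ext by metis
qed (use elts_sep[OF assms(2)] in \<open>auto simp: almost_def\<close>)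

lemma almost_of_mem:
  assumes "is_filter E S F" "X \<lhd> F"
  shows "almost S F (\<lambda>x. x \<lhd> X)"
proof -
  have "el X \<subseteq> el S" using assms unfolding is_filter_def by blast
  then have "{x \<in> el S. x \<lhd> X} = el X" by auto
  moreover have "dP (\<lambda>v. v 0 \<lhd> X)" by (intro dI)
  ultimately show ?thesis using almost_iff_ex[OF assms(1)] assms(2) by auto
qed

lemma almost_diag:
  assumes "ord S" "is_filter E S F" "diagonal_closed E S F"
    and d: "dpred2 P" and "\<And>i. i \<lhd> S \<Longrightarrow> almost S F (P i)"
  shows "almost S F (\<lambda>x. \<forall>i\<in>el x. P i x)"
proof -
  define f where "f i = sep S (P i)" for i
  have df: "dfun f" unfolding f_def by (intro dI dP2[OF d])
  have di: "dP (\<lambda>v. P i (v 0))" for i by (intro dI dP2[OF d])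
  have "is_map E S F (fn f S)"
    by (rule is_map_fn[OF df]) (use assms(5) in \<open>auto simp: f_def almost_def\<close>)
  then obtain X where X: "X \<lhd> F" "el X = {x \<in> el S. \<forall>i\<in>el x. x \<lhd> app E (fn f S) i}"
    using assms(3) unfolding diagonal_closed_def by blast
  have "x \<lhd> app E (fn f S) i \<longleftrightarrow> P i x" if "x \<lhd> S" "i \<lhd> x" for x i
    using app_fn[OF df, of i S] ord_trans[OF assms(1) that(2,1)] that
    unfolding f_def elts_sep[OF di] by (simp add: elts_sep[OF di])
  then have "el X = {x \<in> el S. \<forall>i\<in>el x. P i x}" using X(2) by auto
  moreover have "dP (\<lambda>v. \<forall>i\<in>el (v 0). P i (v 0))" by (intro dI dP2[OF d])
  ultimately show ?thesis using almost_iff_ex[OF assms(2)] X(1) by auto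
qed

text \<open>Diagonal closure together with the tails already gives completeness (\<open>normal_tail_complete\<close>).\<close>

definition normal_tail :: "'m \<Rightarrow> 'm \<Rightarrow> bool" where
  "normal_tail S F \<longleftrightarrow> ord S \<and> is_filter E S F \<and> diagonal_closed E S F \<and> (\<forall>b\<in>el S. almost S F (\<lambda>x. b \<lhd> x))"

lemma normal_tail_ord: "normal_tail S F \<Longrightarrow> ord S" and normal_tail_filter: "normal_tail S F \<Longrightarrow> is_filter E S F"
  and normal_tail_tail: "normal_tail S F \<Longrightarrow> b \<lhd> S \<Longrightarrow> almost S F (\<lambda>x. b \<lhd> x)"
  unfolding normal_tail_def by blast+

lemma normal_tail_suc: assumes "normal_tail S F" "x \<lhd> S" shows "suc x \<lhd> S"
proof -
  have "dP (\<lambda>v. x \<lhd> v 0)" by (intro dI)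
  from almost_ex[OF normal_tail_filter[OF assms(1)] this normal_tail_tail[OF assms]]
  obtain y where y: "y \<lhd> S" "x \<lhd> y" by blast
  have "suc x = y \<or> suc x \<lhd> y"
    using ord_suc_le[OF ord_mem[OF normal_tail_ord[OF assms(1)] y(1)] y(2)] .
  then show ?thesis using y(1) ord_trans[OF normal_tail_ord[OF assms(1)]] by blast
qed

lemma normal_tail_diag:
  assumes "normal_tail S F" "dpred2 P" "\<And>i. i \<lhd> S \<Longrightarrow> almost S F (P i)"
  shows "almost S F (\<lambda>x. \<forall>i\<in>el x. P i x)"
  using assms(1) unfolding normal_tail_def by (intro almost_diag assms) auto

text \<open>Above \<open>b\<close>, every index \<open>i\<close> below \<open>b\<close> lies below
  the point \<open>x\<close>, so the diagonal intersection gives the plain one on this tail.\<close>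

lemma normal_tail_complete:
  assumes N: "normal_tail S F" and d: "dpred2 P" and b: "b \<lhd> S"
    and P: "\<And>i. i \<lhd> b \<Longrightarrow> almost S F (P i)"
  shows "almost S F (\<lambda>x. \<forall>i\<in>el b. P i x)"
proof -
  have F: "is_filter E S F" by (rule normal_tail_filter[OF N])
  have d1: "dP (\<lambda>v. v 0 \<lhd> b \<longrightarrow> P (v 0) (v (Suc 0)))" by (intro dI d)
  have 1: "almost S F (\<lambda>x. \<forall>i\<in>el x. i \<lhd> b \<longrightarrow> P i x)"
  proof (rule normal_tail_diag[OF N d1])
    fix i assume "i \<lhd> S"
    show "almost S F (\<lambda>x. i \<lhd> b \<longrightarrow> P i x)"
    proof (cases "i \<lhd> b")
      case True
      then show ?thesis using P by simp
    qed (use almost_all[OF F] in auto)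
  qed
  have d2: "dP (\<lambda>v. \<forall>i\<in>el (v 0). i \<lhd> b \<longrightarrow> P i (v 0))" by (intro dI dP2[OF d])
  have d3: "dP (\<lambda>v. b \<lhd> v 0)" by (intro dI)
  have d4: "dP (\<lambda>v. \<forall>i\<in>el b. P i (v 0))" by (intro dI dP2[OF d])
  have d5: "dP (\<lambda>v. (\<forall>i\<in>el (v 0). i \<lhd> b \<longrightarrow> P i (v 0)) \<and> b \<lhd> v 0)" by (intro dI d2)
  show ?thesis
    by (rule almost_mono[OF F d5 d4 almost_conj[OF F d2 d3 1 normal_tail_tail[OF N b]]])
      (use ord_trans ord_mem[OF normal_tail_ord[OF N]] in blast)
qed

text \<open>The tails above the fewer than \<open>S\<close> many values are intersected. The mere
  existence of such a filter makes \<open>S\<close> regular.\<close>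

lemma normal_tail_regular:
  assumes N: "normal_tail S F" and f: "dfun f" and b: "b \<lhd> S" and "\<And>i. i \<lhd> b \<Longrightarrow> f i \<lhd> S"
  shows "\<exists>y. y \<lhd> S \<and> (\<forall>i\<in>el b. f i \<lhd> y)"
proof -
  have d: "dP (\<lambda>v. f (v 0) \<lhd> v (Suc 0))" by (intro dI dT1[OF f])
  have "almost S F (\<lambda>x. \<forall>i\<in>el b. f i \<lhd> x)"
    by (rule normal_tail_complete[OF N d b]) (use normal_tail_tail[OF N] assms(4) in auto)
  moreover have "dP (\<lambda>v. \<forall>i\<in>el b. f i \<lhd> v 0)" by (intro dI dT1[OF f])
  ultimately show ?thesis using almost_ex[OF normal_tail_filter[OF N], of "\<lambda>x. \<forall>i\<in>el b. f i \<lhd> x"] by blast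
qed

section \<open>Positive sets, pressing down, and the given filters\<close>

lemma pos_mono:
  assumes "is_filter E S F" "dpred P" "dpred Q" "pos S F P"
    and "\<And>x. x \<lhd> S \<Longrightarrow> P x \<Longrightarrow> Q x"
  shows "pos S F Q"
  using almost_mono[OF assms(1) dP_neg[OF assms(3)] dP_neg[OF assms(2)]] assms(4,5)
  unfolding pos_def by blast

lemma pos_conj_almost:
  assumes F: "is_filter E S F" and d: "dpred P" "dpred Q" and "pos S F P" "almost S F Q"
  shows "pos S F (\<lambda>x. P x \<and> Q x)"
  unfolding pos_def
proof
  assume *: "almost S F (\<lambda>x. \<not> (P x \<and> Q x))"
  have "almost S F (\<lambda>x. \<not> P x)"
    by (rule almost_mono[OF F _ _ almost_conj[OF F _ _ * assms(5)]]) (intro dI d | blast)+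
  then show False using assms(4) unfolding pos_def by blast
qed

lemma pos_ex:
  assumes "is_filter E S F" "pos S F P"
  shows "\<exists>x. x \<lhd> S \<and> P x"
  using almost_all[OF assms(1), of "\<lambda>x. \<not> P x"] assms(2) unfolding pos_def by blast

lemma pos_of_almost:
  assumes F: "is_filter E S F" and d: "dpred P" and "almost S F P"
  shows "pos S F P"
proof -
  have "pos S F (\<lambda>x. True)"
    unfolding pos_def using almost_ex[OF F, of "\<lambda>x. \<not> True"] by (auto intro: dI)
  from pos_conj_almost[OF F _ d this assms(3)] show ?thesis by (simp add: dI)
qed

lemma pos_split:
  assumes N: "normal_tail S F" and d: "dpred2 P" and b: "b \<lhd> S"
    and P: "pos S F (\<lambda>x. \<exists>i\<in>el b. P i x)"
  shows "\<exists>i. i \<lhd> b \<and> pos S F (P i)"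
proof (rule ccontr)
  assume *: "\<not> ?thesis"
  have "almost S F (\<lambda>x. \<forall>i\<in>el b. \<not> P i x)"
    by (rule normal_tail_complete[OF N dP_neg[OF d] b]) (use * in \<open>auto simp: pos_def\<close>)
  then show False using P unfolding pos_def by simp
qed

text \<open>Fodor's argument: if every fibre were null, the diagonal intersection of their
  complements would meet the positive set in a point \<open>x\<close> with \<open>f x\<close> not
  below \<open>x\<close>.\<close>

lemma pressing_down:
  assumes N: "normal_tail S F" and d: "dpred P" and f: "dfun f" and P: "pos S F P"
    and "\<And>x. x \<lhd> S \<Longrightarrow> P x \<Longrightarrow> f x \<lhd> x"
  shows "\<exists>y. y \<lhd> S \<and> pos S F (\<lambda>x. P x \<and> f x = y)"
proof (rule ccontr)
  assume *: "\<not> ?thesis"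
  have d1: "dP (\<lambda>v. \<not> (P (v (Suc 0)) \<and> f (v (Suc 0)) = v 0))" by (intro dI dP1[OF d] dT1[OF f])
  have 1: "almost S F (\<lambda>x. \<forall>y\<in>el x. \<not> (P x \<and> f x = y))"
    by (rule normal_tail_diag[OF N d1]) (use * in \<open>auto simp: pos_def\<close>)
  have d2: "dP (\<lambda>v. \<forall>y\<in>el (v 0). \<not> (P (v 0) \<and> f (v 0) = y))" by (intro dI dP1[OF d] dT1[OF f])
  from pos_ex[OF normal_tail_filter[OF N] pos_conj_almost[OF normal_tail_filter[OF N] d d2 P 1]]
  show False using assms(5) by blast
qed

lemma pos_unbounded:
  assumes N: "normal_tail S F" and d: "dpred P" and "pos S F P" "b \<lhd> S"
  shows "\<exists>x. x \<lhd> S \<and> P x \<and> b \<lhd> x"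
proof -
  have "dP (\<lambda>v. b \<lhd> v 0)" by (intro dI)
  from pos_ex[OF normal_tail_filter[OF N] pos_conj_almost[OF normal_tail_filter[OF N] d this assms(3) normal_tail_tail[OF N assms(4)]]]
  show ?thesis by blast
qed

lemma ultra:
  assumes "is_ultrafilter E S F" and d: "dpred P"
  shows "almost S F P \<or> almost S F (\<lambda>x. \<not> P x)"
proof -
  have F: "is_filter E S F" using assms(1) unfolding is_ultrafilter_def by blast
  have dn: "dP (\<lambda>v. \<not> P (v 0))" by (intro dI d)
  have s: "el (sep S P) = {x \<in> el S. P x}" by (rule elts_sep[OF d])
  have "el (sep S P) \<subseteq> el S" unfolding s by blast
  then have "sep S P \<lhd> F \<or> (\<exists>Y\<in>el F. el Y = el S - el (sep S P))"
    using assms(1) unfolding is_ultrafilter_def by blast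
  moreover have "el S - el (sep S P) = {x \<in> el S. \<not> P x}" unfolding s by blast
  ultimately have "sep S P \<lhd> F \<or> (\<exists>Y\<in>el F. el Y = {x \<in> el S. \<not> P x})" by simp
  then show ?thesis unfolding almost_iff_ex[OF F dn, symmetric] unfolding almost_def by blast
qed

text \<open>A singleton in \<open>U\<close> would generate \<open>U\<close> and make it principal.
  So the complements of singletons belong to \<open>U\<close>, and completeness intersects those of
  all points up to \<open>b\<close>.\<close>

lemma normal_measure_normal_tail:
  assumes k: "ord k" and U: "normal_measure E k U"
  shows "normal_tail k U"
proof -
  have F: "is_filter E k U" and UF: "is_ultrafilter E k U" and np: "\<not> principal E k U"
    and cp: "complete_filter E k U" and dg: "diagonal_closed E k U"
    using U unfolding normal_measure_def is_ultrafilter_def by blast+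
  have ne: "almost k U (\<lambda>x. x \<noteq> b)" if b: "b \<lhd> k" for b
  proof (rule ccontr)
    assume "\<not> ?thesis"
    moreover have d: "dP (\<lambda>v. v 0 \<noteq> b)" by (intro dI)
    moreover have d': "dP (\<lambda>v. v 0 = b)" by (intro dI)
    ultimately have 1: "almost k U (\<lambda>x. x = b)" using ultra[OF UF, of "\<lambda>x. x \<noteq> b"] by simp
    have sg: "sep k (\<lambda>x. x = b) = upair b b"
      by (rule set_ext) (use b in \<open>auto simp: elts_sep[OF d']\<close>)
    have "el U = {X. el (upair b b) \<subseteq> el X \<and> el X \<subseteq> el k}"
    proof (rule set_eqI, rule iffI)
      fix X assume X: "X \<lhd> U"
      have "el X \<subseteq> el k" using F X unfolding is_filter_def by blast
      have "almost k U (\<lambda>x. x = b \<and> x \<lhd> X)"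
        by (rule almost_conj[OF F d' _ 1 almost_of_mem[OF F X]]) (intro dI)
      moreover have "dP (\<lambda>v. v 0 = b \<and> v 0 \<lhd> X)" by (intro dI)
      ultimately obtain x where "x = b \<and> x \<lhd> X" using almost_ex[OF F, of "\<lambda>x. x = b \<and> x \<lhd> X"] by blast
      with \<open>el X \<subseteq> el k\<close> show "X \<in> {X. el (upair b b) \<subseteq> el X \<and> el X \<subseteq> el k}" by auto
    next
      fix X assume "X \<in> {X. el (upair b b) \<subseteq> el X \<and> el X \<subseteq> el k}"
      then show "X \<lhd> U" using F 1 unfolding almost_def sg is_filter_def by blast
    qed
    moreover have "el (upair b b) \<subseteq> el k" using b by simp
    ultimately show False using np unfolding principal_def by blast
  qed
  have "almost k U (\<lambda>x. b \<lhd> x)" if b: "b \<lhd> k" for b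
  proof -
    define f where "f = (\<lambda>i. sep k (\<lambda>x. x \<noteq> i))"
    have df: "dfun f" unfolding f_def by (intro dI)
    have dn: "dP (\<lambda>v. v 0 \<noteq> i)" for i by (intro dI)
    have bk: "i \<lhd> k" if "i \<lhd> b" for i using ord_trans[OF k that b] .
    have "is_map E b U (fn f b)"
      by (rule is_map_fn[OF df]) (use ne bk in \<open>auto simp: f_def almost_def\<close>)
    then obtain X where X: "X \<lhd> U" "el X = {x \<in> el k. \<forall>i\<in>el b. x \<lhd> app E (fn f b) i}"
      using cp b unfolding complete_filter_def by blast
    have "el X = {x \<in> el k. \<forall>i\<in>el b. x \<noteq> i}"
      unfolding X(2) using app_fn[OF df] by (auto simp: f_def elts_sep[OF dn])
    then have 1: "almost k U (\<lambda>x. \<forall>i\<in>el b. x \<noteq> i)"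
      using X(1) by (subst almost_iff_ex[OF F]) (intro dI, blast)
    have "almost k U (\<lambda>x. (\<forall>i\<in>el b. x \<noteq> i) \<and> x \<noteq> b)"
      by (rule almost_conj[OF F _ dn 1 ne[OF b]]) (intro dI)
    then show ?thesis
      by (rule almost_mono[OF F, rotated 2])
        (use ord_linear[OF ord_mem[OF k b] ord_mem[OF k]] in auto, (intro dI)+)
  qed
  then show ?thesis unfolding normal_tail_def using k F dg by blast
qed

end

context zf_om
begin

lemma normal_filter_normal_tail:
  assumes k: "ord k" and "om \<lhd> k" and U: "normal_filter E k F" "dual_ideal_contains_small E k F"
  shows "normal_tail k F"
proof -
  have F: "is_filter E k F" and dg: "diagonal_closed E k F"
    using U unfolding normal_filter_def by blast+
  have small: "almost k F (\<lambda>x. \<not> x \<lhd> X)" if "el X \<subseteq> el k" "b \<lhd> k" "bij_betw f (el b) (el X)" "dfun f" for X b f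
  proof -
    have "in_dual_ideal E k F X"
      using U(2) that is_bij_fn[OF that(4,3)] unfolding dual_ideal_contains_small_def by blast
    moreover have "el k - el X = {x \<in> el k. \<not> x \<lhd> X}" by blast
    ultimately show ?thesis
      unfolding in_dual_ideal_def by (subst almost_iff_ex[OF F]) (intro dI, auto)
  qed
  have "almost k F (\<lambda>x. b \<lhd> x)" if b: "b \<lhd> k" for b
  proof -
    have "el b \<subseteq> el k" using ord_trans[OF k _ b] by blast
    then have 1: "almost k F (\<lambda>x. \<not> x \<lhd> b)"
      by (rule small[OF _ b, of _ "\<lambda>x. x"]) (auto simp: bij_betw_def intro: dI)
    have "suc emp \<lhd> k" using ord_trans[OF k suc_om[OF emp_om] assms(2)] .
    \<comment> \<open>The singleton of \<open>b\<close> is small as well, being in bijection with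
      the ordinal one, \<open>suc emp\<close>.\<close>
    then have 2: "almost k F (\<lambda>x. \<not> x \<lhd> upair b b)"
      by (rule small[rotated, of _ "\<lambda>_. b"]) (use b in \<open>auto simp: bij_betw_def intro: dI\<close>)
    have "almost k F (\<lambda>x. \<not> x \<lhd> b \<and> \<not> x \<lhd> upair b b)"
      by (rule almost_conj[OF F _ _ 1 2]) (intro dI)+
    then show ?thesis
      by (rule almost_mono[OF F, rotated 2])
        (use ord_linear[OF ord_mem[OF k b] ord_mem[OF k]] in auto, (intro dI)+)
  qed
  then show ?thesis unfolding normal_tail_def using k F dg by blast
qed

end

context zf
begin

section \<open>Reflection and simultaneous choice of definable elements\<close>

lemma ex_ord_bound:
  assumes f: "dfun f" and "\<And>x. x \<lhd> A \<Longrightarrow> ord (f x)"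
  shows "\<exists>s. ord s \<and> (\<forall>x\<in>el A. f x \<lhd> s)"
proof -
  have R: "el (img f A) = f ` el A" by (rule elts_img[OF f])
  have o: "ord x" if "x \<lhd> img f A" for x using that R assms(2) by auto
  have "f x \<lhd> suc (union (img f A))" if "x \<lhd> A" for x
    using ord_le_union[of "img f A" "f x"] o R that by auto
  then show ?thesis using ord_suc[OF ord_union[of "img f A"]] o by blast
qed

lemma ord_least': assumes "dpred P" shows "ord (least P)"
proof (cases "\<exists>x. ord x \<and> P x")
  case True
  then show ?thesis using ord_least[OF assms] by blast
next
  case False
  then have "least P = emp" unfolding least_def the1_def by auto
  then show ?thesis by simp
qed

text \<open>Names only the standard naturals of the model; these suffice as variable indices of
  standard formulas.\<close>

primrec num :: "nat \<Rightarrow> 'm" where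
  "num 0 = emp"
| "num (Suc n) = suc (num n)"

lemma suc_inject: "suc x = suc y \<Longrightarrow> x = y"
  by (metis elts_ins insertCI insertE mem_asym)

lemma suc_neq_emp: "suc x \<noteq> emp"
  by (metis elts_emp elts_ins insert_not_empty)

lemma num_inject: "num m = num n \<longleftrightarrow> m = n"
proof (induction m arbitrary: n)
  case 0
  show ?case by (cases n) (simp_all add: suc_neq_emp[symmetric])
next
  case (Suc m)
  show ?case
  proof (cases n)
    case (Suc k)
    then show ?thesis using suc_inject[of "num m" "num k"] Suc.IH[of k] by (simp, blast)
  qed (simp add: suc_neq_emp)
qed

text \<open>Any element \<open>a\<close> of the model serves as an assignment, with \<open>ap a (num k)\<close> as the value of variable \<open>k\<close>.\<close>

definition assign :: "'m \<Rightarrow> nat \<Rightarrow> 'm" where "assign a k = ap a (num k)"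

text \<open>\<open>a\<close> need not be a function: all pairs with first component \<open>n\<close>
  are discarded before the new one is inserted, which makes the value at \<open>n\<close> unique and
  keeps the others.\<close>

definition update :: "'m \<Rightarrow> 'm \<Rightarrow> 'm \<Rightarrow> 'm" where
  "update a n x = ins (opr n x) (sep a (\<lambda>p. \<not> (\<exists>y. p = opr n y)))"

lemma dT_update [dI]: "dT s \<Longrightarrow> dT t \<Longrightarrow> dT u \<Longrightarrow> dT (\<lambda>v. update (s v) (t v) (u v))"
  by (rule dT3[of update]) (unfold update_def, intro dI)

lemma ap_update: "ap (update a n x) m = (if m = n then x else ap a m)"
proof -
  have s: "el (sep a (\<lambda>p. \<not> (\<exists>y. p = opr n y))) = {p \<in> el a. \<not> (\<exists>y. p = opr n y)}"
    by (rule elts_sep) (intro dI)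
  have *: "opr m b \<lhd> update a n x \<longleftrightarrow> (if m = n then b = x else opr m b \<lhd> a)" for b
    unfolding update_def elts_ins s by (cases "m = n") simp_all
  show ?thesis
    unfolding ap_def * by (cases "m = n") (simp_all add: the1_eqI)
qed

lemma assign_update: "assign (update a (num n) x) = (assign a)(n := x)"
  by (auto simp: assign_def ap_update num_inject fun_eq_iff)

lemma dP_sat_assign:
  assumes "dT s" "dT t"
  shows "dP (\<lambda>v. sat E p ((assign (s v))(n := t v)))"
proof -
  have "dT (if k = n then t else (\<lambda>v. ap (s v) (num k)))" for k
    by (cases "k = n") (auto intro: dI assms)
  from dP_sat[OF this, of p]
  have "dP (\<lambda>v. sat E p (\<lambda>k. (if k = n then t else (\<lambda>v. ap (s v) (num k))) v))" .
  moreover have "(\<lambda>k. (if k = n then t else (\<lambda>v. ap (s v) (num k))) v) = (assign (s v))(n := t v)" for v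
    by (auto simp: assign_def fun_eq_iff)
  ultimately show ?thesis by simp
qed

text \<open>Skolem closure for the subformulas of \<open>p\<close>: a universal statement that fails
  under an assignment from \<open>Vl a\<close> has a counterexample in \<open>Vl b\<close>. Truth
  has no uniform definition in the model, so this is a separate definable relation for each
  \<open>p\<close>.\<close>

primrec witness :: "fm \<Rightarrow> 'm \<Rightarrow> 'm \<Rightarrow> bool" where
  "witness (FMem m n) a b = True"
| "witness (FEq m n) a b = True"
| "witness (FNeg p) a b = witness p a b"
| "witness (FConj p q) a b = (witness p a b \<and> witness q a b)"
| "witness (FAll n p) a b = (witness p a b \<and>
     (\<forall>u\<in>el (Vl a). (\<exists>x. \<not> sat E p ((assign u)(n := x))) \<longrightarrow>
        (\<exists>x\<in>el (Vl b). \<not> sat E p ((assign u)(n := x)))))"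

lemma dP_witness [dI]: "dT s \<Longrightarrow> dT t \<Longrightarrow> dP (\<lambda>v. witness p (s v) (t v))"
proof (rule dP2[of "witness p"], goal_cases)
  case 1
  show ?case
  proof (induction p)
    case (FConj p q)
    show ?case unfolding witness.simps by (intro dI FConj)
  next
    case (FAll n p)
    show ?case unfolding witness.simps by (intro dI dP_sat_assign FAll)
  qed (unfold witness.simps, (intro dI | assumption)+)
qed

lemma witness_mono: "witness p a b \<Longrightarrow> ord c \<Longrightarrow> b = c \<or> b \<lhd> c \<Longrightarrow> witness p a c"
proof (induction p)
  case (FAll n p)
  have "el (Vl b) \<subseteq> el (Vl c)" using Vl_mono FAll.prems by blast
  with FAll show ?case unfolding witness.simps by blast
qed auto

end

context zf_om
begin

text \<open>For each assignment \<open>u\<close> the least level containing a counterexample is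
  definable from \<open>u\<close>; replacement bounds these levels over the set
  \<open>Vl a\<close>.\<close>

lemma ex_witness: "\<exists>b. ord b \<and> witness p a b"
proof (induction p)
  case (FConj p q)
  then obtain b c where "ord b" "witness p a b" "ord c" "witness q a c" by blast
  then show ?case using ord_linear[of b c] witness_mono[of p a b c] witness_mono[of q a c b]
    unfolding witness.simps by blast
next
  case (FAll n p)
  then obtain b where b: "ord b" "witness p a b" by blast
  define r where "r u = least (\<lambda>c. \<exists>x\<in>el (Vl c). \<not> sat E p ((assign u)(n := x)))" for u
  have d: "dP (\<lambda>v. \<exists>x\<in>el (Vl (v 0)). \<not> sat E p ((assign u)(n := x)))" for u
    by (intro dI dP_sat_assign)
  have dr: "dfun r" unfolding r_def by (intro dI dP_sat_assign)
  obtain s where s: "ord s" "\<forall>u\<in>el (Vl a). r u \<lhd> s"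
    using ex_ord_bound[OF dr, of "Vl a"] ord_least'[OF d] unfolding r_def by blast
  have "\<exists>x\<in>el (Vl s). \<not> sat E p ((assign u)(n := x))"
    if u: "u \<lhd> Vl a" and x: "\<not> sat E p ((assign u)(n := x))" for u x
  proof -
    obtain c where "ord c" "x \<lhd> Vl c" using ex_Vl by blast
    then have "\<exists>x\<in>el (Vl (r u)). \<not> sat E p ((assign u)(n := x))"
      unfolding r_def using least_P[OF d, of c u] x by blast
    then show ?thesis using Vl_mono[OF s(1), of "r u"] s(2) u by blast
  qed
  then have w: "\<forall>u\<in>el (Vl a). (\<exists>x. \<not> sat E p ((assign u)(n := x))) \<longrightarrow>
      (\<exists>x\<in>el (Vl s). \<not> sat E p ((assign u)(n := x)))" by blast
  show ?case
  proof (cases "b = s \<or> b \<lhd> s")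
    case True
    then show ?thesis using witness_mono[OF b(2) s(1)] w s(1) unfolding witness.simps by blast
  next
    case False
    then have "s \<lhd> b" using ord_linear b(1) s(1) by blast
    then have "el (Vl s) \<subseteq> el (Vl b)" using Vl_mono b(1) by blast
    then have "witness (FAll n p) a b" unfolding witness.simps using b w by blast
    then show ?thesis using b(1) by blast
  qed
qed (auto intro: ord_emp)

end

context zf
begin

section \<open>Limit levels, and sets of assignments as codes\<close>

definition lim :: "'m \<Rightarrow> bool" where
  "lim b \<longleftrightarrow> ord b \<and> emp \<lhd> b \<and> (\<forall>x\<in>el b. suc x \<lhd> b)"

lemma lim_VlE:
  assumes "lim b" "x \<lhd> Vl b" "y \<lhd> Vl b"
  obtains c where "c \<lhd> b" "ord c" "x \<lhd> Vl c" "y \<lhd> Vl c" "el x \<subseteq> el (Vl c)" "el y \<subseteq> el (Vl c)"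
proof -
  have b: "ord b" using assms(1) unfolding lim_def by blast
  obtain c d where c: "c \<lhd> b" "el x \<subseteq> el (Vl c)" and d: "d \<lhd> b" "el y \<subseteq> el (Vl d)"
    using assms(2,3) elts_Vl[OF b] by blast
  have "\<exists>e. e \<lhd> b \<and> (c = e \<or> c \<lhd> e) \<and> (d = e \<or> d \<lhd> e)"
    using c(1) d(1) ord_linear ord_mem[OF b] by blast
  then obtain e where e: "e \<lhd> b" "c = e \<or> c \<lhd> e" "d = e \<or> d \<lhd> e" by blast
  have oe: "ord e" using ord_mem[OF b e(1)] .
  have "el x \<subseteq> el (Vl e)" "el y \<subseteq> el (Vl e)" using Vl_mono[OF oe] c d e by blast+
  moreover from this have "x \<lhd> Vl (suc e)" "y \<lhd> Vl (suc e)"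
    using VlI[OF ord_suc[OF oe], of e] by auto
  moreover have "el (Vl e) \<subseteq> el (Vl (suc e))" using Vl_mono[OF ord_suc[OF oe], of e] by simp
  moreover have "suc e \<lhd> b" using assms(1) e(1) unfolding lim_def by blast
  ultimately show ?thesis using that[of "suc e"] ord_suc[OF oe] by blast
qed

lemma lim_Vl_sub:
  assumes "lim b" "c \<lhd> b" "el x \<subseteq> el (Vl c)"
  shows "x \<lhd> Vl b"
  using VlI[of b c x] assms unfolding lim_def by blast

lemma lim_Vl_upair: assumes "lim b" "x \<lhd> Vl b" "y \<lhd> Vl b" shows "upair x y \<lhd> Vl b"
proof -
  from assms obtain c where "c \<lhd> b" "x \<lhd> Vl c" "y \<lhd> Vl c" by (rule lim_VlE)
  then show ?thesis using lim_Vl_sub[OF assms(1), of c "upair x y"] by simp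
qed

lemma lim_Vl_opr: "lim b \<Longrightarrow> x \<lhd> Vl b \<Longrightarrow> y \<lhd> Vl b \<Longrightarrow> opr x y \<lhd> Vl b"
  unfolding opr_def by (intro lim_Vl_upair)

lemma lim_Vl_ins: assumes "lim b" "x \<lhd> Vl b" "y \<lhd> Vl b" shows "ins x y \<lhd> Vl b"
proof -
  from assms obtain c where "c \<lhd> b" "x \<lhd> Vl c" "el y \<subseteq> el (Vl c)" by (rule lim_VlE)
  then show ?thesis using lim_Vl_sub[OF assms(1), of c "ins x y"] by simp
qed

lemma lim_Vl_subset: assumes "lim b" "x \<lhd> Vl b" "el y \<subseteq> el x" shows "y \<lhd> Vl b"
proof -
  from assms(1,2,2) obtain c where "c \<lhd> b" "el x \<subseteq> el (Vl c)" by (rule lim_VlE)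
  then show ?thesis using lim_Vl_sub[OF assms(1), of c y] assms(3) by blast
qed

lemma lim_Vl_emp: "lim b \<Longrightarrow> emp \<lhd> Vl b"
  using lim_Vl_sub[of b emp emp] unfolding lim_def by simp

lemma lim_Vl_num: "lim b \<Longrightarrow> num k \<lhd> Vl b"
  by (induction k) (auto intro: lim_Vl_emp lim_Vl_ins)

text \<open>Closure under updates makes \<open>code_all\<close> read a quantifier correctly: the
  updated assignments must themselves belong to the level whose subsets are the codes.\<close>

lemma lim_Vl_update:
  assumes "lim b" "a \<lhd> Vl b" "n \<lhd> Vl b" "x \<lhd> Vl b"
  shows "update a n x \<lhd> Vl b"
proof -
  have "el (sep a (\<lambda>p. \<not> (\<exists>y. p = opr n y))) = {p \<in> el a. \<not> (\<exists>y. p = opr n y)}"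
    by (rule elts_sep) (intro dI)
  then have "el (sep a (\<lambda>p. \<not> (\<exists>y. p = opr n y))) \<subseteq> el a" by simp
  then show ?thesis unfolding update_def
    by (intro lim_Vl_ins lim_Vl_opr assms lim_Vl_subset[OF assms(1,2)])
qed

text \<open>In place of internal formula codes, the sets of assignments below are generated from \<open>emp\<close> by
  finitely many binary operations; \<open>code_neg\<close> and \<open>code_suc\<close> ignore their second argument only to have
  the uniform arity.\<close>

definition image2 :: "('m \<Rightarrow> 'm \<Rightarrow> 'm) \<Rightarrow> 'm \<Rightarrow> 'm" where
  "image2 f R = union (img (\<lambda>x. img (\<lambda>y. f x y) R) R)"

lemma dT_image2 [dI]:
  assumes "dT (\<lambda>w. f (w 0) (w (Suc 0)) (\<lambda>n. w (Suc (Suc n))))" "dT s"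
  shows "dT (\<lambda>v. image2 (\<lambda>x y. f x y v) (s v))"
  unfolding image2_def by (intro dI assms dT_bind2[OF assms(1)] dT_weak[OF assms(2)])

lemma elts_image2:
  assumes d: "dfun2 f"
  shows "el (image2 f R) = {f x y | x y. x \<lhd> R \<and> y \<lhd> R}"
proof -
  have 1: "dT (\<lambda>v. img (\<lambda>y. f (v 0) y) R)" by (intro dI dT2[OF d])
  have 2: "dT (\<lambda>v. f x (v 0))" for x by (intro dI dT2[OF d])
  show ?thesis unfolding image2_def by (auto simp: elts_img[OF 1] elts_img[OF 2])
qed

text \<open>With \<open>A\<close> a level of the hierarchy and numerals as variable indices, these
  operations form satisfaction sets over \<open>A\<close>. In \<open>code_all\<close> the same
  \<open>A\<close> serves as the set of assignments and as the range of the quantifier.\<close>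

definition code_mem :: "'m \<Rightarrow> 'm \<Rightarrow> 'm \<Rightarrow> 'm" where "code_mem A x y = sep A (\<lambda>a. ap a x \<lhd> ap a y)"
definition code_eq :: "'m \<Rightarrow> 'm \<Rightarrow> 'm \<Rightarrow> 'm" where "code_eq A x y = sep A (\<lambda>a. ap a x = ap a y)"
definition code_neg :: "'m \<Rightarrow> 'm \<Rightarrow> 'm \<Rightarrow> 'm" where "code_neg A x y = sep A (\<lambda>a. \<not> a \<lhd> x)"
definition code_conj :: "'m \<Rightarrow> 'm \<Rightarrow> 'm \<Rightarrow> 'm" where "code_conj A x y = sep A (\<lambda>a. a \<lhd> x \<and> a \<lhd> y)"
definition code_all :: "'m \<Rightarrow> 'm \<Rightarrow> 'm \<Rightarrow> 'm" where "code_all A x y = sep A (\<lambda>a. \<forall>z\<in>el A. update a x z \<lhd> y)"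
definition code_suc :: "'m \<Rightarrow> 'm \<Rightarrow> 'm" where "code_suc x y = suc x"

lemma dT_ops [dI]:
  assumes "dT r" "dT s" "dT t"
  shows "dT (\<lambda>v. code_mem (r v) (s v) (t v))" "dT (\<lambda>v. code_eq (r v) (s v) (t v))"
    "dT (\<lambda>v. code_neg (r v) (s v) (t v))" "dT (\<lambda>v. code_conj (r v) (s v) (t v))"
    "dT (\<lambda>v. code_all (r v) (s v) (t v))"
  by (rule dT3[OF _ assms]; unfold code_mem_def code_eq_def code_neg_def code_conj_def code_all_def; intro dI)+

lemma dT_code_suc [dI]: "dT s \<Longrightarrow> dT t \<Longrightarrow> dT (\<lambda>v. code_suc (s v) (t v))"
  unfolding code_suc_def by (intro dI)

definition code_step :: "'m \<Rightarrow> 'm \<Rightarrow> 'm" where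
  "code_step A R = cup R (cup (image2 (\<lambda>x y. code_suc x y) R) (cup (image2 (\<lambda>x y. code_mem A x y) R)
     (cup (image2 (\<lambda>x y. code_eq A x y) R) (cup (image2 (\<lambda>x y. code_neg A x y) R)
     (cup (image2 (\<lambda>x y. code_conj A x y) R) (image2 (\<lambda>x y. code_all A x y) R))))))"

lemma dT_code_step [dI]: "dT s \<Longrightarrow> dT t \<Longrightarrow> dT (\<lambda>v. code_step (s v) (t v))"
  by (rule dT2[of code_step]) (unfold code_step_def, intro dI)

definition level :: "'m \<Rightarrow> 'm \<Rightarrow> 'm" where
  "level A = rec (\<lambda>n X. code_step A (ins emp (union X)))"

lemma dT_level [dI]: "dT s \<Longrightarrow> dT t \<Longrightarrow> dT (\<lambda>v. level (s v) (t v))"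
  by (rule dT2[of level]) (unfold level_def, intro dI)

lemma level_eq: "ord n \<Longrightarrow> level A n = code_step A (ins emp (union (img (level A) n)))"
  unfolding level_def by (subst rec_eq) (intro dI, assumption, simp)

end

context zf_om
begin

text \<open>The stages run through the internal \<open>om\<close>, so nonstandard stages may add
  elements that no standard formula denotes. They do no harm, because candidates are later tested
  for the desired property.\<close>

definition codes :: "'m \<Rightarrow> 'm" where "codes A = union (img (level A) om)"

lemma dT_codes [dI]: "dT s \<Longrightarrow> dT (\<lambda>v. codes (s v))"
  by (rule dT1[of codes]) (unfold codes_def, intro dI)

lemma mem_codes: "x \<lhd> codes A \<longleftrightarrow> (\<exists>n. n \<lhd> om \<and> x \<lhd> level A n)"
proof -
  have "el (img (level A) om) = (level A) ` el om" by (rule elts_img) (intro dI)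
  then show ?thesis unfolding codes_def by auto
qed

lemma mem_level_sup: "ord n \<Longrightarrow> m \<lhd> n \<Longrightarrow> x \<lhd> level A m \<Longrightarrow> x \<lhd> ins emp (union (img (level A) n))"
proof -
  have "el (img (level A) n) = (level A) ` el n" for n by (rule elts_img) (intro dI)
  then show "m \<lhd> n \<Longrightarrow> x \<lhd> level A m \<Longrightarrow> ?thesis" by auto
qed

lemma codes_emp: "emp \<lhd> codes A"
proof -
  have "emp \<lhd> level A emp" unfolding level_eq[OF ord_emp] code_step_def by simp
  then show ?thesis unfolding mem_codes using emp_om by blast
qed

lemma codes_ops:
  assumes "x \<lhd> codes A" "y \<lhd> codes A"
  shows "suc x \<lhd> codes A" "code_mem A x y \<lhd> codes A" "code_eq A x y \<lhd> codes A" "code_neg A x y \<lhd> codes A"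
    "code_conj A x y \<lhd> codes A" "code_all A x y \<lhd> codes A"
proof -
  obtain m n where m: "m \<lhd> om" "x \<lhd> level A m" and n: "n \<lhd> om" "y \<lhd> level A n"
    using assms unfolding mem_codes by blast
  have "\<exists>e. e \<lhd> om \<and> (m = e \<or> m \<lhd> e) \<and> (n = e \<or> n \<lhd> e)"
    using m(1) n(1) ord_linear ord_mem[OF om_ord] by blast
  then obtain e where e: "e \<lhd> om" "m \<lhd> suc e" "n \<lhd> suc e" unfolding ord_mem_suc_iff by blast
  have os: "ord (suc e)" using ord_suc[OF ord_mem[OF om_ord e(1)]] .
  define R where "R = ins emp (union (img (level A) (suc e)))"
  have R: "x \<lhd> R" "y \<lhd> R" unfolding R_def using mem_level_sup[OF os] m n e by blast+
  have d: "dT (\<lambda>v. code_suc (v 0) (v (Suc 0)))" "dT (\<lambda>v. code_mem A (v 0) (v (Suc 0)))"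
    "dT (\<lambda>v. code_eq A (v 0) (v (Suc 0)))" "dT (\<lambda>v. code_neg A (v 0) (v (Suc 0)))"
    "dT (\<lambda>v. code_conj A (v 0) (v (Suc 0)))" "dT (\<lambda>v. code_all A (v 0) (v (Suc 0)))" by (intro dI)+
  have "code_suc x y \<lhd> image2 (\<lambda>x y. code_suc x y) R" "code_mem A x y \<lhd> image2 (\<lambda>x y. code_mem A x y) R"
    "code_eq A x y \<lhd> image2 (\<lambda>x y. code_eq A x y) R" "code_neg A x y \<lhd> image2 (\<lambda>x y. code_neg A x y) R"
    "code_conj A x y \<lhd> image2 (\<lambda>x y. code_conj A x y) R" "code_all A x y \<lhd> image2 (\<lambda>x y. code_all A x y) R"
    unfolding elts_image2[OF d(1)] elts_image2[OF d(2)] elts_image2[OF d(3)] elts_image2[OF d(4)]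
      elts_image2[OF d(5)] elts_image2[OF d(6)] using R by blast+
  then have "code_suc x y \<lhd> level A (suc e)" "code_mem A x y \<lhd> level A (suc e)" "code_eq A x y \<lhd> level A (suc e)"
    "code_neg A x y \<lhd> level A (suc e)" "code_conj A x y \<lhd> level A (suc e)" "code_all A x y \<lhd> level A (suc e)"
    unfolding level_eq[OF os] R_def[symmetric] code_step_def elts_cup by blast+
  then show "suc x \<lhd> codes A" "code_mem A x y \<lhd> codes A" "code_eq A x y \<lhd> codes A" "code_neg A x y \<lhd> codes A"
    "code_conj A x y \<lhd> codes A" "code_all A x y \<lhd> codes A"
    unfolding mem_codes code_suc_def using suc_om[OF e(1)] by blast+
qed

lemma codes_num: "num k \<lhd> codes A"
  by (induction k) (auto intro: codes_emp codes_ops(1))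

text \<open>The recursion runs in HOL over a standard formula, whereas each value is an element of
  the model.\<close>

primrec denot :: "'m \<Rightarrow> fm \<Rightarrow> 'm" where
  "denot A (FMem m n) = code_mem A (num m) (num n)"
| "denot A (FEq m n) = code_eq A (num m) (num n)"
| "denot A (FNeg p) = code_neg A (denot A p) emp"
| "denot A (FConj p q) = code_conj A (denot A p) (denot A q)"
| "denot A (FAll n p) = code_all A (num n) (denot A p)"

lemma denot_codes: "denot A p \<lhd> codes A"
  by (induction p) (auto intro: codes_ops codes_num codes_emp)

text \<open>An element of the limit level of such a chain lies in an earlier level.  Since assignments are
  elements, the witness bounds along the chain apply to all of them, without any finiteness
  argument about assignments.\<close>

lemma ex_chain:
  assumes "ord a0"
  shows "\<exists>f. dfun f \<and> (\<forall>n. n \<lhd> om \<longrightarrow> ord (f n) \<and> a0 \<lhd> f n \<and>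
    (\<forall>m. m \<lhd> n \<longrightarrow> f m \<lhd> f n \<and> witness p (f m) (f n)))"
proof -
  define Q where "Q X \<longleftrightarrow> (\<forall>d\<in>el X. ord d)" for X
  define R where "R X c \<longleftrightarrow> ord c \<and> a0 \<lhd> c \<and> (\<forall>d\<in>el X. d \<lhd> c \<and> witness p d c)" for X c
  have dQ: "dpred Q" unfolding Q_def by (intro dI)
  have dR: "dpred2 R" unfolding R_def by (intro dI)
  have ex: "\<exists>c. ord c \<and> R X c" if X: "Q X" for X
  proof -
    define r where "r d = least (\<lambda>c. d \<lhd> c \<and> witness p d c)" for d
    have dr: "dfun r" unfolding r_def by (intro dI)
    have dd: "dP (\<lambda>v. d \<lhd> v 0 \<and> witness p d (v 0))" for d by (intro dI)
    have r: "ord (r d) \<and> d \<lhd> r d \<and> witness p d (r d)" if "ord d" for d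
    proof -
      obtain b where b: "ord b" "witness p d b" using ex_witness by blast
      have "\<exists>c. ord c \<and> d \<lhd> c \<and> witness p d c"
      proof (cases "d \<lhd> b")
        case False
        then have "b \<lhd> suc d" using ord_linear[OF that b(1)] by auto
        then show ?thesis using witness_mono[OF b(2) ord_suc[OF that]] ord_suc[OF that] by auto
      qed (use b in blast)
      then obtain c where "ord c" "d \<lhd> c \<and> witness p d c" by blast
      then show ?thesis unfolding r_def using ord_least[OF dd] least_P[OF dd] by blast
    qed
    have oX: "ord d" if "d \<lhd> X" for d using X that unfolding Q_def by blast
    obtain s where s: "ord s" "\<forall>d\<in>el X. r d \<lhd> s"
      using ex_ord_bound[OF dr, of X] r oX by blast
    have "\<exists>c. ord c \<and> (s = c \<or> s \<lhd> c) \<and> a0 \<lhd> c"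
      using ord_linear[OF s(1) ord_suc[OF assms]] s(1) ord_suc[OF assms]
      by (metis elts_ins insertI1 ord_trans)
    then obtain c where c: "ord c" "s = c \<or> s \<lhd> c" "a0 \<lhd> c" by blast
    have "d \<lhd> c \<and> witness p d c" if d: "d \<lhd> X" for d
    proof -
      have "r d \<lhd> c" using s(2) d c(1,2) ord_trans[OF c(1)] by blast
      then show ?thesis
        using r[OF oX[OF d]] ord_trans[OF c(1)] witness_mono[OF _ c(1)] by blast
    qed
    then show ?thesis using c unfolding R_def by blast
  qed
  have "Q emp" "\<And>X c. Q X \<Longrightarrow> R X c \<Longrightarrow> Q (ins c X)" unfolding Q_def R_def by auto
  from om_dependent_choice[of Q R, OF dQ dR this(1) ex this(2)] obtain f
    where f: "dfun f" and R: "\<And>n. n \<lhd> om \<Longrightarrow> R (img f n) (f n)" by blast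
  then show ?thesis unfolding R_def elts_img[OF f] by blast
qed

text \<open>The level depends on the formula. It is the supremum of a chain closed under
  counterexamples to subformulas, started above \<open>a0\<close> so that given parameters can be
  included.\<close>

lemma reflection:
  assumes "ord a0"
  shows "\<exists>b. lim b \<and> a0 \<lhd> b \<and> (\<forall>a. a \<lhd> Vl b \<longrightarrow> (a \<lhd> denot (Vl b) p \<longleftrightarrow> sat E p (assign a)))"
proof -
  obtain al where da: "dfun al"
    and al: "\<And>n. n \<lhd> om \<Longrightarrow> ord (al n) \<and> a0 \<lhd> al n \<and> (\<forall>m. m \<lhd> n \<longrightarrow> al m \<lhd> al n \<and> witness p (al m) (al n))"
    using ex_chain[OF assms, of p] by blast
  have ea: "el (img al om) = al ` el om" by (rule elts_img[OF da])
  define b where "b = union (img al om)"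
  have b: "x \<lhd> b \<longleftrightarrow> (\<exists>n. n \<lhd> om \<and> x \<lhd> al n)" for x unfolding b_def elts_union ea by blast
  have ob: "ord b" unfolding b_def by (rule ord_union) (use ea al in auto)
  have alb: "al n \<lhd> b" if "n \<lhd> om" for n
    unfolding b using al[OF suc_om[OF that]] suc_om[OF that] by auto
  have a0: "a0 \<lhd> b" unfolding b using al emp_om by blast
  have lb: "lim b"
    unfolding lim_def
  proof (intro conjI ballI)
    show "emp \<lhd> b" using ord_linear[OF ord_emp ob] a0 by auto
    fix x assume "x \<lhd> b"
    then obtain n where n: "n \<lhd> om" "x \<lhd> al n" unfolding b by blast
    then have "suc x = al n \<or> suc x \<lhd> al n" using ord_suc_le al by blast
    then show "suc x \<lhd> b" using alb[OF n(1)] ord_trans[OF ob] by metis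
  qed (rule ob)
  have Vb: "\<exists>n. n \<lhd> om \<and> x \<lhd> Vl (al n)" if x: "x \<lhd> Vl b" for x
  proof -
    obtain c where c: "c \<lhd> b" "el x \<subseteq> el (Vl c)" using x elts_Vl[OF ob] by blast
    then obtain n where n: "n \<lhd> om" "c \<lhd> al n" unfolding b by blast
    then show ?thesis using VlI[of "al n" c x] c al by blast
  qed
  have ds: "dP (\<lambda>v. ap (v 0) x \<lhd> ap (v 0) y)" "dP (\<lambda>v. ap (v 0) x = ap (v 0) y)"
    "dP (\<lambda>v. \<not> v 0 \<lhd> x)" "dP (\<lambda>v. v 0 \<lhd> x \<and> v 0 \<lhd> y)" "dP (\<lambda>v. \<forall>z\<in>el A. update (v 0) x z \<lhd> y)" for x y A
    by (intro dI)+
  note els = elts_sep[OF ds(1)] elts_sep[OF ds(2)] elts_sep[OF ds(3)] elts_sep[OF ds(4)] elts_sep[OF ds(5)]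
  have "(\<And>n. n \<lhd> om \<Longrightarrow> witness q (al n) (al (suc n))) \<Longrightarrow> a \<lhd> Vl b \<Longrightarrow>
      (a \<lhd> denot (Vl b) q \<longleftrightarrow> sat E q (assign a))" for q a
  proof (induction q arbitrary: a)
    case (FMem m n)
    then show ?case by (simp add: code_mem_def els assign_def E_iff[of "ap a (num m)"])
  next
    case (FEq m n)
    then show ?case by (simp add: code_eq_def els assign_def)
  next
    case (FNeg q)
    then show ?case by (simp add: code_neg_def els)
  next
    case (FConj q q')
    then show ?case by (simp add: code_conj_def els)
  next
    case (FAll n q)
    have cq: "\<And>n. n \<lhd> om \<Longrightarrow> witness q (al n) (al (suc n))" using FAll.prems(1) by simp
    have IH: "update a (num n) z \<lhd> denot (Vl b) q \<longleftrightarrow> sat E q ((assign a)(n := z))" if "z \<lhd> Vl b" for z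
      unfolding assign_update[symmetric]
      by (rule FAll.IH[OF cq lim_Vl_update[OF lb FAll.prems(2) lim_Vl_num[OF lb] that]])
    have "sat E q ((assign a)(n := x))" if *: "\<forall>z\<in>el (Vl b). sat E q ((assign a)(n := z))" for x
    proof (rule ccontr)
      assume nx: "\<not> ?thesis"
      \<comment> \<open>The assignment \<open>a\<close> already belongs to some level of the chain,
        so a counterexample anywhere in the model can be traded for one in the next level, inside
        \<open>Vl b\<close>.\<close>
      obtain m where m: "m \<lhd> om" "a \<lhd> Vl (al m)" using Vb[OF FAll.prems(2)] by blast
      obtain z where "z \<lhd> Vl (al (suc m))" "\<not> sat E q ((assign a)(n := z))"
        using FAll.prems(1)[OF m(1)] m(2) nx unfolding witness.simps by blast
      then show False using * Vl_mono[OF ob] alb[OF suc_om[OF m(1)]] by blast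
    qed
    then show ?case
      using FAll.prems(2) IH by (simp add: code_all_def els) blast
  qed
  moreover have "\<And>n. n \<lhd> om \<Longrightarrow> witness p (al n) (al (suc n))" using al[OF suc_om] by simp
  ultimately show ?thesis using lb a0 by blast
qed

text \<open>Collects the values at variable 0 of those assignments in \<open>Y\<close> that have
  value \<open>C\<close> at variable 1. For the satisfaction set of a formula defining
  \<open>D\<close> from \<open>C\<close> this collection is the singleton of \<open>D\<close>, and
  the union strips the braces.\<close>

definition decode :: "'m \<Rightarrow> 'm \<Rightarrow> 'm" where
  "decode C Y = union (img (\<lambda>a. ap a emp) (sep Y (\<lambda>a. ap a (suc emp) = C)))"

lemma dT_decode [dI]: "dT s \<Longrightarrow> dT t \<Longrightarrow> dT (\<lambda>v. decode (s v) (t v))"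
  by (rule dT2[of decode]) (unfold decode_def, intro dI)

lemma definable_from_codes:
  assumes "definable_from E C D"
  shows "\<exists>b. ord b \<and> (\<exists>y. y \<lhd> codes (Vl b) \<and> decode C y = D)"
proof -
  obtain p where p: "\<And>v x. sat E p (v(0 := x, 1 := C)) \<longleftrightarrow> x = D"
    using assms unfolding definable_from_def by blast
  \<comment> \<open>Since levels are transitive, a level containing the pair contains both
    \<open>C\<close> and \<open>D\<close>.\<close>
  obtain a0 where a0: "ord a0" "upair C D \<lhd> Vl a0" using ex_Vl by blast
  obtain b where b: "lim b" "a0 \<lhd> b"
    and refl: "\<And>a. a \<lhd> Vl b \<Longrightarrow> (a \<lhd> denot (Vl b) p \<longleftrightarrow> sat E p (assign a))"
    using reflection[OF a0(1), of p] by blast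
  have ob: "ord b" using b(1) unfolding lim_def by blast
  have "C \<lhd> Vl a0" "D \<lhd> Vl a0" using Vl_trans[OF a0] by auto
  then have CD: "C \<lhd> Vl b" "D \<lhd> Vl b" using Vl_mono[OF ob] b(2) by blast+
  define Y where "Y = denot (Vl b) p"
  have YV: "el Y \<subseteq> el (Vl b)"
  proof -
    have "el (sep A P) \<subseteq> el A" if "dpred P" for A P
      using elts_sep[OF that] by blast
    then show ?thesis unfolding Y_def
      by (cases p) (simp_all add: code_mem_def code_eq_def code_neg_def code_conj_def code_all_def dI)
  qed
  define a where "a = update (update emp (num 0) D) (num 1) C"
  have aV: "a \<lhd> Vl b" unfolding a_def
    by (intro lim_Vl_update lim_Vl_num lim_Vl_emp b(1) CD)
  have assign_a: "assign a = (assign emp)(0 := D, 1 := C)" unfolding a_def assign_update ..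
  have "sat E p (assign a)" unfolding assign_a using p by blast
  then have aY: "a \<lhd> Y" using refl[OF aV] unfolding Y_def by blast
  have apa: "ap a emp = D" "ap a (suc emp) = C"
  proof -
    have "assign a 0 = D" "assign a 1 = C" unfolding assign_a by simp_all
    then show "ap a emp = D" "ap a (suc emp) = C" by (simp_all add: assign_def)
  qed
  \<comment> \<open>An assignment with value \<open>C\<close> at 1 equals its own update there, so
    membership in \<open>Y\<close> makes the defining formula force the value \<open>D\<close> at
    0.\<close>
  have union: "ap u emp = D" if u: "u \<lhd> Y" "ap u (suc emp) = C" for u
  proof -
    have "sat E p (assign u)" using refl u YV unfolding Y_def by blast
    moreover have "assign u = (assign u)(0 := ap u emp, 1 := C)"
      using u(2) by (auto simp: assign_def fun_eq_iff)
    ultimately have "sat E p ((assign u)(0 := ap u emp, 1 := C))" by metis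
    then show ?thesis using p by blast
  qed
  have d1: "dP (\<lambda>v. ap (v 0) (suc emp) = C)" by (intro dI)
  have d2: "dT (\<lambda>v. ap (v 0) emp)" by (intro dI)
  have "el (img (\<lambda>a. ap a emp) (sep Y (\<lambda>a. ap a (suc emp) = C))) = {D}"
    unfolding elts_img[OF d2] elts_sep[OF d1]
  proof (rule set_eqI, rule iffI)
    fix x assume "x \<in> {D}"
    then show "x \<in> (\<lambda>a. ap a emp) ` {x \<in> el Y. ap x (suc emp) = C}"
      using aY apa by (intro image_eqI[of _ _ a]) auto
  qed (use union in auto)
  then have "decode C Y = D" unfolding decode_def by (intro set_ext) simp
  then show ?thesis using ob denot_codes[of "Vl b" p] unfolding Y_def by blast
qed

end

context zf
begin

text \<open>Substitutes for internal finiteness: the codes at a level need not be well-ordered, it suffices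
  that elements of \<open>U\<close> indexed by them can be intersected.\<close>

definition inter_closed :: "'m \<Rightarrow> 'm \<Rightarrow> 'm \<Rightarrow> bool" where
  "inter_closed k U R \<longleftrightarrow> (\<forall>g. (\<forall>x\<in>el R. ap g x \<lhd> U) \<longrightarrow> almost k U (\<lambda>j. \<forall>x\<in>el R. j \<lhd> ap g x))"

lemma dP_inter_closed [dI]: "dT r \<Longrightarrow> dT s \<Longrightarrow> dT t \<Longrightarrow> dP (\<lambda>v. inter_closed (r v) (s v) (t v))"
  by (rule dP3[of inter_closed]) (unfold inter_closed_def, intro dI)

lemma inter_closedD:
  assumes "inter_closed k U R" and h: "dfun h" and "\<And>x. x \<lhd> R \<Longrightarrow> h x \<lhd> U"
  shows "almost k U (\<lambda>j. \<forall>x\<in>el R. j \<lhd> h x)"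
proof -
  have a: "ap (fn h R) x = h x" if "x \<lhd> R" for x by (rule ap_fn[OF h that])
  then have "\<forall>x\<in>el R. ap (fn h R) x \<lhd> U" using assms(3) by auto
  then have "almost k U (\<lambda>j. \<forall>x\<in>el R. j \<lhd> ap (fn h R) x)"
    using assms(1) unfolding inter_closed_def by blast
  moreover have "(\<lambda>j. \<forall>x\<in>el R. j \<lhd> ap (fn h R) x) = (\<lambda>j. \<forall>x\<in>el R. j \<lhd> h x)"
    using a by auto
  ultimately show ?thesis by simp
qed

context
  fixes k U
  assumes N: "normal_tail k U"
begin

lemma inter_closed_single: "inter_closed k U (upair a a)"
  unfolding inter_closed_def by (auto intro: almost_of_mem[OF normal_tail_filter[OF N]])

lemma inter_closed_cup:
  assumes "inter_closed k U R" "inter_closed k U R'"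
  shows "inter_closed k U (cup R R')"
  unfolding inter_closed_def
proof (intro allI impI)
  fix g assume g: "\<forall>x\<in>el (cup R R'). ap g x \<lhd> U"
  have d: "dP (\<lambda>v. \<forall>x\<in>el R. v 0 \<lhd> ap g x)" for R by (intro dI)
  have "almost k U (\<lambda>j. (\<forall>x\<in>el R. j \<lhd> ap g x) \<and> (\<forall>x\<in>el R'. j \<lhd> ap g x))"
    by (rule almost_conj[OF normal_tail_filter[OF N] d d])
      (use assms g in \<open>auto simp: inter_closed_def\<close>)
  moreover have "(\<lambda>j. (\<forall>x\<in>el R. j \<lhd> ap g x) \<and> (\<forall>x\<in>el R'. j \<lhd> ap g x)) =
      (\<lambda>j. \<forall>x\<in>el (cup R R'). j \<lhd> ap g x)" by auto
  ultimately show "almost k U (\<lambda>j. \<forall>x\<in>el (cup R R'). j \<lhd> ap g x)" by simp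
qed

text \<open>The intersection over pairs is taken in two stages: each \<open>h x\<close> is an
  intersection over \<open>y\<close>, again belongs to \<open>U\<close>, and is then intersected
  over \<open>x\<close>. No enumeration of \<open>R\<close> or of the image is required.\<close>

lemma inter_closed_image2:
  assumes d: "dfun2 f" and R: "inter_closed k U R"
  shows "inter_closed k U (image2 f R)"
  unfolding inter_closed_def elts_image2[OF d]
proof (intro allI impI)
  fix g assume g: "\<forall>z\<in>{f x y |x y. x \<lhd> R \<and> y \<lhd> R}. ap g z \<lhd> U"
  define h where "h x = sep k (\<lambda>j. \<forall>y\<in>el R. j \<lhd> ap g (f x y))" for x
  have dh: "dfun h" unfolding h_def by (intro dI dT2[OF d])
  have d1: "dT (\<lambda>v. ap g (f x (v 0)))" for x by (intro dI dT2[OF d])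
  have d2: "dP (\<lambda>v. \<forall>y\<in>el R. v 0 \<lhd> ap g (f x y))" for x by (intro dI dT2[OF d])
  have d3: "dP (\<lambda>v. \<forall>x\<in>el R. v 0 \<lhd> h x)" by (intro dI dT1[OF dh])
  have d4: "dP (\<lambda>v. \<forall>z\<in>{f x y |x y. x \<lhd> R \<and> y \<lhd> R}. v 0 \<lhd> ap g z)"
  proof -
    have "(\<forall>z\<in>{f x y |x y. x \<lhd> R \<and> y \<lhd> R}. j \<lhd> ap g z) \<longleftrightarrow> (\<forall>x\<in>el R. \<forall>y\<in>el R. j \<lhd> ap g (f x y))" for j
      by blast
    then show ?thesis by (simp only:) (intro dI dT2[OF d])
  qed
  have hU: "h x \<lhd> U" if "x \<lhd> R" for x
    using inter_closedD[OF R d1, of x] g that unfolding h_def almost_def by blast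
  have eh: "el (h x) = {j \<in> el k. \<forall>y\<in>el R. j \<lhd> ap g (f x y)}" for x
    unfolding h_def by (rule elts_sep[OF d2])
  show "almost k U (\<lambda>j. \<forall>z\<in>{f x y |x y. x \<lhd> R \<and> y \<lhd> R}. j \<lhd> ap g z)"
    by (rule almost_mono[OF normal_tail_filter[OF N] d3 d4 inter_closedD[OF R dh hU]]) (auto simp: eh)
qed

lemma inter_closed_UN:
  assumes f: "dfun f" and b: "b \<lhd> k" and R: "\<And>i. i \<lhd> b \<Longrightarrow> inter_closed k U (f i)"
  shows "inter_closed k U (union (img f b))"
  unfolding inter_closed_def
proof (intro allI impI)
  fix g assume g: "\<forall>x\<in>el (union (img f b)). ap g x \<lhd> U"
  have e: "el (union (img f b)) = (\<Union>i\<in>el b. el (f i))" unfolding elts_union elts_img[OF f] by blast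
  have d: "dP (\<lambda>v. \<forall>x\<in>el (f (v 0)). v (Suc 0) \<lhd> ap g x)" by (intro dI dT1[OF f])
  have "almost k U (\<lambda>j. \<forall>i\<in>el b. \<forall>x\<in>el (f i). j \<lhd> ap g x)"
  proof (rule normal_tail_complete[OF N d b])
    fix i assume i: "i \<lhd> b"
    have "\<forall>x\<in>el (f i). ap g x \<lhd> U" using g i unfolding e by blast
    then show "almost k U (\<lambda>j. \<forall>x\<in>el (f i). j \<lhd> ap g x)" using R[OF i] unfolding inter_closed_def by blast
  qed
  moreover have "(\<lambda>j. \<forall>i\<in>el b. \<forall>x\<in>el (f i). j \<lhd> ap g x) = (\<lambda>j. \<forall>x\<in>el (union (img f b)). j \<lhd> ap g x)"
    unfolding e by auto
  ultimately show "almost k U (\<lambda>j. \<forall>x\<in>el (union (img f b)). j \<lhd> ap g x)" by simp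
qed

lemma inter_closed_code_step: "inter_closed k U R \<Longrightarrow> inter_closed k U (code_step A R)"
  unfolding code_step_def by (intro inter_closed_cup inter_closed_image2) (assumption | intro dI)+

end

end

context zf_om
begin

lemma inter_closed_codes:
  assumes N: "normal_tail k U" and "om \<lhd> k"
  shows "inter_closed k U (codes A)"
proof -
  have dc: "dT (\<lambda>v. level A (v 0))" by (intro dI)
  have "inter_closed k U (level A n)" if "n \<lhd> om" for n
  proof -
    have "dP (\<lambda>v. v 0 \<lhd> om \<longrightarrow> inter_closed k U (level A (v 0)))" by (intro dI)
    then have "n \<lhd> om \<longrightarrow> inter_closed k U (level A n)" using ord_mem[OF om_ord that]
    proof (induction rule: ord_induct)
      case (step n)
      show ?case
      proof
        assume n: "n \<lhd> om"
        have "inter_closed k U (union (img (level A) n))"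
          by (rule inter_closed_UN[OF N dc])
            (use n step(2) ord_trans[OF om_ord] ord_trans[OF normal_tail_ord[OF N] _ assms(2)] in blast)+
        then show "inter_closed k U (level A n)"
          unfolding level_eq[OF step(1)]
          by (subst ins_def) (intro inter_closed_code_step[OF N] inter_closed_cup[OF N] inter_closed_single[OF N])
      qed
    qed
    then show ?thesis using that by blast
  qed
  then show ?thesis unfolding codes_def by (intro inter_closed_UN[OF N dc assms(2)])
qed

text \<open>For each index, all candidates that occur at the least possible level are intersected.\<close>

lemma definable_choice:
  assumes N: "normal_tail k U" and omk: "om \<lhd> k"
    and C: "dfun C" and Q: "dpred2 Q" and X: "dfun2 X"
    and ex: "\<And>i. i \<lhd> I \<Longrightarrow> \<exists>D. definable_from E (C i) D \<and> Q i D"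
    and XU: "\<And>i D. i \<lhd> I \<Longrightarrow> Q i D \<Longrightarrow> X i D \<lhd> U"
  shows "\<exists>W. dfun W \<and> (\<forall>i\<in>el I. W i \<lhd> U \<and> (\<exists>D. Q i D \<and> el (W i) \<subseteq> el (X i D)))"
proof -
  define al where "al i = least (\<lambda>a. \<exists>y\<in>el (codes (Vl a)). Q i (decode (C i) y))" for i
  \<comment> \<open>Codes that do not decode to a candidate contribute the whole space
    \<open>k\<close> and leave the intersection unchanged.\<close>
  define h where "h i y = (if Q i (decode (C i) y) then X i (decode (C i) y) else k)" for i y
  define W where "W i = sep k (\<lambda>j. \<forall>y\<in>el (codes (Vl (al i))). j \<lhd> h i y)" for i
  have da: "dfun al" unfolding al_def by (intro dI dP2[OF Q] dT1[OF C])
  have dh: "dfun2 h" unfolding h_def by (intro dI dP2[OF Q] dT1[OF C] dT2[OF X])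
  have dW: "dfun W" unfolding W_def by (intro dI dT1[OF da] dT2[OF dh])
  have kU: "k \<lhd> U" using normal_tail_filter[OF N] unfolding is_filter_def by blast
  have "W i \<lhd> U \<and> (\<exists>D. Q i D \<and> el (W i) \<subseteq> el (X i D))" if i: "i \<lhd> I" for i
  proof
    have dhi: "dT (\<lambda>v. h i (v 0))" by (intro dT2[OF dh] dI)
    have "almost k U (\<lambda>j. \<forall>y\<in>el (codes (Vl (al i))). j \<lhd> h i y)"
      by (rule inter_closedD[OF inter_closed_codes[OF N omk] dhi]) (use XU[OF i] kU in \<open>simp add: h_def\<close>)
    then show "W i \<lhd> U" unfolding W_def almost_def .
    have d: "dP (\<lambda>v. \<exists>y\<in>el (codes (Vl (v 0))). Q i (decode (C i) y))" by (intro dI dP2[OF Q])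
    obtain D where D: "definable_from E (C i) D" "Q i D" using ex[OF i] by blast
    obtain b where b: "ord b" "\<exists>y\<in>el (codes (Vl b)). Q i (decode (C i) y)"
      using definable_from_codes[OF D(1)] D(2) by blast
    have "\<exists>y\<in>el (codes (Vl (al i))). Q i (decode (C i) y)"
      unfolding al_def by (rule least_P[OF d b])
    then obtain y where y: "y \<lhd> codes (Vl (al i))" "Q i (decode (C i) y)" by blast
    have dj: "dP (\<lambda>v. \<forall>y\<in>el (codes (Vl (al i))). v 0 \<lhd> h i y)" by (intro dI dT2[OF dh])
    have "el (W i) \<subseteq> el (h i y)" unfolding W_def elts_sep[OF dj] using y(1) by blast
    then show "\<exists>D. Q i D \<and> el (W i) \<subseteq> el (X i D)" using y(2) unfolding h_def by auto
  qed
  then show ?thesis using dW by blast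
qed

end

section \<open>The combinatorial core\<close>

text \<open>The part of \<open>lam\<close> attached to \<open>j\<close> is \<open>mu j\<close> with its filter \<open>Fl j\<close>; the cardinal \<open>nu j\<close> lies
  strictly between the earlier \<open>mu i\<close> and \<open>mu j\<close>, and bounds the ranks at \<open>j\<close>.  Adjacency is
  colour one.\<close>

locale blocks = zf_om E om for E :: "'m \<Rightarrow> 'm \<Rightarrow> bool" and om :: 'm +
  fixes kap lam U K :: 'm and nu mu Fl :: "'m \<Rightarrow> 'm" and adj :: "'m \<Rightarrow> 'm \<Rightarrow> bool"
  assumes lam: "ord lam" and N: "normal_tail kap U" and UF: "is_ultrafilter E kap U" and omk: "om \<lhd> kap"
    and d_nu: "dfun nu" and d_mu: "dfun mu" and d_Fl: "dfun Fl"
    and K_sub: "\<And>j. j \<lhd> K \<Longrightarrow> j \<lhd> kap" and K_big: "almost kap U (\<lambda>j. j \<lhd> K)"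
    and Nm: "\<And>j. j \<lhd> K \<Longrightarrow> normal_tail (mu j) (Fl j)"
    and Nn: "\<And>j. j \<lhd> K \<Longrightarrow> \<exists>G. normal_tail (nu j) G"
    and kap_nu: "\<And>j. j \<lhd> K \<Longrightarrow> kap \<lhd> nu j" and nu_mu: "\<And>j. j \<lhd> K \<Longrightarrow> nu j \<lhd> mu j"
    and mu_lam: "\<And>j. j \<lhd> K \<Longrightarrow> mu j \<lhd> lam"
    and mu_nu: "\<And>i j. i \<lhd> K \<Longrightarrow> j \<lhd> K \<Longrightarrow> i \<lhd> j \<Longrightarrow> mu i \<lhd> nu j"
    and mu_card: "\<And>j. j \<lhd> K \<Longrightarrow> is_card E (mu j)"
    and gal: "\<And>j. j \<lhd> K \<Longrightarrow> Gal_Def E U (mu j)"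
    and mu_cofinal: "\<And>t. t \<lhd> lam \<Longrightarrow> \<exists>i. i \<lhd> kap \<and> (\<forall>j. j \<lhd> K \<longrightarrow> i \<lhd> j \<longrightarrow> t \<lhd> mu j)"
    and d_adj: "dpred2 adj" and adj_sym: "\<And>x y. adj x y \<Longrightarrow> adj y x"
    and no_clique: "\<And>f b. dfun f \<Longrightarrow> b \<lhd> lam \<Longrightarrow> (\<And>n. n \<lhd> om \<Longrightarrow> f n \<lhd> b \<and> adj (f n) b) \<Longrightarrow>
      (\<And>m n. n \<lhd> om \<Longrightarrow> m \<lhd> n \<Longrightarrow> f m \<lhd> f n \<and> adj (f m) (f n)) \<Longrightarrow> False"
begin

abbreviation pos_at where "pos_at j \<equiv> pos (mu j) (Fl j)"

lemmas dT_nu [dI] = dT1[OF d_nu] and dT_mu [dI] = dT1[OF d_mu] and dT_Fl [dI] = dT1[OF d_Fl]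
  and dP_adj [dI] = dP2[OF d_adj]

lemma kap_ord: "ord kap" and U_filter: "is_filter E kap U"
  using normal_tail_ord[OF N] normal_tail_filter[OF N] by blast+

lemma mu_ord: "j \<lhd> K \<Longrightarrow> ord (mu j)" and mu_filter: "j \<lhd> K \<Longrightarrow> is_filter E (mu j) (Fl j)"
  using normal_tail_ord[OF Nm] normal_tail_filter[OF Nm] by blast+

lemma nu_ord: "j \<lhd> K \<Longrightarrow> ord (nu j)"
  using ord_mem[OF mu_ord nu_mu] by blast

lemma K_nu: "j \<lhd> K \<Longrightarrow> j \<lhd> nu j"
  using ord_trans[OF nu_ord K_sub kap_nu] by blast

lemma K_mu: "j \<lhd> K \<Longrightarrow> j \<lhd> mu j"
  using ord_trans[OF mu_ord K_nu nu_mu] by blast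

lemma mu_sub: "j \<lhd> K \<Longrightarrow> a \<lhd> mu j \<Longrightarrow> a \<lhd> lam"
  using ord_trans[OF lam _ mu_lam] by blast

lemma nu_emp: "j \<lhd> K \<Longrightarrow> emp \<lhd> nu j"
  using ord_trans[OF nu_ord _ kap_nu] ord_trans[OF kap_ord emp_om omk] by blast

lemma mu_emp: "j \<lhd> K \<Longrightarrow> emp \<lhd> mu j"
  using ord_trans[OF mu_ord nu_emp nu_mu] by blast

section \<open>First cliques and edgeless blocks\<close>

definition clique_rec :: "'m \<Rightarrow> 'm \<Rightarrow> 'm" where
  "clique_rec b = rec (\<lambda>x I. if adj x b \<and> (\<forall>y\<in>el I. y \<noteq> b \<longrightarrow> adj y x) then x else b)"

text \<open>The lexicographically first clique among the neighbours of \<open>b\<close> below \<open>b\<close>; the value \<open>b\<close> of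
  the recursion marks rejection.\<close>

definition fclique :: "'m \<Rightarrow> 'm" where "fclique b = sep b (\<lambda>x. clique_rec b x = x)"

lemma dT_clique_rec [dI]: "dT s \<Longrightarrow> dT t \<Longrightarrow> dT (\<lambda>v. clique_rec (s v) (t v))"
  by (rule dT2[of clique_rec]) (unfold clique_rec_def, intro dI)

lemma dT_fclique [dI]: "dT s \<Longrightarrow> dT (\<lambda>v. fclique (s v))"
  by (rule dT1[of fclique]) (unfold fclique_def, intro dI)

lemma mem_fclique0: "x \<lhd> fclique b \<longleftrightarrow> x \<lhd> b \<and> clique_rec b x = x"
proof -
  have "el (fclique b) = {x \<in> el b. clique_rec b x = x}" unfolding fclique_def by (rule elts_sep) (intro dI)
  then show ?thesis by blast
qed

text \<open>Every accepted point contributes itself and every rejected one contributes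
  \<open>b\<close>, so among the earlier values those different from \<open>b\<close> are exactly
  the earlier clique members.\<close>

lemma mem_fclique:
  assumes b: "ord b"
  shows "x \<lhd> fclique b \<longleftrightarrow> x \<lhd> b \<and> adj x b \<and> (\<forall>y. y \<lhd> fclique b \<longrightarrow> y \<lhd> x \<longrightarrow> adj y x)"
proof (cases "x \<lhd> b")
  case True
  have dg: "dT (\<lambda>v. if adj (v 0) b \<and> (\<forall>y\<in>el (v (Suc 0)). y \<noteq> b \<longrightarrow> adj y (v 0)) then v 0 else b)"
    by (intro dI)
  have eq: "clique_rec b x = (if adj x b \<and> (\<forall>y\<in>el (img (clique_rec b) x). y \<noteq> b \<longrightarrow> adj y x) then x else b)"
    if "ord x" for x
    using rec_eq[OF dg that] unfolding clique_rec_def[symmetric] .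
  have di: "dT (\<lambda>v. clique_rec b (v 0))" by (intro dI)
  have val: "clique_rec b z = z \<or> clique_rec b z = b" if "z \<lhd> b" for z
    using eq[OF ord_mem[OF b that]] by metis
  have "(\<forall>y\<in>el (img (clique_rec b) x). y \<noteq> b \<longrightarrow> adj y x) \<longleftrightarrow> (\<forall>y. y \<lhd> fclique b \<longrightarrow> y \<lhd> x \<longrightarrow> adj y x)"
  proof (intro iffI allI impI ballI)
    fix y assume *: "\<forall>y\<in>el (img (clique_rec b) x). y \<noteq> b \<longrightarrow> adj y x" and y: "y \<lhd> fclique b" "y \<lhd> x"
    have y': "y \<lhd> b" "clique_rec b y = y" using y(1) unfolding mem_fclique0 by blast+
    have "y \<lhd> img (clique_rec b) x"
      unfolding elts_img[OF di] using y(2) y'(2)[symmetric] by (rule rev_image_eqI)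
    moreover have "y \<noteq> b" using y'(1) by auto
    ultimately show "adj y x" using * by blast
  next
    fix y assume *: "\<forall>y. y \<lhd> fclique b \<longrightarrow> y \<lhd> x \<longrightarrow> adj y x" and "y \<lhd> img (clique_rec b) x" and yb: "y \<noteq> b"
    then obtain z where z: "z \<lhd> x" "y = clique_rec b z" unfolding elts_img[OF di] by blast
    have zb: "z \<lhd> b" using ord_trans[OF b z(1) True] .
    have "clique_rec b z = z" using val[OF zb] z(2) yb by simp
    then have "y = z" "z \<lhd> fclique b" using z(2) zb unfolding mem_fclique0 by simp_all
    then show "adj y x" using * z(1) by blast
  qed
  moreover have "x \<noteq> b" using True by auto
  ultimately show ?thesis
    using True eq[OF ord_mem[OF b True]] unfolding mem_fclique0[of x] by auto
qed (simp add: mem_fclique0)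

text \<open>Without a maximum, the part of the first clique below \<open>y\<close> would have order
  type at least \<open>om\<close>; its first \<open>om\<close> members together with
  \<open>b\<close> form a forbidden clique.\<close>

lemma fclique_max:
  assumes b: "b \<lhd> lam" and ne: "z0 \<lhd> fclique b" "z0 \<lhd> y" and y: "ord y"
  shows "\<exists>m. m \<lhd> fclique b \<and> m \<lhd> y \<and> (\<forall>z. z \<lhd> fclique b \<longrightarrow> z \<lhd> y \<longrightarrow> z = m \<or> z \<lhd> m)"
proof -
  have ob: "ord b" using ord_mem[OF lam b] .
  define A where "A = sep (fclique b) (\<lambda>z. z \<lhd> y)"
  have A: "el A = {z \<in> el (fclique b). z \<lhd> y}" unfolding A_def by (rule elts_sep) (intro dI)
  have "ord z" if "z \<lhd> A" for z using that y ord_mem unfolding A by blast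
  then obtain t f where t: "ord t" and f: "dfun f" and bij: "bij_betw f (el t) (el A)"
    and mono: "\<And>x x'. x \<lhd> t \<Longrightarrow> x' \<lhd> t \<Longrightarrow> x \<lhd> x' \<Longrightarrow> f x \<lhd> f x'"
    using ex_order_type[of A] by blast
  have fA: "f x \<lhd> fclique b \<and> f x \<lhd> y" if "x \<lhd> t" for x
    using bij that A unfolding bij_betw_def by blast
  have Af: "\<exists>x. x \<lhd> t \<and> z = f x" if "z \<lhd> fclique b" "z \<lhd> y" for z
    using bij that A unfolding bij_betw_def by blast
  have emp_t: "emp \<lhd> t"
    using Af[OF ne] ord_linear[OF ord_emp t] by auto
  show ?thesis
  proof (cases "\<exists>x. x \<lhd> t \<and> (\<forall>x'. x' \<lhd> t \<longrightarrow> \<not> x \<lhd> x')")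
    case True
    then obtain x where x: "x \<lhd> t" "\<And>x'. x' \<lhd> t \<Longrightarrow> \<not> x \<lhd> x'" by blast
    have "z = f x \<or> z \<lhd> f x" if z: "z \<lhd> fclique b" "z \<lhd> y" for z
    proof -
      obtain x' where x': "x' \<lhd> t" "z = f x'" using Af[OF z] by blast
      then have "x' = x \<or> x' \<lhd> x" using x ord_linear ord_mem[OF t] by blast
      then show ?thesis using x' mono x(1) by blast
    qed
    then show ?thesis using fA[OF x(1)] by blast
  next
    case False
    then have "om = t \<or> om \<lhd> t" using om_limit_le[OF t emp_t] by blast
    then have nt: "n \<lhd> t" if "n \<lhd> om" for n using that ord_trans[OF t] by blast
    have False
    proof (rule no_clique[OF f b])
      fix n assume "n \<lhd> om"
      then show "f n \<lhd> b \<and> adj (f n) b" using fA[OF nt] mem_fclique[OF ob] by blast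
    next
      fix m n assume n: "n \<lhd> om" "m \<lhd> n"
      then have m: "m \<lhd> om" using ord_trans[OF om_ord] by blast
      have "f m \<lhd> f n" using mono nt m n by blast
      then show "f m \<lhd> f n \<and> adj (f m) (f n)"
        using fA[OF nt[OF m]] fA[OF nt[OF n(1)]] mem_fclique[OF ob, of "f n"] by blast
    qed
    then show ?thesis ..
  qed
qed

text \<open>Pressing down the maximum moves the point from which \<open>fclique b\<close> is constant downwards; the least
  such point leaves nothing below it.\<close>

lemma fclique_constant:
  assumes j: "j \<lhd> K"
  shows "\<exists>t. pos_at j (\<lambda>b. fclique b = t)"
proof -
  note Nj = Nm[OF j] and Fj = mu_filter[OF j] and oj = mu_ord[OF j]
  define tl where "tl y b = sep (fclique b) (\<lambda>z. \<not> z \<lhd> y)" for y b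
  have dtl [dI]: "dT s \<Longrightarrow> dT t \<Longrightarrow> dT (\<lambda>v. tl (s v) (t v))" for s t
    by (rule dT2[of tl]) (unfold tl_def, intro dI)
  have tl: "el (tl y b) = {z \<in> el (fclique b). \<not> z \<lhd> y}" for y b
    unfolding tl_def by (rule elts_sep) (intro dI)
  \<comment> \<open>At \<open>mu j\<close> all tails are empty, so some point admits a constant tail
    on a positive set, and a least such point \<open>y\<close> exists.\<close>
  have tl_top: "tl (mu j) b = emp" if "b \<lhd> mu j" for b
    by (rule set_ext) (use ord_trans[OF oj _ that] in \<open>auto simp: tl mem_fclique0\<close>)
  have "dP (\<lambda>v. tl (mu j) (v 0) = emp)" by (intro dI)
  from pos_of_almost[OF Fj this almost_all[OF Fj tl_top]]
  have "\<exists>t. pos_at j (\<lambda>b. tl (mu j) b = t)" by blast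
  moreover have "dP (\<lambda>v. \<exists>t. pos_at j (\<lambda>b. tl (v 0) b = t))" by (intro dI)
  ultimately obtain y t where oy: "ord y" and t: "pos_at j (\<lambda>b. tl y b = t)"
    and ymin: "\<And>y'. y' \<lhd> y \<Longrightarrow> \<not> (\<exists>t. pos_at j (\<lambda>b. tl y' b = t))"
    using ord_ex_least[of "\<lambda>y. \<exists>t. pos_at j (\<lambda>b. tl y b = t)", OF _ oj] by blast
  have d0: "dP (\<lambda>v. tl y (v 0) = t)" by (intro dI)
  show ?thesis
  proof (rule ccontr)
    assume *: "\<not> ?thesis"
    \<comment> \<open>A vertex with tail \<open>t\<close> whose first clique differs from
      \<open>t\<close> has clique members below \<open>y\<close>. As no first clique recurs on a
      positive set, these vertices remain positively many.\<close>
    define P where "P b \<longleftrightarrow> tl y b = t \<and> (\<exists>z\<in>el (fclique b). z \<lhd> y)" for b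
    have dP: "dpred P" unfolding P_def by (intro dI)
    have nf: "almost (mu j) (Fl j) (\<lambda>b. \<not> (fclique b = t))" using * unfolding pos_def by blast
    have 1: "pos_at j (\<lambda>b. tl y b = t \<and> \<not> (fclique b = t))"
      by (rule pos_conj_almost[OF Fj d0 _ t nf]) (intro dI)
    have P: "pos_at j P"
    proof (rule pos_mono[OF Fj _ dP 1])
      fix b assume b: "tl y b = t \<and> \<not> (fclique b = t)"
      then have "el (tl y b) \<noteq> el (fclique b)" using set_ext by blast
      then show "P b" using b unfolding P_def tl by blast
    qed (intro dI)
    define Mx where "Mx b m \<longleftrightarrow> m \<lhd> fclique b \<and> m \<lhd> y \<and> (\<forall>z\<in>el (fclique b). z \<lhd> y \<longrightarrow> z = m \<or> z \<lhd> m)" for b m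
    define mx where "mx b = the1 (Mx b)" for b
    have dmx: "dfun mx" unfolding mx_def Mx_def by (intro dI)
    have mx: "Mx b (mx b)" if bP: "b \<lhd> mu j" "P b" for b
    proof -
      obtain z where "z \<lhd> fclique b" "z \<lhd> y" using bP(2) unfolding P_def by blast
      then obtain m where m: "Mx b m"
        using fclique_max[OF mu_sub[OF j bP(1)] _ _ oy] unfolding Mx_def by blast
      have "mx b = m" unfolding mx_def
        by (rule the1_eqI[of "Mx b"], rule m) (use m mem_asym in \<open>unfold Mx_def, blast\<close>)
      then show ?thesis using m by simp
    qed
    have "mx b \<lhd> b" if "b \<lhd> mu j" "P b" for b
      using mx[OF that] mem_fclique0 unfolding Mx_def by blast
    from pressing_down[OF Nj dP dmx P this]
    obtain y' where y': "pos_at j (\<lambda>b. P b \<and> mx b = y')" by auto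
    then obtain b0 where "b0 \<lhd> mu j" "P b0" "mx b0 = y'" using pos_ex[OF Fj y'] by blast
    then have "y' \<lhd> y" using mx unfolding Mx_def by blast
    \<comment> \<open>\<open>y'\<close> is the largest clique member below \<open>y\<close>, so
      lowering \<open>y\<close> to \<open>y'\<close> adds just this point to the tail. The tail from
      \<open>y'\<close> is then constant as well, against minimality of \<open>y\<close>.\<close>
    have "tl y' b = ins y' t" if b: "b \<lhd> mu j" "P b \<and> mx b = y'" for b
    proof (rule set_ext, rule set_eqI)
      fix z
      have M: "Mx b y'" using mx b by blast
      have T: "z \<lhd> t \<longleftrightarrow> z \<lhd> fclique b \<and> \<not> z \<lhd> y"
        using b(2) tl[of y b] unfolding P_def by auto
      show "z \<lhd> tl y' b \<longleftrightarrow> z \<lhd> ins y' t"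
        unfolding tl elts_ins insert_iff T using M \<open>y' \<lhd> y\<close> ord_trans[OF oy] mem_irrefl unfolding Mx_def by blast
    qed
    moreover have "dP (\<lambda>v. P (v 0) \<and> mx (v 0) = y')" "dP (\<lambda>v. tl y' (v 0) = ins y' t)"
      by (intro dI dP dmx)+
    ultimately have "pos_at j (\<lambda>b. tl y' b = ins y' t)"
      by (intro pos_mono[OF Fj _ _ y', of "\<lambda>b. tl y' b = ins y' t"])
    then show False using ymin[OF \<open>y' \<lhd> y\<close>] by blast
  qed
qed

text \<open>The frequent value of \<open>fclique\<close> is a set and could not be picked for all
  \<open>j\<close> at once; the least ordinal having that first clique can.\<close>

definition typical :: "'m \<Rightarrow> 'm" where
  "typical j = least (\<lambda>b. b \<lhd> mu j \<and> pos_at j (\<lambda>b'. fclique b' = fclique b))"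

text \<open>The null part up to \<open>nu j\<close> is cut off, so that every vertex of the block
  lies above all earlier \<open>mu i\<close>.\<close>

definition block :: "'m \<Rightarrow> 'm \<Rightarrow> bool" where
  "block j b \<longleftrightarrow> b \<lhd> mu j \<and> nu j \<lhd> b \<and> fclique b = fclique (typical j)"

lemma dT_typical [dI]: "dT s \<Longrightarrow> dT (\<lambda>v. typical (s v))"
  by (rule dT1[of typical]) (unfold typical_def, intro dI)

lemma dP_block [dI]: "dT s \<Longrightarrow> dT t \<Longrightarrow> dP (\<lambda>v. block (s v) (t v))"
  by (rule dP2[of block]) (unfold block_def, intro dI)

lemma block_mu: "block j b \<Longrightarrow> b \<lhd> mu j" and block_nu: "block j b \<Longrightarrow> nu j \<lhd> b"
  unfolding block_def by blast+

lemma block_lam: "j \<lhd> K \<Longrightarrow> block j b \<Longrightarrow> b \<lhd> lam"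
  using mu_sub block_mu by blast

lemma block_pos: assumes j: "j \<lhd> K" shows "pos_at j (block j)"
proof -
  note Fj = mu_filter[OF j]
  obtain t where t: "pos_at j (\<lambda>b. fclique b = t)" using fclique_constant[OF j] by blast
  obtain b0 where b0: "b0 \<lhd> mu j" "fclique b0 = t" using pos_ex[OF Fj t] by blast
  have d: "dP (\<lambda>v. v 0 \<lhd> mu j \<and> pos_at j (\<lambda>b'. fclique b' = fclique (v 0)))" by (intro dI)
  have "b0 \<lhd> mu j \<and> pos_at j (\<lambda>b'. fclique b' = fclique b0)" using b0 t by simp
  from least_P[OF d ord_mem[OF mu_ord[OF j] b0(1)] this]
  have 1: "pos_at j (\<lambda>b'. fclique b' = fclique (typical j))" unfolding typical_def by blast
  have 2: "almost (mu j) (Fl j) (\<lambda>b. nu j \<lhd> b)" by (rule normal_tail_tail[OF Nm[OF j] nu_mu[OF j]])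
  have d1: "dP (\<lambda>v. fclique (v 0) = fclique (typical j))" "dP (\<lambda>v. nu j \<lhd> v 0)"
    "dP (\<lambda>v. fclique (v 0) = fclique (typical j) \<and> nu j \<lhd> v 0)" "dP (\<lambda>v. block j (v 0))" by (intro dI)+
  show ?thesis
    by (rule pos_mono[OF Fj d1(3,4) pos_conj_almost[OF Fj d1(1,2) 1 2]]) (simp add: block_def)
qed

text \<open>A vertex \<open>a\<close> adjacent to \<open>b\<close> and to all of the common first
  clique would itself be accepted into it. But the first clique of \<open>a\<close> consists of
  points below \<open>a\<close>.\<close>

lemma block_not_adj0:
  assumes j: "j \<lhd> K" and "block j a" "block j b" "a \<lhd> b"
  shows "\<not> adj a b"
proof
  assume "adj a b"
  have eq: "fclique a = fclique b" using assms(2,3) unfolding block_def by simp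
  have o: "ord a" "ord b" using ord_mem[OF lam] block_lam[OF j] assms by blast+
  have "adj y a" if "y \<lhd> fclique b" for y
    using that mem_fclique[OF o(1), of y] unfolding eq by simp
  then have "a \<lhd> fclique b"
    using mem_fclique[OF o(2), of a] assms(4) \<open>adj a b\<close> by simp
  then show False unfolding eq[symmetric] mem_fclique0 by simp
qed

lemma block_not_adj:
  assumes j: "j \<lhd> K" and "block j a" "block j b" "a \<noteq> b"
  shows "\<not> adj a b"
proof -
  have "ord a" "ord b" using ord_mem[OF lam] block_lam[OF j] assms by blast+
  then show ?thesis using ord_linear assms block_not_adj0[OF j] adj_sym by blast
qed

definition homog :: bool where
  "homog \<longleftrightarrow> (\<exists>A. el A \<subseteq> el lam \<and> has_otp E A lam \<and> (\<forall>x\<in>el A. \<forall>y\<in>el A. x \<noteq> y \<longrightarrow> \<not> adj x y))"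

text \<open>If the union had type \<open>t\<close> below \<open>lam\<close>, some block with
  \<open>t\<close> below \<open>mu i\<close> would be covered by an enumeration of length
  \<open>t\<close> and hence bounded in the regular \<open>mu i\<close>.\<close>

lemma homog_of_unbounded:
  assumes Hd: "dpred H" and Zd: "dpred2 Z"
    and H: "almost kap U H" and HK: "\<And>i. i \<lhd> kap \<Longrightarrow> H i \<Longrightarrow> i \<lhd> K"
    and Zmu: "\<And>i a. i \<lhd> K \<Longrightarrow> Z i a \<Longrightarrow> a \<lhd> mu i"
    and Zunb: "\<And>i x. i \<lhd> kap \<Longrightarrow> H i \<Longrightarrow> x \<lhd> mu i \<Longrightarrow> \<exists>a. Z i a \<and> x \<lhd> a"
    and na: "\<And>i j a b. i \<lhd> kap \<Longrightarrow> H i \<Longrightarrow> j \<lhd> kap \<Longrightarrow> H j \<Longrightarrow> i = j \<or> i \<lhd> j \<Longrightarrow> Z i a \<Longrightarrow> Z j b \<Longrightarrow> a \<noteq> b \<Longrightarrow> \<not> adj a b"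
  shows homog
proof -
  define A where "A = sep lam (\<lambda>a. \<exists>i\<in>el kap. H i \<and> Z i a)"
  have A0: "el A = {a \<in> el lam. \<exists>i\<in>el kap. H i \<and> Z i a}"
    unfolding A_def by (rule elts_sep) (intro dI dP1[OF Hd] dP2[OF Zd])
  have A: "a \<lhd> A \<longleftrightarrow> (\<exists>i. i \<lhd> kap \<and> H i \<and> Z i a)" for a
    unfolding A0 using mu_sub Zmu HK by blast
  have "el A \<subseteq> el lam" unfolding A0 by blast
  from order_type_le[OF lam this] obtain t f where t: "ord t" "t = lam \<or> t \<lhd> lam"
    and f: "dfun f" and bij: "bij_betw f (el t) (el A)"
    and mono: "\<And>x y. x \<lhd> t \<Longrightarrow> y \<lhd> t \<Longrightarrow> x \<lhd> y \<Longrightarrow> f x \<lhd> f y" by blast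
  have "\<not> t \<lhd> lam"
  proof
    assume "t \<lhd> lam"
    then obtain i0 where i0: "i0 \<lhd> kap" "\<And>j. j \<lhd> K \<Longrightarrow> i0 \<lhd> j \<Longrightarrow> t \<lhd> mu j"
      using mu_cofinal by blast
    have di: "dP (\<lambda>v. i0 \<lhd> v 0)" by (intro dI)
    from almost_ex[OF U_filter dP_conj[OF Hd di] almost_conj[OF U_filter Hd di H normal_tail_tail[OF N i0(1)]]]
    obtain i where i: "i \<lhd> kap" "H i" "i0 \<lhd> i" by blast
    have iK: "i \<lhd> K" using HK i by blast
    \<comment> \<open>Values outside \<open>mu i\<close> are replaced by \<open>emp\<close>, so that
      regularity of \<open>mu i\<close> applies to the enumeration of the whole union.\<close>
    define h where "h x = (if f x \<lhd> mu i then f x else emp)" for x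
    have dh: "dfun h" unfolding h_def by (intro dI dT1[OF f])
    have "\<And>x. x \<lhd> t \<Longrightarrow> h x \<lhd> mu i" using mu_emp[OF iK] unfolding h_def by simp
    from normal_tail_regular[OF Nm[OF iK] dh i0(2)[OF iK i(3)] this]
    obtain y where y: "y \<lhd> mu i" "\<And>x. x \<lhd> t \<Longrightarrow> h x \<lhd> y" by blast
    obtain a where a: "Z i a" "y \<lhd> a" using Zunb[OF i(1,2) y(1)] by blast
    then have "a \<lhd> A" using A i by blast
    then obtain x where x: "x \<lhd> t" "a = f x" using bij unfolding bij_betw_def by blast
    have "h x = a" unfolding h_def using Zmu[OF iK a(1)] x by simp
    then show False using y(2)[OF x(1)] a(2) mem_asym by simp
  qed
  then have "t = lam" using t by blast
  then have "has_otp E A lam" using has_otpI[OF t(1) f bij mono] by blast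
  moreover have "\<not> adj x y" if xy: "x \<lhd> A" "y \<lhd> A" "x \<noteq> y" for x y
  proof -
    obtain i j where i: "i \<lhd> kap" "H i" "Z i x" and j: "j \<lhd> kap" "H j" "Z j y"
      using xy A by blast
    have "i = j \<or> i \<lhd> j \<or> j \<lhd> i" using ord_linear ord_mem[OF kap_ord] i(1) j(1) by blast
    then show ?thesis using na[OF i(1,2) j(1,2) _ i(3) j(3)] na[OF j(1,2) i(1,2) _ j(3) i(3)] xy(3) adj_sym by blast
  qed
  ultimately show ?thesis unfolding homog_def using \<open>el A \<subseteq> el lam\<close> by blast
qed

section \<open>Terminal vertices and the Galvin property\<close>

definition pos_nbrs :: "('m \<Rightarrow> 'm \<Rightarrow> bool) \<Rightarrow> 'm \<Rightarrow> 'm \<Rightarrow> bool" where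
  "pos_nbrs Q j a \<longleftrightarrow> pos_at j (\<lambda>b. Q j b \<and> adj a b)"

definition far :: "('m \<Rightarrow> 'm \<Rightarrow> bool) \<Rightarrow> 'm \<Rightarrow> 'm \<Rightarrow> 'm \<Rightarrow> bool" where
  "far Q i a j \<longleftrightarrow> i \<lhd> j \<and> j \<lhd> K \<and> pos_nbrs Q j a"

text \<open>As \<open>U\<close> is an ultrafilter, the negation amounts to \<open>far\<close>
  failing almost everywhere; for \<open>i\<close> below \<open>kap\<close> the index clauses of
  \<open>far\<close> hold almost everywhere, so it is the neighbourhood that is null.\<close>

definition terminal :: "('m \<Rightarrow> 'm \<Rightarrow> bool) \<Rightarrow> 'm \<Rightarrow> 'm \<Rightarrow> bool" where
  "terminal Q i a \<longleftrightarrow> Q i a \<and> \<not> almost kap U (far Q i a)"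

context
  fixes Q
  assumes dQ: "dpred2 Q"
begin

lemma dP_pos_nbrs: "dT s \<Longrightarrow> dT t \<Longrightarrow> dP (\<lambda>v. pos_nbrs Q (s v) (t v))"
  by (rule dP2[of "pos_nbrs Q"]) (unfold pos_nbrs_def, intro dI dP2[OF dQ])

lemma dP_far: "dT s \<Longrightarrow> dT t \<Longrightarrow> dT u \<Longrightarrow> dP (\<lambda>v. far Q (s v) (t v) (u v))"
  by (rule dP3[of "far Q"]) (unfold far_def, intro dI dP_pos_nbrs)

lemma dP_terminal: "dT s \<Longrightarrow> dT t \<Longrightarrow> dP (\<lambda>v. terminal Q (s v) (t v))"
  by (rule dP2[of "terminal Q"]) (unfold terminal_def, intro dI dP_far dP2[OF dQ])

end

text \<open>The bad points of block \<open>j\<close>, adjacent to some earlier \<open>a\<close> with a null neighbourhood in block \<open>j\<close>, are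
  removed before the Galvin property is applied, because the sets it returns need not be
  positive.\<close>

lemma many_terminal_homog:
  assumes dQ: "dpred2 Q" and Qhs: "\<And>i a. i \<lhd> K \<Longrightarrow> Q i a \<Longrightarrow> block i a"
    and many: "almost kap U (\<lambda>i. i \<lhd> K \<and> pos_at i (terminal Q i))"
  shows homog
proof -
  note dP_Q [dI] = dP2[OF dQ]
  note dP_ds [dI] = dP_pos_nbrs[OF dQ] dP_far[OF dQ] dP_terminal[OF dQ]
  define bad where "bad j b \<longleftrightarrow> (\<exists>i\<in>el j. i \<lhd> K \<and> (\<exists>a\<in>el (mu i). \<not> pos_nbrs Q j a \<and> Q j b \<and> adj a b))" for j b
  have dP_bad [dI]: "dT s \<Longrightarrow> dT t \<Longrightarrow> dP (\<lambda>v. bad (s v) (t v))" for s t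
    by (rule dP2[of bad]) (unfold bad_def, intro dI)
  have not_bad: "almost (mu j) (Fl j) (\<lambda>b. \<not> bad j b)" if j: "j \<lhd> K" for j
  proof -
    have d1: "dP (\<lambda>v. \<forall>a\<in>el (mu (v 0)). v 0 \<lhd> K \<longrightarrow> \<not> (\<not> pos_nbrs Q j a \<and> Q j (v (Suc 0)) \<and> adj a (v (Suc 0))))"
      by (intro dI)
    \<comment> \<open>Completeness of \<open>Fl j\<close> is applied twice: over the earlier blocks,
      and over the fewer than \<open>mu j\<close> points of each.\<close>
    have "almost (mu j) (Fl j) (\<lambda>b. \<forall>i\<in>el j. \<forall>a\<in>el (mu i). i \<lhd> K \<longrightarrow> \<not> (\<not> pos_nbrs Q j a \<and> Q j b \<and> adj a b))"
    proof (rule normal_tail_complete[OF Nm[OF j] d1 K_mu[OF j]])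
      fix i assume i: "i \<lhd> j"
      show "almost (mu j) (Fl j) (\<lambda>b. \<forall>a\<in>el (mu i). i \<lhd> K \<longrightarrow> \<not> (\<not> pos_nbrs Q j a \<and> Q j b \<and> adj a b))"
      proof (cases "i \<lhd> K")
        case True
        have d2: "dP (\<lambda>v. i \<lhd> K \<longrightarrow> \<not> (\<not> pos_nbrs Q j (v 0) \<and> Q j (v (Suc 0)) \<and> adj (v 0) (v (Suc 0))))"
          by (intro dI)
        have "mu i \<lhd> mu j" using ord_trans[OF mu_ord[OF j] mu_nu[OF True j i] nu_mu[OF j]] .
        then show ?thesis
        proof (rule normal_tail_complete[OF Nm[OF j] d2])
          fix a
          show "almost (mu j) (Fl j) (\<lambda>b. i \<lhd> K \<longrightarrow> \<not> (\<not> pos_nbrs Q j a \<and> Q j b \<and> adj a b))"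
          proof (cases "pos_nbrs Q j a")
            case False
            then have "almost (mu j) (Fl j) (\<lambda>b. \<not> (Q j b \<and> adj a b))"
              unfolding pos_nbrs_def pos_def by blast
            then show ?thesis using True False by simp
          qed (simp add: almost_all[OF mu_filter[OF j]])
        qed
      qed (simp add: almost_all[OF mu_filter[OF j]])
    qed
    moreover have "(\<lambda>b. \<forall>i\<in>el j. \<forall>a\<in>el (mu i). i \<lhd> K \<longrightarrow> \<not> (\<not> pos_nbrs Q j a \<and> Q j b \<and> adj a b)) = (\<lambda>b. \<not> bad j b)"
      unfolding bad_def by (auto simp: fun_eq_iff)
    ultimately show ?thesis by simp
  qed
  define tg where "tg i a \<longleftrightarrow> terminal Q i a \<and> \<not> bad i a" for i a
  have dP_tg [dI]: "dT s \<Longrightarrow> dT t \<Longrightarrow> dP (\<lambda>v. tg (s v) (t v))" for s t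
    by (rule dP2[of tg]) (unfold tg_def, intro dI)
  define G where "G i \<longleftrightarrow> i \<lhd> K \<and> pos_at i (tg i)" for i
  have dP_G [dI]: "dT s \<Longrightarrow> dP (\<lambda>v. G (s v))" for s
    by (rule dP1[of G]) (unfold G_def, intro dI)
  have G: "almost kap U G"
  proof (rule almost_mono[OF U_filter _ _ many])
    fix i assume i: "i \<lhd> K \<and> pos_at i (terminal Q i)"
    have d: "dP (\<lambda>v. terminal Q i (v 0))" "dP (\<lambda>v. \<not> bad i (v 0))" by (intro dI)+
    have "pos_at i (\<lambda>a. terminal Q i a \<and> \<not> bad i a)"
      using pos_conj_almost[OF mu_filter d _ not_bad] i by blast
    then show "G i" using i unfolding G_def tg_def by blast
  qed (intro dI)+
  \<comment> \<open>For each \<open>x\<close> the least suitable vertex above it is taken. Different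
    \<open>x\<close> may share a vertex; the Galvin property admits such repetitions.\<close>
  define nx where "nx i x = least (\<lambda>a. a \<lhd> mu i \<and> tg i a \<and> x \<lhd> a)" for i x
  have dT_nx [dI]: "dT s \<Longrightarrow> dT t \<Longrightarrow> dT (\<lambda>v. nx (s v) (t v))" for s t
    by (rule dT2[of nx]) (unfold nx_def, intro dI)
  have nx: "nx i x \<lhd> mu i \<and> tg i (nx i x) \<and> x \<lhd> nx i x" if i: "G i" and x: "x \<lhd> mu i" for i x
  proof -
    have iK: "i \<lhd> K" using i unfolding G_def by blast
    have d: "dP (\<lambda>v. tg i (v 0))" by (intro dI)
    have d': "dP (\<lambda>v. v 0 \<lhd> mu i \<and> tg i (v 0) \<and> x \<lhd> v 0)" by (intro dI)
    obtain a where a: "a \<lhd> mu i \<and> tg i a \<and> x \<lhd> a"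
      using pos_unbounded[OF Nm[OF iK] d _ x] i unfolding G_def by blast
    then have "ord a" using ord_mem[OF mu_ord[OF iK]] by blast
    from least_P[OF d' this a] show ?thesis unfolding nx_def .
  qed
  define Ca where "Ca i a = sep kap (\<lambda>j. \<not> far Q i a j)" for i a
  have dT_Ca [dI]: "dT s \<Longrightarrow> dT t \<Longrightarrow> dT (\<lambda>v. Ca (s v) (t v))" for s t
    by (rule dT2[of Ca]) (unfold Ca_def, intro dI)
  have eCa: "el (Ca i a) = {j \<in> el kap. \<not> far Q i a j}" for i a
    unfolding Ca_def by (rule elts_sep) (intro dI)
  have CaU: "Ca i a \<lhd> U" if "tg i a" for i a
  proof -
    have "dP (\<lambda>v. far Q i a (v 0))" by (intro dI)
    from ultra[OF UF this] have "almost kap U (far Q i a) \<or> almost kap U (\<lambda>j. \<not> far Q i a j)" .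
    moreover have "\<not> almost kap U (far Q i a)" using that unfolding tg_def terminal_def by blast
    ultimately have "almost kap U (\<lambda>j. \<not> far Q i a j)" by blast
    then show ?thesis unfolding Ca_def almost_def .
  qed
  define Cs where "Cs i = fn (\<lambda>x. Ca i (nx i x)) (mu i)" for i
  have dT_Cs: "dfun Cs" unfolding Cs_def by (intro dI)
  define Xd where "Xd i D = sep kap (\<lambda>j. \<forall>y\<in>el (mu i). j \<lhd> ap D y)" for i D
  have dT_Xd: "dfun2 Xd" unfolding Xd_def by (intro dI)
  \<comment> \<open>\<open>R\<close> retains the consequences of the Galvin property without the
    index map, so each decoded set can be tested as a candidate on its own.\<close>
  define R where "R i D \<longleftrightarrow> Xd i D \<lhd> U \<and>
    (\<forall>x\<in>el (mu i). \<exists>y\<in>el (mu i). x \<lhd> y \<and> el (Xd i D) \<subseteq> el (Ca i (nx i y)))" for i D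
  have dR: "dpred2 R" unfolding R_def by (intro dI dT2[OF dT_Xd])
  have exR: "\<exists>D. definable_from E (Cs i) D \<and> R i D" if "i \<lhd> sep kap G" for i
  proof -
    have "el (sep kap G) = {i \<in> el kap. G i}" by (rule elts_sep) (intro dI)
    then have i: "G i" using that by blast
    have iK: "i \<lhd> K" using i unfolding G_def by blast
    have dc: "dT (\<lambda>v. Ca i (nx i (v 0)))" by (intro dI)
    have "is_map E (mu i) U (Cs i)"
      unfolding Cs_def by (rule is_map_fn[OF dc]) (use CaU nx[OF i] in blast)
    with gal[OF iK, unfolded Gal_Def_def, rule_format, of "Cs i"] have "\<exists>r D. is_map E (mu i) (mu i) r \<and>
      inj_on (app E r) (el (mu i)) \<and> is_seq E (mu i) D \<and>
      (\<forall>j\<in>el (mu i). app E D j = app E (Cs i) (app E r j)) \<and> definable_from E (Cs i) D \<and>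
      (\<exists>X\<in>el U. el X = (\<Inter>j\<in>el (mu i). el (app E D j)))" by (simp only:)
    then obtain r D where r: "is_map E (mu i) (mu i) r" "inj_on (app E r) (el (mu i))"
      and D: "is_seq E (mu i) D" "\<forall>j\<in>el (mu i). app E D j = app E (Cs i) (app E r j)"
      and def: "definable_from E (Cs i) D"
      and X: "\<exists>X\<in>el U. el X = (\<Inter>j\<in>el (mu i). el (app E D j))"
      by (elim exE conjE)
    have rs: "is_seq E (mu i) r" using r(1) unfolding is_map_def by blast
    have rap: "app E r y = ap r y" if "y \<lhd> mu i" for y using app_eq_ap[OF rs that] .
    have rmu: "ap r y \<lhd> mu i" if "y \<lhd> mu i" for y
      using r(1) that rap unfolding is_map_def by metis
    have Dap: "ap D y = Ca i (nx i (ap r y))" if y: "y \<lhd> mu i" for y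
      using D(2) y app_eq_ap[OF D(1) y] rap[OF y] app_fn[OF dc rmu[OF y]] unfolding Cs_def by simp
    obtain X where X: "X \<lhd> U" "el X = (\<Inter>j\<in>el (mu i). el (app E D j))" using X by blast
    have dX: "dP (\<lambda>v. \<forall>y\<in>el (mu i). v 0 \<lhd> ap D y)" by (intro dI)
    have eX: "el (Xd i D) = {j \<in> el kap. \<forall>y\<in>el (mu i). j \<lhd> ap D y}"
      unfolding Xd_def by (rule elts_sep[OF dX])
    have "el X \<subseteq> el kap" using X(1) U_filter unfolding is_filter_def by blast
    moreover have "el X = {j. \<forall>y\<in>el (mu i). j \<lhd> ap D y}"
      unfolding X(2) using app_eq_ap[OF D(1)] by auto
    ultimately have "X = Xd i D" by (intro set_ext) (auto simp: eX)
    then have XU: "Xd i D \<lhd> U" using X(1) by simp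
    have "\<exists>y\<in>el (mu i). x \<lhd> y \<and> el (Xd i D) \<subseteq> el (Ca i (nx i y))" if x: "x \<lhd> mu i" for x
    proof -
      have sx: "suc x \<lhd> mu i" using normal_tail_suc[OF Nm[OF iK] x] .
      have dr: "dT (\<lambda>v. ap r (v 0))" by (intro dI)
      have "inj_on (\<lambda>y. ap r y) (el (mu i))" using r(2) rap by (simp add: inj_on_def)
      \<comment> \<open>An injective index map cannot send the cardinal \<open>mu i\<close> into the
        smaller ordinal \<open>suc x\<close>, so the selected indices are unbounded.\<close>
      from card_no_inj[OF mu_card[OF iK] sx dr this]
      obtain y where y: "y \<lhd> mu i" "\<not> ap r y \<lhd> suc x" by blast
      have "x \<lhd> ap r y"
        using y(2) ord_linear[OF ord_mem[OF mu_ord[OF iK] x] ord_mem[OF mu_ord[OF iK] rmu[OF y(1)]]]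
        by auto
      moreover have "el (Xd i D) \<subseteq> el (Ca i (nx i (ap r y)))"
        unfolding eX Dap[OF y(1), symmetric] using y(1) by blast
      ultimately show ?thesis using rmu[OF y(1)] by blast
    qed
    then show ?thesis using def XU unfolding R_def by blast
  qed
  have XdU: "Xd i D \<lhd> U" if "i \<lhd> sep kap G" "R i D" for i D using that unfolding R_def by blast
  have "\<exists>W. dfun W \<and>
    (\<forall>i\<in>el (sep kap G). W i \<lhd> U \<and> (\<exists>D. R i D \<and> el (W i) \<subseteq> el (Xd i D)))"
    by (rule definable_choice[OF N omk dT_Cs dR dT_Xd exR XdU])
  then obtain W where dW: "dfun W"
    and W0: "\<forall>i\<in>el (sep kap G). W i \<lhd> U \<and> (\<exists>D. R i D \<and> el (W i) \<subseteq> el (Xd i D))"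
    by (elim exE conjE)
  note dT_W [dI] = dT1[OF dW]
  have "el (sep kap G) = {i \<in> el kap. G i}" by (rule elts_sep) (intro dI)
  then have W: "W i \<lhd> U" "\<exists>D. R i D \<and> el (W i) \<subseteq> el (Xd i D)" if "i \<lhd> kap" "G i" for i
    using W0 that by blast+
  define Z where "Z i a \<longleftrightarrow> a \<lhd> mu i \<and> tg i a \<and> el (W i) \<subseteq> el (Ca i a)" for i a
  have dZ: "dpred2 Z" unfolding Z_def by (intro dI)
  \<comment> \<open>For \<open>i\<close> in \<open>H\<close> and an earlier \<open>i'\<close> in
    \<open>H\<close>, membership of \<open>i\<close> in \<open>W i'\<close> puts \<open>i\<close>
    into \<open>Ca i' a\<close> for every vertex \<open>a\<close> kept in block \<open>i'\<close>.
    Such an \<open>a\<close> has a null neighbourhood in block \<open>i\<close>, and the vertices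
    kept there avoid it.\<close>
  define H where "H i \<longleftrightarrow> G i \<and> (\<forall>i'\<in>el i. G i' \<longrightarrow> i \<lhd> W i')" for i
  have dH: "dpred H" unfolding H_def by (intro dI)
  have H: "almost kap U H"
    unfolding H_def
  proof (rule almost_conj[OF U_filter _ _ G])
    have d: "dP (\<lambda>v. G (v 0) \<longrightarrow> v (Suc 0) \<lhd> W (v 0))" by (intro dI)
    show "almost kap U (\<lambda>i. \<forall>i'\<in>el i. G i' \<longrightarrow> i \<lhd> W i')"
    proof (rule normal_tail_diag[OF N d])
      fix i' assume i': "i' \<lhd> kap"
      show "almost kap U (\<lambda>i. G i' \<longrightarrow> i \<lhd> W i')"
      proof (cases "G i'")
        case True
        then show ?thesis using almost_of_mem[OF U_filter W(1)[OF i']] by simp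
      qed (simp add: almost_all[OF U_filter])
    qed
  qed (intro dI)+
  show ?thesis
  proof (rule homog_of_unbounded[OF dH dZ H])
    fix i assume "H i"
    then show "i \<lhd> K" unfolding H_def G_def by blast
  next
    fix i a assume "Z i a"
    then show "a \<lhd> mu i" unfolding Z_def by blast
  next
    fix i x assume i: "i \<lhd> kap" "H i" and x: "x \<lhd> mu i"
    have Gi: "G i" using i(2) unfolding H_def by blast
    obtain D where D: "R i D" "el (W i) \<subseteq> el (Xd i D)" using W(2)[OF i(1) Gi] by blast
    then obtain y where y: "y \<lhd> mu i" "x \<lhd> y" "el (W i) \<subseteq> el (Ca i (nx i y))"
      using x unfolding R_def by blast
    have iK: "i \<lhd> K" using Gi unfolding G_def by blast
    have "ord (nx i y)" using ord_mem[OF mu_ord[OF iK]] nx[OF Gi y(1)] by blast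
    then have "x \<lhd> nx i y" using nx[OF Gi y(1)] ord_trans y(2) by blast
    then show "\<exists>a. Z i a \<and> x \<lhd> a" unfolding Z_def using nx[OF Gi y(1)] y(3) by blast
  next
    fix i j a b
    assume i: "i \<lhd> kap" "H i" and j: "j \<lhd> kap" "H j" and ij: "i = j \<or> i \<lhd> j"
      and a: "Z i a" and b: "Z j b" and ab: "a \<noteq> b"
    have K: "i \<lhd> K" "j \<lhd> K" and G: "G i" using i(2) j(2) unfolding H_def G_def by blast+
    have Q: "Q i a" "Q j b" using a b unfolding Z_def tg_def terminal_def by blast+
    show "\<not> adj a b"
    proof (cases "i = j")
      case True
      then show ?thesis using block_not_adj[OF K(1)] Qhs[OF K(1) Q(1)] Qhs[OF K(2) Q(2)] ab by blast
    next
      case False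
      then have "i \<lhd> j" using ij by blast
      then have "j \<lhd> W i" using j(2) G unfolding H_def by blast
      then have "j \<lhd> Ca i a" using a unfolding Z_def by blast
      then have "\<not> pos_nbrs Q j a" unfolding eCa far_def using \<open>i \<lhd> j\<close> K(2) by blast
      moreover have "\<not> bad j b" using b unfolding Z_def tg_def by blast
      moreover have "a \<lhd> mu i" using a unfolding Z_def by blast
      ultimately show ?thesis unfolding bad_def using \<open>i \<lhd> j\<close> K(1) Q(2) by blast
    qed
  qed
qed

text \<open>A child of the clique \<open>t\<close> at \<open>(j, b)\<close> is a vertex by which \<open>t\<close> can be extended inside the
  neighbourhood of \<open>b\<close>; \<open>ranked j b x\<close> is the set of all \<open>t\<close> of rank at most \<open>x\<close> in the resulting tree.\<close>

definition child :: "'m \<Rightarrow> 'm \<Rightarrow> 'm \<Rightarrow> 'm \<Rightarrow> bool" where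
  "child j b t a \<longleftrightarrow> (\<exists>i\<in>el j. i \<lhd> K \<and> a \<lhd> mu i) \<and> adj a b \<and> (\<forall>x\<in>el t. x \<lhd> a \<and> adj x a)"

definition ranked :: "'m \<Rightarrow> 'm \<Rightarrow> 'm \<Rightarrow> 'm" where
  "ranked j b = rec (\<lambda>x I. sep (power lam) (\<lambda>t. \<forall>a\<in>el lam. child j b t a \<longrightarrow> (\<exists>Y\<in>el I. ins a t \<lhd> Y)))"

lemma dP_child [dI]: "dT s \<Longrightarrow> dT t \<Longrightarrow> dT u \<Longrightarrow> dT r \<Longrightarrow> dP (\<lambda>v. child (s v) (t v) (u v) (r v))"
  by (rule dP4[of child]) (unfold child_def, intro dI)

lemma dT_ranked [dI]: "dT s \<Longrightarrow> dT t \<Longrightarrow> dT u \<Longrightarrow> dT (\<lambda>v. ranked (s v) (t v) (u v))"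
  by (rule dT3[of ranked]) (unfold ranked_def, intro dI)

lemma mem_ranked:
  assumes x: "ord x"
  shows "t \<lhd> ranked j b x \<longleftrightarrow> el t \<subseteq> el lam \<and>
    (\<forall>a. a \<lhd> lam \<longrightarrow> child j b t a \<longrightarrow> (\<exists>y. y \<lhd> x \<and> ins a t \<lhd> ranked j b y))"
proof -
  have dg: "dT (\<lambda>v. sep (power lam) (\<lambda>t. \<forall>a\<in>el lam. child j b t a \<longrightarrow> (\<exists>Y\<in>el (v (Suc 0)). ins a t \<lhd> Y)))"
    by (intro dI)
  have df: "dT (\<lambda>v. ranked j b (v 0))" by (intro dI)
  have eq: "ranked j b x = sep (power lam) (\<lambda>t. \<forall>a\<in>el lam. child j b t a \<longrightarrow> (\<exists>Y\<in>el (img (ranked j b) x). ins a t \<lhd> Y))"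
    using rec_eq[OF dg x] unfolding ranked_def[symmetric] .
  have d: "dP (\<lambda>v. \<forall>a\<in>el lam. child j b (v 0) a \<longrightarrow> (\<exists>Y\<in>el (img (ranked j b) x). ins a (v 0) \<lhd> Y))"
    by (intro dI)
  have "t \<lhd> ranked j b x \<longleftrightarrow> el t \<subseteq> el lam \<and>
    (\<forall>a\<in>el lam. child j b t a \<longrightarrow> (\<exists>Y\<in>el (img (ranked j b) x). ins a t \<lhd> Y))"
    by (subst eq, subst elts_sep[OF d]) simp
  then show ?thesis unfolding elts_img[OF df] by blast
qed

section \<open>Ranks of cliques and their decrease\<close>

definition bad :: "'m \<Rightarrow> 'm \<Rightarrow> 'm \<Rightarrow> bool" where
  "bad j b t \<longleftrightarrow> el t \<subseteq> el lam \<and> \<not> (\<exists>x\<in>el (nu j). t \<lhd> ranked j b x)"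

lemma dP_bad [dI]: "dT s \<Longrightarrow> dT t \<Longrightarrow> dT u \<Longrightarrow> dP (\<lambda>v. bad (s v) (t v) (u v))"
  by (rule dP3[of bad]) (unfold bad_def, intro dI)

text \<open>Otherwise every child would have a rank below \<open>nu j\<close>. The children lie in
  the sets \<open>mu i\<close> for \<open>i\<close> below \<open>j\<close>; one bound on each
  \<open>mu i\<close>, then one over all \<open>i\<close>, both from regularity of
  \<open>nu j\<close>, would give \<open>t\<close> a rank below \<open>nu j\<close>.\<close>

lemma bad_child:
  assumes j: "j \<lhd> K" and t: "bad j b t"
  shows "\<exists>a. a \<lhd> lam \<and> child j b t a \<and> bad j b (ins a t)"
proof (rule ccontr)
  assume *: "\<not> ?thesis"
  have tl: "el t \<subseteq> el lam" using t unfolding bad_def by blast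
  obtain G where G: "normal_tail (nu j) G" using Nn[OF j] by blast
  have on: "ord (nu j)" by (rule nu_ord[OF j])
  define ra where "ra a = (if child j b t a then least (\<lambda>x. x \<lhd> nu j \<and> ins a t \<lhd> ranked j b x) else emp)" for a
  have dra: "dfun ra" unfolding ra_def by (intro dI)
  have dx: "dP (\<lambda>v. v 0 \<lhd> nu j \<and> ins a t \<lhd> ranked j b (v 0))" for a by (intro dI)
  have ra: "ra a \<lhd> nu j \<and> (child j b t a \<longrightarrow> ins a t \<lhd> ranked j b (ra a))" if a: "a \<lhd> lam" for a
  proof (cases "child j b t a")
    case True
    have "el (ins a t) \<subseteq> el lam" using tl a by simp
    then obtain x where x: "x \<lhd> nu j \<and> ins a t \<lhd> ranked j b x"
      using * True a unfolding bad_def by blast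
    then have "ord x" using ord_mem[OF on] by blast
    from least_P[OF dx this x] show ?thesis using True unfolding ra_def by simp
  qed (simp add: ra_def nu_emp[OF j])
  define yb where "yb i = (if i \<lhd> K then least (\<lambda>y. y \<lhd> nu j \<and> (\<forall>a\<in>el (mu i). ra a \<lhd> y)) else emp)" for i
  have dyb: "dfun yb" unfolding yb_def by (intro dI dT1[OF dra])
  have dy: "dP (\<lambda>v. v 0 \<lhd> nu j \<and> (\<forall>a\<in>el (mu i). ra a \<lhd> v 0))" for i by (intro dI dT1[OF dra])
  have yb: "yb i \<lhd> nu j \<and> (i \<lhd> K \<longrightarrow> (\<forall>a\<in>el (mu i). ra a \<lhd> yb i))" if i: "i \<lhd> j" for i
  proof (cases "i \<lhd> K")
    case True
    have "\<exists>y. y \<lhd> nu j \<and> (\<forall>a\<in>el (mu i). ra a \<lhd> y)"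
      by (rule normal_tail_regular[OF G dra mu_nu[OF True j i]]) (use ra mu_sub[OF True] in blast)
    then obtain y where y: "y \<lhd> nu j \<and> (\<forall>a\<in>el (mu i). ra a \<lhd> y)" by blast
    then have "ord y" using ord_mem[OF on] by blast
    from least_P[OF dy this y] show ?thesis using True unfolding yb_def by simp
  qed (simp add: yb_def nu_emp[OF j])
  obtain y where y: "y \<lhd> nu j" "\<forall>i\<in>el j. yb i \<lhd> y"
    using normal_tail_regular[OF G dyb K_nu[OF j]] yb by blast
  have oy: "ord y" using ord_mem[OF on y(1)] .
  have "t \<lhd> ranked j b y"
    unfolding mem_ranked[OF oy]
  proof (intro conjI allI impI tl)
    fix a assume a: "a \<lhd> lam" "child j b t a"
    then obtain i where i: "i \<lhd> j" "i \<lhd> K" "a \<lhd> mu i" unfolding child_def by blast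
    have "ra a \<lhd> yb i" using yb[OF i(1)] i by blast
    moreover have "yb i \<lhd> y" using y(2) i(1) by blast
    ultimately have "ra a \<lhd> y" by (rule ord_trans[OF oy])
    then show "\<exists>y'. y' \<lhd> y \<and> ins a t \<lhd> ranked j b y'" using ra[OF a(1)] a(2) by blast
  qed
  then show False using t y(1) unfolding bad_def by blast
qed

text \<open>An unranked set has an unranked child, so \<open>om\<close> steps add an increasing
  clique of neighbours of \<open>b\<close>. Its points lie below \<open>nu j\<close> and hence below
  \<open>b\<close>, which completes a forbidden clique.\<close>

lemma ranked_total:
  assumes j: "j \<lhd> K" and b: "block j b" and t: "el t \<subseteq> el lam"
  shows "\<exists>x. x \<lhd> nu j \<and> t \<lhd> ranked j b x"
proof (rule ccontr)
  assume "\<not> ?thesis"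
  then have typical: "bad j b t" using t unfolding bad_def by blast
  define Q where "Q I a \<longleftrightarrow> a \<lhd> lam \<and> child j b (cup t I) a \<and> bad j b (cup t (ins a I))" for I a
  have dQ: "dpred2 Q" unfolding Q_def by (intro dI)
  have db: "dP (\<lambda>v. bad j b (cup t (v 0)))" by (intro dI)
  have "cup t emp = t" by (rule set_ext) simp
  then have 0: "bad j b (cup t emp)" using typical by simp
  have ex: "\<exists>a. ord a \<and> Q I a" if I: "bad j b (cup t I)" for I
  proof -
    have "ins a (cup t I) = cup t (ins a I)" for a by (rule set_ext) simp
    then show ?thesis using bad_child[OF j I] ord_mem[OF lam] unfolding Q_def by auto
  qed
  have st: "bad j b (cup t (ins a I))" if "Q I a" for I a using that unfolding Q_def by blast
  from om_dependent_choice[of "\<lambda>I. bad j b (cup t I)" Q, OF db dQ 0 ex st]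
  obtain al where dal: "dfun al" and Qn: "\<And>n. n \<lhd> om \<Longrightarrow> Q (img al n) (al n)" by blast
  show False
  proof (rule no_clique[OF dal block_lam[OF j b]])
    fix n assume n: "n \<lhd> om"
    obtain i where i: "i \<lhd> j" "i \<lhd> K" "al n \<lhd> mu i" and a: "adj (al n) b"
      using Qn[OF n] unfolding Q_def child_def by blast
    have "al n \<lhd> nu j" using ord_trans[OF nu_ord[OF j] i(3) mu_nu[OF i(2) j i(1)]] .
    then have "al n \<lhd> b" using ord_trans[OF ord_mem[OF lam block_lam[OF j b]] _ block_nu[OF b]] by blast
    then show "al n \<lhd> b \<and> adj (al n) b" using a by blast
  next
    fix m n assume n: "n \<lhd> om" "m \<lhd> n"
    then have "al m \<lhd> cup t (img al n)" by (simp add: elts_img[OF dal])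
    then show "al m \<lhd> al n \<and> adj (al m) (al n)"
      using Qn[OF n(1)] unfolding Q_def child_def by blast
  qed
qed

definition nbr :: "'m \<Rightarrow> 'm \<Rightarrow> 'm \<Rightarrow> bool" where
  "nbr j t b \<longleftrightarrow> block j b \<and> (\<forall>x\<in>el t. adj x b)"

text \<open>The rank at \<open>(j, b)\<close> varies with \<open>b\<close>. This is the least bound
  valid for positively many common neighbours, a single ordinal for each block.\<close>

definition rank :: "'m \<Rightarrow> 'm \<Rightarrow> 'm" where
  "rank j t = least (\<lambda>x. pos_at j (\<lambda>b. nbr j t b \<and> t \<lhd> ranked j b x))"

text \<open>Keeping \<open>t\<close> inside one \<open>mu i\<close> ensures that all vertices of
  later blocks lie above it.\<close>

definition good :: "'m \<Rightarrow> bool" where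
  "good t \<longleftrightarrow> (\<exists>i\<in>el K. el t \<subseteq> el (mu i)) \<and> almost kap U (\<lambda>j. j \<lhd> K \<and> pos_at j (nbr j t))"

lemma dP_nbr [dI]: "dT s \<Longrightarrow> dT t \<Longrightarrow> dT u \<Longrightarrow> dP (\<lambda>v. nbr (s v) (t v) (u v))"
  by (rule dP3[of nbr]) (unfold nbr_def, intro dI)

lemma dT_rank [dI]: "dT s \<Longrightarrow> dT t \<Longrightarrow> dT (\<lambda>v. rank (s v) (t v))"
  by (rule dT2[of rank]) (unfold rank_def, intro dI)

lemma dP_good [dI]: "dT s \<Longrightarrow> dP (\<lambda>v. good (s v))"
  by (rule dP1[of good]) (unfold good_def, intro dI)

lemma good_lam: "good t \<Longrightarrow> el t \<subseteq> el lam"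
  unfolding good_def using mu_sub by blast

lemma dP_rank: "dP (\<lambda>v. pos_at j (\<lambda>b. nbr j t b \<and> t \<lhd> ranked j b (v 0)))"
  by (intro dI)

lemma rank_le:
  assumes j: "j \<lhd> K" and x: "x \<lhd> nu j" "pos_at j (\<lambda>b. nbr j t b \<and> t \<lhd> ranked j b x)"
  shows "rank j t = x \<or> rank j t \<lhd> x" "rank j t \<lhd> nu j"
    "pos_at j (\<lambda>b. nbr j t b \<and> t \<lhd> ranked j b (rank j t))"
proof -
  define P where "P x \<longleftrightarrow> pos_at j (\<lambda>b. nbr j t b \<and> t \<lhd> ranked j b x)" for x
  have r: "rank j t = least P" unfolding rank_def P_def ..
  have d: "dpred P" unfolding P_def by (intro dI)
  have o: "ord x" using ord_mem[OF nu_ord[OF j] x(1)] .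
  have "P x" unfolding P_def by (rule x(2))
  from least_le[of P x, OF d o this] least_P[of P x, OF d o this]
  have "rank j t = x \<or> rank j t \<lhd> x" "P (rank j t)" unfolding r by blast+
  then show 1: "rank j t = x \<or> rank j t \<lhd> x" and "pos_at j (\<lambda>b. nbr j t b \<and> t \<lhd> ranked j b (rank j t))"
    unfolding P_def by blast+
  show "rank j t \<lhd> nu j" using 1 x(1) ord_trans[OF nu_ord[OF j]] by blast
qed

text \<open>Fewer than \<open>mu j\<close> ranks are possible, so completeness of
  \<open>Fl j\<close> leaves one of them on a positive set.\<close>

lemma pos_rank_split:
  assumes j: "j \<lhd> K" and x: "x \<lhd> mu j"
    and P: "pos_at j P" "dpred P"
    and sub: "\<And>b. b \<lhd> mu j \<Longrightarrow> P b \<Longrightarrow> nbr j t b \<and> (\<exists>y\<in>el x. t \<lhd> ranked j b y)"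
  shows "\<exists>y. y \<lhd> x \<and> pos_at j (\<lambda>b. nbr j t b \<and> t \<lhd> ranked j b y)"
proof (rule pos_split[OF Nm[OF j] _ x])
  show "pos_at j (\<lambda>b. \<exists>y\<in>el x. nbr j t b \<and> t \<lhd> ranked j b y)"
    by (rule pos_mono[OF mu_filter[OF j] P(2) _ P(1)]) (intro dI, use sub in blast)
qed (intro dI)

lemma rank:
  assumes j: "j \<lhd> K" and t: "el t \<subseteq> el lam" and P: "pos_at j (nbr j t)"
  shows "rank j t \<lhd> nu j" "pos_at j (\<lambda>b. nbr j t b \<and> t \<lhd> ranked j b (rank j t))"
proof -
  have d: "dP (\<lambda>v. nbr j t (v 0))" by (intro dI)
  have "\<exists>y. y \<lhd> nu j \<and> pos_at j (\<lambda>b. nbr j t b \<and> t \<lhd> ranked j b y)"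
  proof (rule pos_rank_split[OF j nu_mu[OF j] P d])
    fix b assume b: "nbr j t b"
    then have "block j b" unfolding nbr_def by blast
    from ranked_total[OF j this t] b show "nbr j t b \<and> (\<exists>y\<in>el (nu j). t \<lhd> ranked j b y)" by blast
  qed
  then obtain x where "x \<lhd> nu j" "pos_at j (\<lambda>b. nbr j t b \<and> t \<lhd> ranked j b x)" by blast
  from rank_le(2,3)[OF j this] show "rank j t \<lhd> nu j"
    "pos_at j (\<lambda>b. nbr j t b \<and> t \<lhd> ranked j b (rank j t))" .
qed

text \<open>\<open>Q j\<close> consists of the common neighbours at which \<open>t\<close> has rank
  at most \<open>rank j t\<close>. Since \<open>homog\<close> fails, almost all blocks have only
  null many terminal vertices; a non-terminal vertex of \<open>Q i\<close>, in a block above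
  \<open>t\<close>, is the extension.\<close>

lemma good_extend:
  assumes nh: "\<not> homog" and t: "good t"
  shows "\<exists>a. a \<lhd> lam \<and> good (ins a t) \<and> almost kap U (\<lambda>j. rank j (ins a t) \<lhd> rank j t)"
proof -
  define Q where "Q j b \<longleftrightarrow> nbr j t b \<and> t \<lhd> ranked j b (rank j t)" for j b
  have dQ: "dpred2 Q" unfolding Q_def by (intro dI)
  note dP_Q [dI] = dP2[OF dQ]
  note dP_ds [dI] = dP_pos_nbrs[OF dQ] dP_far[OF dQ] dP_terminal[OF dQ]
  have tl: "el t \<subseteq> el lam" by (rule good_lam[OF t])
  obtain i0 where i0: "i0 \<lhd> K" "el t \<subseteq> el (mu i0)" using t unfolding good_def by blast
  have g: "almost kap U (\<lambda>j. j \<lhd> K \<and> pos_at j (nbr j t))" using t unfolding good_def by blast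
  have "\<not> almost kap U (\<lambda>i. i \<lhd> K \<and> pos_at i (terminal Q i))"
    using many_terminal_homog[OF dQ] nh unfolding Q_def nbr_def by blast
  moreover have dA: "dP (\<lambda>v. v 0 \<lhd> K \<and> pos (mu (v 0)) (Fl (v 0)) (terminal Q (v 0)))" by (intro dI)
  ultimately have num: "almost kap U (\<lambda>i. \<not> (i \<lhd> K \<and> pos_at i (terminal Q i)))"
    using ultra[OF UF dA] by (elim disjE) simp_all
  have dB: "dP (\<lambda>v. v 0 \<lhd> K \<and> pos (mu (v 0)) (Fl (v 0)) (nbr (v 0) t))" by (intro dI)
  have dC: "dP (\<lambda>v. i0 \<lhd> v 0)" by (intro dI)
  define B where "B i \<longleftrightarrow> \<not> (i \<lhd> K \<and> pos_at i (terminal Q i)) \<and> (i \<lhd> K \<and> pos_at i (nbr i t))" for i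
  have dBB: "dpred B" unfolding B_def by (intro dI)
  have "almost kap U B" unfolding B_def by (rule almost_conj[OF U_filter dP_neg[OF dA] dB num g])
  from almost_conj[OF U_filter dBB dC this normal_tail_tail[OF N K_sub[OF i0(1)]]]
  have "\<exists>i. i \<lhd> kap \<and> (B i \<and> i0 \<lhd> i)" by (rule almost_ex[OF U_filter dP_conj[OF dBB dC]])
  then obtain i where B: "B i" "i0 \<lhd> i" by blast
  then have i: "i \<lhd> K" "pos_at i (nbr i t)" "\<not> pos_at i (terminal Q i)" "i0 \<lhd> i"
    unfolding B_def by blast+
  have Qi: "pos_at i (Q i)" using rank(2)[OF i(1) tl i(2)] unfolding Q_def .
  have "almost (mu i) (Fl i) (\<lambda>a. \<not> terminal Q i a)" using i(3) unfolding pos_def by blast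
  moreover have "dP (\<lambda>v. Q i (v 0))" "dP (\<lambda>v. \<not> terminal Q i (v 0))" by (intro dI)+
  ultimately have "pos_at i (\<lambda>a. Q i a \<and> \<not> terminal Q i a)"
    by (intro pos_conj_almost[OF mu_filter[OF i(1)] _ _ Qi])
  from pos_ex[OF mu_filter[OF i(1)] this]
  obtain a where a: "a \<lhd> mu i" "Q i a" "almost kap U (far Q i a)" unfolding terminal_def by blast
  have al: "a \<lhd> lam" by (rule mu_sub[OF i(1) a(1)])
  have oa: "ord a" by (rule ord_mem[OF lam al])
  have ha: "block i a" "\<forall>x\<in>el t. adj x a" using a(2) unfolding Q_def nbr_def by blast+
  have ta: "x \<lhd> a" if "x \<lhd> t" for x
  proof -
    have "mu i0 \<lhd> a" using ord_trans[OF oa mu_nu[OF i0(1) i(1) i(4)] block_nu[OF ha(1)]] .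
    then show ?thesis using ord_trans[OF oa _ \<open>mu i0 \<lhd> a\<close>] i0(2) that by blast
  qed
  \<comment> \<open>At such \<open>j\<close>, positively many \<open>b\<close> in \<open>Q j\<close>
    are adjacent to \<open>a\<close>, and for them \<open>a\<close> is a child of \<open>t\<close>.
    So \<open>ins a t\<close> has a rank strictly below \<open>rank j t\<close> at each of these
    \<open>b\<close>, and \<open>pos_rank_split\<close> makes one value work on a positive
    set.\<close>
  have key: "pos_at j (nbr j (ins a t)) \<and> rank j (ins a t) \<lhd> rank j t"
    if j: "far Q i a j" and jB: "pos_at j (nbr j t)" for j
  proof -
    have jK: "j \<lhd> K" and ij: "i \<lhd> j" and P: "pos_at j (\<lambda>b. Q j b \<and> adj a b)"
      using j unfolding far_def pos_nbrs_def by blast+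
    have r: "rank j t \<lhd> nu j" by (rule rank(1)[OF jK tl jB])
    have orr: "ord (rank j t)" by (rule ord_mem[OF nu_ord[OF jK] r])
    have sub: "nbr j (ins a t) b \<and> (\<exists>y\<in>el (rank j t). ins a t \<lhd> ranked j b y)" if b: "Q j b \<and> adj a b" for b
    proof
      show "nbr j (ins a t) b" using b unfolding Q_def nbr_def by simp
      have "child j b t a" unfolding child_def using ij i(1) a(1) b ta ha(2) by blast
      then show "\<exists>y\<in>el (rank j t). ins a t \<lhd> ranked j b y"
        using b al unfolding Q_def mem_ranked[OF orr] by blast
    qed
    have dp: "dP (\<lambda>v. Q j (v 0) \<and> adj a (v 0))" by (intro dI)
    have rmu: "rank j t \<lhd> mu j" by (rule ord_trans[OF mu_ord[OF jK] r nu_mu[OF jK]])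
    have "\<exists>y. y \<lhd> rank j t \<and> pos_at j (\<lambda>b. nbr j (ins a t) b \<and> ins a t \<lhd> ranked j b y)"
      by (rule pos_rank_split[OF jK rmu P dp]) (rule sub)
    then obtain y where y: "y \<lhd> rank j t" "pos_at j (\<lambda>b. nbr j (ins a t) b \<and> ins a t \<lhd> ranked j b y)"
      by blast
    have ynu: "y \<lhd> nu j" by (rule ord_trans[OF nu_ord[OF jK] y(1) r])
    have "rank j (ins a t) \<lhd> rank j t"
      using rank_le(1)[OF jK ynu y(2)] y(1) ord_trans[OF orr] by blast
    moreover have "dP (\<lambda>v. nbr j (ins a t) (v 0))" by (intro dI)
    then have "pos_at j (nbr j (ins a t))"
      by (rule pos_mono[OF mu_filter[OF jK] dp _ P]) (use sub in blast)
    ultimately show ?thesis by blast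
  qed
  have dF: "dP (\<lambda>v. far Q i a (v 0))" by (intro dI)
  have both: "almost kap U (\<lambda>j. far Q i a j \<and> (j \<lhd> K \<and> pos_at j (nbr j t)))"
    by (rule almost_conj[OF U_filter dF dB a(3) g])
  have "almost kap U (\<lambda>j. rank j (ins a t) \<lhd> rank j t)"
    by (rule almost_mono[OF U_filter dP_conj[OF dF dB] _ both]) (intro dI, use key in blast)
  moreover have "almost kap U (\<lambda>j. j \<lhd> K \<and> pos_at j (nbr j (ins a t)))"
    by (rule almost_mono[OF U_filter dP_conj[OF dF dB] _ both]) (intro dI, use key in blast)
  moreover have "el (ins a t) \<subseteq> el (mu i)"
  proof -
    have "mu i0 \<lhd> mu i"
      by (rule ord_trans[OF mu_ord[OF i(1)] mu_nu[OF i0(1) i(1) i(4)] nu_mu[OF i(1)]])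
    then show ?thesis using a(1) i0(2) ord_trans[OF mu_ord[OF i(1)]] by auto
  qed
  ultimately show ?thesis using al i(1) unfolding good_def by blast
qed

text \<open>Otherwise the ranks would decrease along \<open>om\<close> extensions for almost all \<open>j\<close> at once.\<close>

lemma homog: homog
proof (rule ccontr)
  assume nh: "\<not> homog"
  define P where "P I a \<longleftrightarrow> a \<lhd> lam \<and> good (ins a I) \<and> almost kap U (\<lambda>j. rank j (ins a I) \<lhd> rank j I)" for I a
  have dP: "dpred2 P" unfolding P_def by (intro dI)
  have dK: "dP (\<lambda>v. v 0 \<lhd> K)" by (intro dI)
  have good_emp: "good emp"
  proof -
    obtain i where "i \<lhd> K" using almost_ex[OF U_filter dK K_big] by blast
    moreover have "almost kap U (\<lambda>j. j \<lhd> K \<and> pos_at j (nbr j emp))"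
    proof (rule almost_mono[OF U_filter dK _ K_big])
      fix j assume j: "j \<lhd> K"
      have "nbr j emp = block j" unfolding nbr_def by simp
      then show "j \<lhd> K \<and> pos_at j (nbr j emp)" using j block_pos by simp
    qed (intro dI)
    ultimately show ?thesis unfolding good_def by auto
  qed
  have dg: "dpred good" by (intro dI)
  have ex: "\<exists>a. ord a \<and> P I a" if "good I" for I
    using good_extend[OF nh that] ord_mem[OF lam] unfolding P_def by blast
  have st: "good (ins a I)" if "P I a" for I a using that unfolding P_def by blast
  from om_dependent_choice[of good P, OF dg dP good_emp ex st]
  obtain al where dal: "dfun al" and al: "\<And>n. n \<lhd> om \<Longrightarrow> P (img al n) (al n)" by blast
  have suc: "img al (ins n n) = ins (al n) (img al n)" for n
    by (rule set_ext) (simp add: elts_img[OF dal])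
  have d1: "dP (\<lambda>v. rank (v (Suc 0)) (img al (ins (v 0) (v 0))) \<lhd> rank (v (Suc 0)) (img al (v 0)))"
    by (intro dI dT1[OF dal])
  have "almost kap U (\<lambda>j. \<forall>n\<in>el om. rank j (img al (ins n n)) \<lhd> rank j (img al n))"
  proof (rule normal_tail_complete[OF N d1 omk])
    fix n assume n: "n \<lhd> om"
    show "almost kap U (\<lambda>j. rank j (img al (ins n n)) \<lhd> rank j (img al n))"
      using al[OF n] unfolding P_def suc by blast
  qed
  moreover have d2: "dP (\<lambda>v. \<forall>n\<in>el om. rank (v 0) (img al (ins n n)) \<lhd> rank (v 0) (img al n))"
    by (intro dI dT1[OF dal])
  ultimately obtain j where j: "\<forall>n\<in>el om. rank j (img al (ins n n)) \<lhd> rank j (img al n)"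
    using almost_ex[OF U_filter d2] by blast
  \<comment> \<open>For this single \<open>j\<close> the ranks would form a nonempty definable class
    of ordinals without a least element. The sequence \<open>al\<close> is definable, so this is
    refuted inside the model even when it is ill-founded.\<close>
  have d3: "dP (\<lambda>v. \<exists>n\<in>el om. v 0 = rank j (img al n))" by (intro dI dT1[OF dal])
  have o: "ord (rank j t)" for t unfolding rank_def by (rule ord_least'[OF dP_rank[of j t]])
  have "\<exists>n\<in>el om. rank j (img al emp) = rank j (img al n)" using emp_om by blast
  then have "\<exists>x. ord x \<and> (\<exists>n\<in>el om. x = rank j (img al n)) \<and>
    (\<forall>y. y \<lhd> x \<longrightarrow> \<not> (\<exists>n\<in>el om. y = rank j (img al n)))"
    by (rule ord_ex_least[OF d3 o])
  then obtain x where x: "\<exists>n\<in>el om. x = rank j (img al n)"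
    "\<And>y. y \<lhd> x \<Longrightarrow> \<not> (\<exists>n\<in>el om. y = rank j (img al n))" by blast
  then obtain n where n: "n \<lhd> om" "x = rank j (img al n)" by blast
  then have "rank j (img al (ins n n)) \<lhd> x" using j by blast
  then show False using x(2) suc_om[OF n(1)] by blast
qed

end

context zf_om
begin

section \<open>The theorem\<close>

text \<open>Passage from colourings to graphs: an increasing \<open>om\<close>-sequence of mutually
  adjacent vertices with a common neighbour on top is a set of type \<open>om1\<close> homogeneous
  in colour one.\<close>

lemma arrows_of_clique_free:
  assumes om1: "om1 = suc om" and lam: "ord lam"
    and blk: "\<And>adj. dpred2 adj \<Longrightarrow> (\<And>x y. adj x y \<Longrightarrow> adj y x) \<Longrightarrow>
      (\<And>f b. dfun f \<Longrightarrow> b \<lhd> lam \<Longrightarrow> (\<And>n. n \<lhd> om \<Longrightarrow> f n \<lhd> b \<and> adj (f n) b) \<Longrightarrow>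
        (\<And>m n. n \<lhd> om \<Longrightarrow> m \<lhd> n \<Longrightarrow> f m \<lhd> f n \<and> adj (f m) (f n)) \<Longrightarrow> False) \<Longrightarrow>
      \<exists>A. el A \<subseteq> el lam \<and> has_otp E A lam \<and> (\<forall>x\<in>el A. \<forall>y\<in>el A. x \<noteq> y \<longrightarrow> \<not> adj x y)"
  shows "arrows E lam lam om1"
  unfolding arrows_def is_zero_iff is_succ_iff
proof (intro allI impI)
  fix zero one two P c
  assume *: "zero = emp \<and> one = suc zero \<and> two = suc one \<and> el P = pairs E lam \<and> is_map E P two c"
  then have zero: "zero = emp" and one: "one = suc emp" and two: "two = suc one"
    and P: "el P = pairs E lam" and c: "is_map E P two c" by blast+
  have cs: "is_seq E P c" using c unfolding is_map_def by blast
  have cpair: "app E c (upair x y) = ap c (upair x y) \<and> (ap c (upair x y) = zero \<or> ap c (upair x y) = one)"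
    if "x \<lhd> lam" "y \<lhd> lam" "x \<noteq> y" for x y
  proof -
    have p: "upair x y \<lhd> P" unfolding P pairs_def using that by auto
    have "app E c (upair x y) \<lhd> two" using c p unfolding is_map_def by blast
    then show ?thesis using app_eq_ap[OF cs p] unfolding two one zero by auto
  qed
  have pairsE: "\<exists>x y. x \<lhd> B \<and> y \<lhd> B \<and> x \<noteq> y \<and> z = upair x y" if "z \<in> pairs E B" for z B
    using that upairI unfolding pairs_def by blast
  define adj where "adj x y \<longleftrightarrow> x \<noteq> y \<and> ap c (upair x y) = one" for x y
  have up: "upair x y = upair y x" for x y by (rule set_ext) auto
  have sym: "adj y x" if "adj x y" for x y using that up unfolding adj_def by metis
  have d: "dpred2 adj" unfolding adj_def by (intro dI)
  show "(\<exists>A. el A \<subseteq> el lam \<and> has_otp E A lam \<and> (\<forall>z\<in>pairs E A. app E c z = zero)) \<or>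
    (\<exists>B. el B \<subseteq> el lam \<and> has_otp E B om1 \<and> (\<forall>z\<in>pairs E B. app E c z = one))"
  proof (rule disjCI)
    assume nB: "\<not> (\<exists>B. el B \<subseteq> el lam \<and> has_otp E B om1 \<and> (\<forall>z\<in>pairs E B. app E c z = one))"
    have "\<exists>A. el A \<subseteq> el lam \<and> has_otp E A lam \<and> (\<forall>x\<in>el A. \<forall>y\<in>el A. x \<noteq> y \<longrightarrow> \<not> adj x y)"
    proof (rule blk[OF d sym])
      fix f b
      assume f: "dfun f" and b: "b \<lhd> lam" and fb: "\<And>n. n \<lhd> om \<Longrightarrow> f n \<lhd> b \<and> adj (f n) b"
        and ff: "\<And>m n. n \<lhd> om \<Longrightarrow> m \<lhd> n \<Longrightarrow> f m \<lhd> f n \<and> adj (f m) (f n)"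
      \<comment> \<open>The top vertex \<open>b\<close> is placed at position \<open>om\<close>, the
        last element of \<open>om1\<close>.\<close>
      define g where "g x = (if x \<lhd> om then f x else b)" for x
      have dg: "dfun g" unfolding g_def by (intro dI dT1[OF f])
      have main: "g x \<lhd> g y \<and> adj (g x) (g y)" if "y \<lhd> om1" "x \<lhd> y" for x y
      proof (cases "y \<lhd> om")
        case True
        then show ?thesis using ff[OF True that(2)] ord_trans[OF om_ord that(2) True] unfolding g_def by simp
      next
        case False
        then have "y = om" using that(1) unfolding om1 by simp
        then show ?thesis using fb[of x] that(2) unfolding g_def by simp
      qed
      have o1: "ord om1" unfolding om1 by simp
      define B where "B = img g om1"
      have B: "el B = g ` el om1" unfolding B_def by (rule elts_img[OF dg])
      have gl: "g x \<lhd> lam" for x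
        using b fb ord_trans[OF lam _ b] unfolding g_def by auto
      have lin: "x \<lhd> y \<or> x = y \<or> y \<lhd> x" if "x \<lhd> om1" "y \<lhd> om1" for x y
        using ord_linear ord_mem[OF o1] that by blast
      have "inj_on g (el om1)"
      proof (rule inj_onI)
        fix x y assume xy: "x \<lhd> om1" "y \<lhd> om1" "g x = g y"
        then show "x = y" using lin[OF xy(1,2)] main[OF xy(1), of y] main[OF xy(2), of x] by auto
      qed
      then have "bij_betw g (el om1) (el B)" unfolding bij_betw_def B by blast
      then have otp: "has_otp E B om1" by (rule has_otpI[OF o1 dg]) (use main in blast)
      have "app E c z = one" if zB: "z \<in> pairs E B" for z
      proof -
        obtain u w where "u \<lhd> B" "w \<lhd> B" "u \<noteq> w" "z = upair u w" using pairsE[OF zB] by blast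
        then obtain x y where xy: "x \<lhd> om1" "y \<lhd> om1" "g x \<noteq> g y" and z: "z = upair (g x) (g y)"
          unfolding B by blast
        have "adj (g x) (g y)" using lin[OF xy(1,2)] main[OF xy(1), of y] main[OF xy(2), of x] xy(3) sym by blast
        then show ?thesis using cpair[OF gl gl xy(3)] unfolding z adj_def by simp
      qed
      moreover have "el B \<subseteq> el lam" unfolding B using gl by blast
      ultimately show False using nB otp by blast
    qed
    then obtain A where A: "el A \<subseteq> el lam" "has_otp E A lam" and na: "\<forall>x\<in>el A. \<forall>y\<in>el A. x \<noteq> y \<longrightarrow> \<not> adj x y"
      by blast
    have "app E c z = zero" if zA: "z \<in> pairs E A" for z
    proof -
      obtain x y where xy: "x \<lhd> A" "y \<lhd> A" "x \<noteq> y" and z: "z = upair x y" using pairsE[OF zA] by blast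
      have "x \<lhd> lam" "y \<lhd> lam" using A(1) xy by blast+
      from cpair[OF this xy(3)] na xy show ?thesis unfolding z adj_def by auto
    qed
    then show "\<exists>A. el A \<subseteq> el lam \<and> has_otp E A lam \<and> (\<forall>z\<in>pairs E A. app E c z = zero)"
      using A by blast
  qed
qed

lemma singular_arrows:
  assumes om1: "om1 = suc om"
    and kap: "ord kap" and lam: "ord lam"
    and omk: "om \<lhd> kap" and cf: "is_cf E lam kap" and kl: "kap \<lhd> lam"
    and U: "normal_measure E kap U"
    and L: "cofinal_seq E kap lam L"
    and Lc: "\<And>i. i \<lhd> kap \<Longrightarrow> is_card E (app E L i)"
    and F: "is_seq E kap F"
    and nf: "\<And>i. i \<lhd> kap \<Longrightarrow> normal_filter E (app E L i) (app E F i) \<and>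
           dual_ideal_contains_small E (app E L i) (app E F i)"
    and gal: "\<And>i. i \<lhd> kap \<Longrightarrow> Gal_Def E U (app E L i)"
  shows "arrows E lam lam om1"
proof -
  have N: "normal_tail kap U" by (rule normal_measure_normal_tail[OF kap U])
  have UF: "is_ultrafilter E kap U" using U unfolding normal_measure_def by blast
  have Lm: "is_map E kap lam L" using L unfolding cofinal_seq_def by blast
  then have Ls: "is_seq E kap L" unfolding is_map_def by blast
  define ell where "ell i = ap L i" for i
  have dT_ell [dI]: "dT s \<Longrightarrow> dT (\<lambda>v. ell (s v))" for s unfolding ell_def by (intro dI)
  have ell: "app E L i = ell i" if "i \<lhd> kap" for i unfolding ell_def by (rule app_eq_ap[OF Ls that])
  have Fa: "app E F i = ap F i" if "i \<lhd> kap" for i by (rule app_eq_ap[OF F that])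
  have ell_lam: "ell i \<lhd> lam" if "i \<lhd> kap" for i
    using Lm ell[OF that] that unfolding is_map_def by metis
  have ell_ord: "ord (ell i)" if "i \<lhd> kap" for i using ord_mem[OF lam ell_lam[OF that]] .
  have ell_cof: "\<exists>i. i \<lhd> kap \<and> (a \<lhd> ell i \<or> a = ell i)" if al: "a \<lhd> lam" for a
  proof -
    obtain i where i: "i \<lhd> kap" "E a (app E L i) \<or> a = app E L i"
      using L al unfolding cofinal_seq_def by blast
    then show ?thesis using ell[OF i(1)] E_iff[of a "ell i"] by auto
  qed
  have bounded: "\<exists>a. a \<lhd> lam \<and> (\<forall>i\<in>el b. f i \<lhd> a)"
    if b: "b \<lhd> kap" and f: "dfun f" and fl: "\<And>i. i \<lhd> b \<Longrightarrow> f i \<lhd> lam" for b f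
  proof -
    have "\<not> cofinal_seq E b lam (fn f b)" using cf b unfolding is_cf_def by blast
    moreover have "is_map E b lam (fn f b)" by (rule is_map_fn[OF f fl])
    ultimately obtain a where a: "a \<lhd> lam"
      "\<And>i. i \<lhd> b \<Longrightarrow> \<not> (E a (app E (fn f b) i) \<or> a = app E (fn f b) i)"
      unfolding cofinal_seq_def by blast
    have "f i \<lhd> a" if i: "i \<lhd> b" for i
      using a(2)[OF i] ord_linear[OF ord_mem[OF lam a(1)] ord_mem[OF lam fl[OF i]]]
      unfolding app_fn[OF f i] using E_iff[of a "f i"] by blast
    then show ?thesis using a(1) by blast
  qed
  have "suc emp \<lhd> kap" using ord_trans[OF kap suc_om[OF emp_om] omk] .
  \<comment> \<open>A sequence of length one is shorter than the cofinality \<open>kap\<close>, so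
    the constant sequence with value \<open>kap\<close> is not cofinal; this gives a point of
    \<open>lam\<close> strictly above \<open>kap\<close>.\<close>
  from bounded[OF this dT_const[of kap] kl] obtain a where "a \<lhd> lam" "kap \<lhd> a" by auto
  then obtain p0 where "p0 \<lhd> kap" "a \<lhd> ell p0 \<or> a = ell p0" using ell_cof by blast
  then have p0: "p0 \<lhd> kap" "kap \<lhd> ell p0"
    using \<open>kap \<lhd> a\<close> ord_trans[OF ell_ord, of p0 kap a] by blast+
  have ex_p: "\<exists>p. p \<lhd> kap \<and> kap \<lhd> ell p \<and> (\<forall>i\<in>el (suc j). ell i \<lhd> ell p)" if j: "j \<lhd> kap" for j
  proof -
    have sj: "suc j \<lhd> kap" by (rule normal_tail_suc[OF N j])
    have dl: "dfun ell" by (intro dI)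
    have "ell i \<lhd> lam" if "i \<lhd> suc j" for i using ell_lam ord_trans[OF kap that sj] by blast
    from bounded[OF sj dl this] obtain a where a: "a \<lhd> lam" "\<forall>i\<in>el (suc j). ell i \<lhd> a" by blast
    obtain p1 where p1: "p1 \<lhd> kap" "a \<lhd> ell p1 \<or> a = ell p1" using ell_cof[OF a(1)] by blast
    then have "\<forall>i\<in>el (suc j). ell i \<lhd> ell p1" using a(2) ord_trans[OF ell_ord[OF p1(1)]] by blast
    moreover have "kap \<lhd> ell p1" if "ell p0 = ell p1 \<or> ell p0 \<lhd> ell p1"
      using that p0(2) ord_trans[OF ell_ord[OF p1(1)], of kap "ell p0"] by auto
    moreover have "\<forall>i\<in>el (suc j). ell i \<lhd> ell p0" if "ell p1 \<lhd> ell p0"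
      using that calculation(1) ord_trans[OF ell_ord[OF p0(1)], of _ "ell p1"] by blast
    ultimately show ?thesis
      using p0 p1(1) ord_linear[OF ell_ord[OF p0(1)] ell_ord[OF p1(1)]] by blast
  qed
  \<comment> \<open>\<open>suc j\<close> includes the index \<open>j\<close> itself, so one
    application leads strictly above every \<open>ell i\<close> with \<open>i\<close> up to
    \<open>j\<close>.\<close>
  define pp where "pp j = least (\<lambda>p. p \<lhd> kap \<and> kap \<lhd> ell p \<and> (\<forall>i\<in>el (suc j). ell i \<lhd> ell p))" for j
  have dT_pp [dI]: "dT s \<Longrightarrow> dT (\<lambda>v. pp (s v))" for s
    by (rule dT1[of pp]) (unfold pp_def, intro dI)
  have pp: "pp j \<lhd> kap \<and> kap \<lhd> ell (pp j) \<and> (\<forall>i\<in>el (suc j). ell i \<lhd> ell (pp j))" if j: "j \<lhd> kap" for j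
  proof -
    obtain p where p: "p \<lhd> kap \<and> kap \<lhd> ell p \<and> (\<forall>i\<in>el (suc j). ell i \<lhd> ell p)" using ex_p[OF j] by blast
    then have "ord p" using ord_mem[OF kap] by blast
    have d: "dP (\<lambda>v. v 0 \<lhd> kap \<and> kap \<lhd> ell (v 0) \<and> (\<forall>i\<in>el (suc j). ell i \<lhd> ell (v 0)))" by (intro dI)
    from least_P[OF d \<open>ord p\<close> p] show ?thesis unfolding pp_def .
  qed
  have ppk: "pp j \<lhd> kap" and kpp: "kap \<lhd> ell (pp j)" if "j \<lhd> kap" for j using pp[OF that] by blast+
  have ell_pp: "ell i \<lhd> ell (pp j)" if "j \<lhd> kap" "i = j \<or> i \<lhd> j" for i j
    using pp[OF that(1)] that(2) by auto
  \<comment> \<open>Two jumps provide the two cardinals needed for an index: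
    \<open>ell (pp j)\<close> serves as \<open>nu j\<close>, and \<open>ell (hh j)\<close> as the
    larger \<open>mu j\<close>.\<close>
  define hh where "hh j = pp (pp j)" for j
  have dT_hh [dI]: "dT s \<Longrightarrow> dT (\<lambda>v. hh (s v))" for s unfolding hh_def by (intro dI)
  have hhk: "hh j \<lhd> kap" if "j \<lhd> kap" for j unfolding hh_def by (rule ppk[OF ppk[OF that]])
  \<comment> \<open>The given sequence need not increase; on the closed unbounded set \<open>K\<close> the blocks do.\<close>
  define K where "K = sep kap (\<lambda>j. \<forall>i\<in>el j. hh i \<lhd> j)"
  have dK: "dP (\<lambda>v. \<forall>i\<in>el (v 0). hh i \<lhd> v 0)" by (intro dI)
  have K: "el K = {j \<in> el kap. \<forall>i\<in>el j. hh i \<lhd> j}" unfolding K_def by (rule elts_sep[OF dK])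
  have d: "dP (\<lambda>v. hh (v 0) \<lhd> v (Suc 0))" by (intro dI)
  have 1: "almost kap U (\<lambda>j. \<forall>i\<in>el j. hh i \<lhd> j)"
    by (rule normal_tail_diag[OF N d]) (rule normal_tail_tail[OF N hhk])
  have dKm: "dP (\<lambda>v. v 0 \<lhd> K)" by (intro dI)
  have K_big: "almost kap U (\<lambda>j. j \<lhd> K)"
    by (rule almost_mono[OF normal_tail_filter[OF N] dK dKm 1]) (simp add: K)
  have Kk: "j \<lhd> kap" if "j \<lhd> K" for j using that K by blast
  have om_ell: "om \<lhd> ell i" if "i \<lhd> kap" "kap \<lhd> ell i" for i
    using ord_trans[OF ell_ord[OF that(1)] omk that(2)] .
  have nfl: "normal_tail (ell i) (ap F i)" if "i \<lhd> kap" "kap \<lhd> ell i" for i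
    using normal_filter_normal_tail[OF ell_ord[OF that(1)] om_ell[OF that]] nf[OF that(1)]
    unfolding ell[OF that(1)] Fa[OF that(1)] by blast
  have ph: "ell (pp j) \<lhd> ell (hh j)" if "j \<lhd> kap" for j
    unfolding hh_def using ell_pp[OF ppk[OF that]] by blast
  have khh: "kap \<lhd> ell (hh j)" if "j \<lhd> kap" for j unfolding hh_def by (rule kpp[OF ppk[OF that]])
  show ?thesis
  proof (rule arrows_of_clique_free[OF om1 lam])
    fix adj
    assume A: "dpred2 adj" "\<And>x y. adj x y \<Longrightarrow> adj y x"
      "\<And>f b. dfun f \<Longrightarrow> b \<lhd> lam \<Longrightarrow> (\<And>n. n \<lhd> om \<Longrightarrow> f n \<lhd> b \<and> adj (f n) b) \<Longrightarrow>
        (\<And>m n. n \<lhd> om \<Longrightarrow> m \<lhd> n \<Longrightarrow> f m \<lhd> f n \<and> adj (f m) (f n)) \<Longrightarrow> False"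
    interpret blocks E om kap lam U K "\<lambda>j. ell (pp j)" "\<lambda>j. ell (hh j)" "\<lambda>j. ap F (hh j)" adj
    proof (unfold_locales, goal_cases)
      case (8 j)
      then show ?case by (rule Kk)
    next
      case 9
      show ?case by (rule K_big)
    next
      case (10 j)
      then have jk: "j \<lhd> kap" by (rule Kk)
      show ?case by (rule nfl[OF hhk[OF jk] khh[OF jk]])
    next
      case (11 j)
      then have jk: "j \<lhd> kap" by (rule Kk)
      show ?case using nfl[OF ppk[OF jk] kpp[OF jk]] by blast
    next
      case (12 j)
      then have jk: "j \<lhd> kap" by (rule Kk)
      show ?case by (rule kpp[OF jk])
    next
      case (13 j)
      then have jk: "j \<lhd> kap" by (rule Kk)
      show ?case by (rule ph[OF jk])
    next
      case (14 j)
      then have jk: "j \<lhd> kap" by (rule Kk)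
      show ?case by (rule ell_lam[OF hhk[OF jk]])
    next
      case (15 i j)
      \<comment> \<open>Closure of \<open>j\<close> under \<open>hh\<close> is what puts
        \<open>mu i\<close> below \<open>nu j\<close>.\<close>
      then have "hh i \<lhd> j" using K by blast
      then show ?case using ell_pp[OF Kk[OF 15(2)]] by blast
    next
      case (16 j)
      show ?case using Lc[OF hhk[OF Kk[OF 16]]] unfolding ell[OF hhk[OF Kk[OF 16]]] .
    next
      case (17 j)
      show ?case using gal[OF hhk[OF Kk[OF 17]]] unfolding ell[OF hhk[OF Kk[OF 17]]] .
    next
      case (18 t)
      obtain i where i: "i \<lhd> kap" "t \<lhd> ell i \<or> t = ell i" using ell_cof[OF 18] by blast
      have "t \<lhd> ell (hh j)" if j: "j \<lhd> K" "i \<lhd> j" for j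
      proof -
        have o: "ord (ell (hh j))" using ell_ord[OF hhk[OF Kk[OF j(1)]]] .
        have "ell i \<lhd> ell (hh j)"
          using ord_trans[OF o ell_pp[OF Kk[OF j(1)]] ph[OF Kk[OF j(1)]]] j(2) by blast
        then show ?thesis using i(2) ord_trans[OF o] by blast
      qed
      then show ?case using i(1) by blast
    qed (use lam N UF omk A in \<open>(assumption | intro dI | blast)+\<close>)
    show "\<exists>A. el A \<subseteq> el lam \<and> has_otp E A lam \<and> (\<forall>x\<in>el A. \<forall>y\<in>el A. x \<noteq> y \<longrightarrow> \<not> adj x y)"
      using homog unfolding homog_def .
  qed
qed

end

theorem theorem3p4:
  fixes E :: "'m \<Rightarrow> 'm \<Rightarrow> bool"
    and om om1 kap lam U L F :: 'm
  assumes "ZF_model E"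
    and "is_omega E om" and "is_succ E om om1"
    and "is_card E kap" and "is_card E lam"
    and "E om kap" and "is_cf E lam kap" and "E kap lam"
    and "normal_measure E kap U"
    and "cofinal_seq E kap lam L"
    and "\<And>i. i \<in> elts E kap \<Longrightarrow> is_card E (app E L i)"
    and "is_seq E kap F"
    and "\<And>i. i \<in> elts E kap \<Longrightarrow>
           normal_filter E (app E L i) (app E F i) \<and>
           dual_ideal_contains_small E (app E L i) (app E F i)"
    and "\<And>i. i \<in> elts E kap \<Longrightarrow> Gal_Def E U (app E L i)"
  shows "arrows E lam lam om1"
proof -
  interpret zf_om E om
    by unfold_locales (rule assms(1), rule assms(2))
  have "ord kap" "ord lam" using assms(4,5) unfolding is_card_def by blast+
  moreover have "om1 = ins om om" using assms(3) by simp
  moreover have "om \<in> elts E kap" "kap \<in> elts E lam" using assms(6,8) unfolding elts_def by blast+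
  ultimately show ?thesis
    by (intro singular_arrows[OF _ _ _ _ assms(7) _ assms(9-14)])
qed

end
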